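(* Let $G$ be a 3-dimensional complex-parallelizable non-Abelian solvable Lie group, that is, a simply-connected complex Lie group having a basis $\varphi^1,\varphi^2,\varphi^3$ of left-invariant holomorphic $(1,0)$-forms satisfying one of (I) $d\varphi^1=d\varphi^2=0,\quad d\varphi^3=\varphi^1\wedge\varphi^2$; (II) $d\varphi^1=0,\quad d\varphi^2=\varphi^1\wedge\varphi^2,\quad d\varphi^3=-\varphi^1\wedge\varphi^3$. Then $G$ has a Hermitian metric such that the holonomy of its Bismut connection is equal to $\mathrm{SU}(3)$.
   Context: For a Hermitian manifold $(M,J,g)$ with Kähler form $F(\cdot,\cdot)=g(J\cdot,\cdot)$ and Levi-Civita connection $\nabla^{LC}$, the Bismut connection $\nabla^B$ is the unique connection with $\nabla^Bg=0$, $\nabla^BJ=0$ and totally skew-symmetric torsion. Explicitly, $g(\nabla^B_XY,Z)=g(\nabla^{LC}_XY,Z)+\tfrac12T(X,Y,Z)$, where $T(X,Y,Z)=JdF(X,Y,Z)=dF(JX,JY,JZ)$. *)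

theory Defs
  imports "HOL-Analysis.Analysis" "HOL-Algebra.Group"
begin

section \<open>Smooth and holomorphic maps between open subsets of vector spaces\<close>

primrec Ck_on :: "nat \<Rightarrow> ('a::real_normed_vector \<Rightarrow> 'b::real_normed_vector) \<Rightarrow> 'a set \<Rightarrow> bool" where
  "Ck_on 0 f S \<longleftrightarrow> continuous_on S f"
| "Ck_on (Suc k) f S \<longleftrightarrow>
     (\<forall>x\<in>S. f differentiable (at x)) \<and>
     (\<forall>v. Ck_on k (\<lambda>x. frechet_derivative f (at x) v) S)"

text \<open>Only used for open \<^term>\<open>S\<close> in a finite-dimensional space.\<close>

definition smooth_on :: "('a::real_normed_vector \<Rightarrow> 'b::real_normed_vector) \<Rightarrow> 'a set \<Rightarrow> bool" where
  "smooth_on f S \<longleftrightarrow> (\<forall>k. Ck_on k f S)"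

text \<open>The parameters \<^term>\<open>s\<close> and \<^term>\<open>t\<close> are the complex scalar multiplications of source and target:
  the total derivative is required to be complex linear.\<close>

definition holo_on ::
    "(complex \<Rightarrow> 'a \<Rightarrow> 'a) \<Rightarrow> (complex \<Rightarrow> 'b \<Rightarrow> 'b) \<Rightarrow>
     ('a::real_normed_vector \<Rightarrow> 'b::real_normed_vector) \<Rightarrow> 'a set \<Rightarrow> bool" where
  "holo_on s t f S \<longleftrightarrow>
     (\<forall>x\<in>S. \<exists>f'. (f has_derivative f') (at x) \<and> (\<forall>k v. f' (s k v) = t k (f' v)))"


section \<open>Complex threefolds\<close>

type_synonym 'g chart = "'g set \<times> ('g \<Rightarrow> complex^3)"

abbreviation chart_inv :: "'g chart \<Rightarrow> complex^3 \<Rightarrow> 'g" where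
  "chart_inv c \<equiv> inv_into (fst c) (snd c)"

abbreviation chart_range :: "'g chart \<Rightarrow> (complex^3) set" where
  "chart_range c \<equiv> snd c ` fst c"

definition transition :: "'g chart \<Rightarrow> 'g chart \<Rightarrow> complex^3 \<Rightarrow> complex^3" where
  "transition c d = snd d \<circ> chart_inv c"

locale complex_threefold =
  fixes A :: "'g::{t2_space,second_countable_topology} chart set"
  assumes chart_open: "c \<in> A \<Longrightarrow> open (fst c)"
    and chart_range_open: "c \<in> A \<Longrightarrow> open (chart_range c)"
    and chart_homeo: "c \<in> A \<Longrightarrow> homeomorphism (fst c) (chart_range c) (snd c) (chart_inv c)"
    and charts_cover: "(\<Union>c\<in>A. fst c) = UNIV"
    and charts_compatible:
      "c \<in> A \<Longrightarrow> d \<in> A \<Longrightarrow> holo_on (*s) (*s) (transition c d) (snd c ` (fst c \<inter> fst d))"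

text \<open>The tangent space at \<^term>\<open>p\<close> is modelled by \<^typ>\<open>complex^3\<close>, by taking components in
  one fixed chart \<^term>\<open>chart_at A p\<close> around \<^term>\<open>p\<close>. As charts are holomorphic, the complex
  structure \<open>J\<close> is multiplication by \<^term>\<open>\<i>\<close> on every tangent space.
  The preferred chart may jump with \<^term>\<open>p\<close>; regularity of tensor fields is therefore always tested on
  their components with respect to the charts of the atlas.\<close>

definition chart_at :: "'g chart set \<Rightarrow> 'g \<Rightarrow> 'g chart" where
  "chart_at A p = (SOME c. c \<in> A \<and> p \<in> fst c)"

text \<open>Change of components, from chart \<^term>\<open>c\<close> to chart \<^term>\<open>d\<close>, of a tangent vector at \<^term>\<open>p\<close>.\<close>

definition change :: "'g chart \<Rightarrow> 'g chart \<Rightarrow> 'g \<Rightarrow> complex^3 \<Rightarrow> complex^3" where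
  "change c d p = frechet_derivative (transition c d) (at (snd c p))"

definition differential :: "'g chart set \<Rightarrow> ('g \<Rightarrow> 'g) \<Rightarrow> 'g \<Rightarrow> complex^3 \<Rightarrow> complex^3" where
  "differential A f p =
     frechet_derivative (snd (chart_at A (f p)) \<circ> f \<circ> chart_inv (chart_at A p))
       (at (snd (chart_at A p) p))"

definition smooth_fun :: "'g chart set \<Rightarrow> ('g \<Rightarrow> real) \<Rightarrow> bool" where
  "smooth_fun A f \<longleftrightarrow> (\<forall>c\<in>A. smooth_on (f \<circ> chart_inv c) (chart_range c))"

text \<open>Derivative of the function \<^term>\<open>f\<close> in the direction of the tangent vector \<^term>\<open>v\<close> at \<^term>\<open>p\<close>.\<close>

definition dir_deriv :: "'g chart set \<Rightarrow> ('g \<Rightarrow> real) \<Rightarrow> 'g \<Rightarrow> complex^3 \<Rightarrow> real" where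
  "dir_deriv A f p v =
     frechet_derivative (f \<circ> chart_inv (chart_at A p)) (at (snd (chart_at A p) p)) v"


subsection \<open>Vector fields\<close>

type_synonym 'g vfield = "'g \<Rightarrow> complex^3"

definition vfield_in :: "'g chart set \<Rightarrow> 'g chart \<Rightarrow> 'g vfield \<Rightarrow> complex^3 \<Rightarrow> complex^3" where
  "vfield_in A c X y = (let p = chart_inv c y in change (chart_at A p) c p (X p))"

definition smooth_vfield :: "'g chart set \<Rightarrow> 'g vfield \<Rightarrow> bool" where
  "smooth_vfield A X \<longleftrightarrow> (\<forall>c\<in>A. smooth_on (vfield_in A c X) (chart_range c))"

definition lie_bracket :: "'g chart set \<Rightarrow> 'g vfield \<Rightarrow> 'g vfield \<Rightarrow> 'g vfield" where
  "lie_bracket A X Y p =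
     (let c = chart_at A p; x = snd c p in
        frechet_derivative (vfield_in A c Y) (at x) (X p)
      - frechet_derivative (vfield_in A c X) (at x) (Y p))"


subsection \<open>Complex-valued differential forms\<close>

type_synonym 'g form1 = "'g \<Rightarrow> complex^3 \<Rightarrow> complex"
type_synonym 'g form2 = "'g \<Rightarrow> complex^3 \<Rightarrow> complex^3 \<Rightarrow> complex"

definition form_in :: "'g chart set \<Rightarrow> 'g chart \<Rightarrow> 'g form1 \<Rightarrow> complex^3 \<Rightarrow> complex^3 \<Rightarrow> complex" where
  "form_in A c \<alpha> y w = (let p = chart_inv c y in \<alpha> p (change c (chart_at A p) p w))"

definition holomorphic_10_form :: "'g chart set \<Rightarrow> 'g form1 \<Rightarrow> bool" where
  "holomorphic_10_form A \<alpha> \<longleftrightarrow>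
     (\<forall>p. Vector_Spaces.linear (*s) (*) (\<alpha> p)) \<and>
     (\<forall>c\<in>A. \<forall>w. holo_on (*s) (*) (\<lambda>y. form_in A c \<alpha> y w) (chart_range c))"

text \<open>The conventions without factor 1/2:
  \<open>d\<alpha>(X,Y) = X(\<alpha>(Y)) - Y(\<alpha>(X)) - \<alpha>([X,Y])\<close> and
  \<open>(\<alpha> \<and> \<beta>)(u,v) = \<alpha>(u) \<beta>(v) - \<alpha>(v) \<beta>(u)\<close>.\<close>

definition ext_deriv :: "'g chart set \<Rightarrow> 'g form1 \<Rightarrow> 'g form2" where
  "ext_deriv A \<alpha> p u v =
     (let c = chart_at A p; x = snd c p in
        frechet_derivative (\<lambda>y. form_in A c \<alpha> y v) (at x) u
      - frechet_derivative (\<lambda>y. form_in A c \<alpha> y u) (at x) v)"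

definition wedge :: "'g form1 \<Rightarrow> 'g form1 \<Rightarrow> 'g form2" where
  "wedge \<alpha> \<beta> p u v = \<alpha> p u * \<beta> p v - \<alpha> p v * \<beta> p u"


section \<open>Complex Lie groups of dimension three\<close>

locale complex_lie_group3 = complex_threefold A + group G
  for A :: "'g::{t2_space,second_countable_topology} chart set" and G :: "'g monoid" (structure) +
  assumes carrier_UNIV: "carrier G = UNIV"
    and mult_continuous: "continuous_on UNIV (\<lambda>(p, q). p \<otimes> q)"
    and mult_holomorphic: "c \<in> A \<Longrightarrow> d \<in> A \<Longrightarrow> e \<in> A \<Longrightarrow>
      holo_on (\<lambda>k (u, v). (k *s u, k *s v)) (*s)
        (\<lambda>(x, y). snd e (chart_inv c x \<otimes> chart_inv d y))
        {(snd c p, snd d q) | p q. p \<in> fst c \<and> q \<in> fst d \<and> p \<otimes> q \<in> fst e}"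
    and inverse_continuous: "continuous_on UNIV (\<lambda>p. inv p)"
    and inverse_holomorphic: "c \<in> A \<Longrightarrow> d \<in> A \<Longrightarrow>
      holo_on (*s) (*s) (\<lambda>x. snd d (inv (chart_inv c x)))
        {snd c p | p. p \<in> fst c \<and> inv p \<in> fst d}"

definition left_invariant :: "'g chart set \<Rightarrow> 'g monoid \<Rightarrow> 'g form1 \<Rightarrow> bool" where
  "left_invariant A G \<alpha> \<longleftrightarrow>
     (\<forall>a p v. \<alpha> (a \<otimes>\<^bsub>G\<^esub> p) (differential A (\<lambda>x. a \<otimes>\<^bsub>G\<^esub> x) p v) = \<alpha> p v)"

definition left_inv_holo_forms :: "'g chart set \<Rightarrow> 'g monoid \<Rightarrow> 'g form1 set" where
  "left_inv_holo_forms A G = {\<alpha>. holomorphic_10_form A \<alpha> \<and> left_invariant A G \<alpha>}"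

text \<open>A basis of the complex vector space of left-invariant holomorphic (1,0)-forms.\<close>

definition basis_of_forms :: "'g chart set \<Rightarrow> 'g monoid \<Rightarrow> (3 \<Rightarrow> 'g form1) \<Rightarrow> bool" where
  "basis_of_forms A G \<phi> \<longleftrightarrow>
     (\<forall>i. \<phi> i \<in> left_inv_holo_forms A G) \<and>
     (\<forall>\<alpha>\<in>left_inv_holo_forms A G. \<exists>!k::complex^3. \<alpha> = (\<lambda>p v. \<Sum>i\<in>UNIV. k $ i * \<phi> i p v))"


section \<open>Hermitian metrics and the Bismut connection\<close>

text \<open>A metric is recorded by its underlying Riemannian metric, a real-valued real bilinear
  form on each tangent space.\<close>

type_synonym 'g metric = "'g \<Rightarrow> complex^3 \<Rightarrow> complex^3 \<Rightarrow> real"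

definition metric_in ::
    "'g chart set \<Rightarrow> 'g chart \<Rightarrow> 'g metric \<Rightarrow> complex^3 \<Rightarrow> complex^3 \<Rightarrow> complex^3 \<Rightarrow> real" where
  "metric_in A c g y u w =
     (let p = chart_inv c y; D = change c (chart_at A p) p in g p (D u) (D w))"

definition hermitian_metric :: "'g chart set \<Rightarrow> 'g metric \<Rightarrow> bool" where
  "hermitian_metric A g \<longleftrightarrow>
     (\<forall>p u. linear (g p u)) \<and>
     (\<forall>p u v. g p u v = g p v u) \<and>
     (\<forall>p u. u \<noteq> 0 \<longrightarrow> g p u u > 0) \<and>
     (\<forall>p u v. g p (\<i> *s u) (\<i> *s v) = g p u v) \<and>
     (\<forall>c\<in>A. \<forall>u v. smooth_on (\<lambda>y. metric_in A c g y u v) (chart_range c))"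

text \<open>A connection \<open>\<nabla>\<close> on the (real) tangent bundle is written
  \<^term>\<open>nab Y p v\<close> for \<open>\<nabla>\<^sub>v Y\<close> with \<open>v\<close> a tangent vector at \<open>p\<close>. Its values on
  non-smooth \<open>Y\<close> are irrelevant.\<close>

type_synonym 'g connection = "'g vfield \<Rightarrow> 'g \<Rightarrow> complex^3 \<Rightarrow> complex^3"

definition affine_connection :: "'g chart set \<Rightarrow> 'g connection \<Rightarrow> bool" where
  "affine_connection A nab \<longleftrightarrow>
     (\<forall>Y p. smooth_vfield A Y \<longrightarrow> linear (nab Y p)) \<and>
     (\<forall>X Y. smooth_vfield A X \<longrightarrow> smooth_vfield A Y \<longrightarrow> smooth_vfield A (\<lambda>p. nab Y p (X p))) \<and>
     (\<forall>Y Z p v. smooth_vfield A Y \<longrightarrow> smooth_vfield A Z \<longrightarrow>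
        nab (\<lambda>q. Y q + Z q) p v = nab Y p v + nab Z p v) \<and>
     (\<forall>f Y p v. smooth_fun A f \<longrightarrow> smooth_vfield A Y \<longrightarrow>
        nab (\<lambda>q. f q *\<^sub>R Y q) p v = dir_deriv A f p v *\<^sub>R Y p + f p *\<^sub>R nab Y p v)"

definition torsion :: "'g chart set \<Rightarrow> 'g connection \<Rightarrow> 'g vfield \<Rightarrow> 'g vfield \<Rightarrow> 'g vfield" where
  "torsion A nab X Y p = nab Y p (X p) - nab X p (Y p) - lie_bracket A X Y p"

text \<open>The defining properties \<open>\<nabla>g = 0\<close>, \<open>\<nabla>J = 0\<close> and
  total skew-symmetry of \<open>g(T(X,Y),Z)\<close> (skew-symmetry in \<open>X,Y\<close> is
  automatic). They determine the connection uniquely on smooth vector fields.\<close>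

definition bismut_connection :: "'g chart set \<Rightarrow> 'g metric \<Rightarrow> 'g connection \<Rightarrow> bool" where
  "bismut_connection A g nab \<longleftrightarrow>
     affine_connection A nab \<and>
     (\<forall>Y Z p v. smooth_vfield A Y \<longrightarrow> smooth_vfield A Z \<longrightarrow>
        dir_deriv A (\<lambda>q. g q (Y q) (Z q)) p v = g p (nab Y p v) (Z p) + g p (Y p) (nab Z p v)) \<and>
     (\<forall>Y p v. smooth_vfield A Y \<longrightarrow> nab (\<lambda>q. \<i> *s Y q) p v = \<i> *s nab Y p v) \<and>
     (\<forall>X Y Z p. smooth_vfield A X \<longrightarrow> smooth_vfield A Y \<longrightarrow> smooth_vfield A Z \<longrightarrow>
        g p (torsion A nab X Y p) (Z p) = - g p (torsion A nab Y X p) (Z p) \<and>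
        g p (torsion A nab X Y p) (Z p) = - g p (torsion A nab X Z p) (Y p))"


section \<open>Parallel transport and holonomy\<close>

definition smooth_curve :: "'g::topological_space chart set \<Rightarrow> (real \<Rightarrow> 'g) \<Rightarrow> bool" where
  "smooth_curve A \<gamma> \<longleftrightarrow>
     (\<exists>S. open S \<and> {0..1} \<subseteq> S \<and> continuous_on S \<gamma> \<and>
        (\<forall>c\<in>A. smooth_on (snd c \<circ> \<gamma>) (S \<inter> \<gamma> -` fst c)))"

definition velocity :: "'g chart set \<Rightarrow> (real \<Rightarrow> 'g) \<Rightarrow> real \<Rightarrow> complex^3" where
  "velocity A \<gamma> t = vector_derivative (snd (chart_at A (\<gamma> t)) \<circ> \<gamma>) (at t)"

text \<open>The covariant derivative at \<^term>\<open>t\<close> of a vector field \<^term>\<open>V\<close> along \<^term>\<open>\<gamma>\<close> is computed by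
  the Leibniz rule from any local expression \<open>V(s) = \<Sum>\<^sub>i v\<^sub>i(s) E\<^sub>i(\<gamma>(s))\<close> in smooth
  vector fields \<open>E\<^sub>i\<close>; the result does not depend on the expression chosen.\<close>

definition has_cov_deriv ::
    "'g chart set \<Rightarrow> 'g connection \<Rightarrow> (real \<Rightarrow> 'g) \<Rightarrow> (real \<Rightarrow> complex^3) \<Rightarrow> complex^3 \<Rightarrow> real \<Rightarrow> bool" where
  "has_cov_deriv A nab \<gamma> V W t \<longleftrightarrow>
     (\<exists>n (E :: nat \<Rightarrow> 'g vfield) (v :: nat \<Rightarrow> real \<Rightarrow> real) (v' :: nat \<Rightarrow> real).
        (\<forall>i<n. smooth_vfield A (E i)) \<and>
        (\<forall>i<n. (v i has_real_derivative v' i) (at t within {0..1})) \<and>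
        (\<exists>\<epsilon>>0. \<forall>s\<in>{0..1}. \<bar>s - t\<bar> < \<epsilon> \<longrightarrow> V s = (\<Sum>i<n. v i s *\<^sub>R E i (\<gamma> s))) \<and>
        W = (\<Sum>i<n. v' i *\<^sub>R E i (\<gamma> t) + v i t *\<^sub>R nab (E i) (\<gamma> t) (velocity A \<gamma> t)))"

definition parallel_along ::
    "'g chart set \<Rightarrow> 'g connection \<Rightarrow> (real \<Rightarrow> 'g) \<Rightarrow> (real \<Rightarrow> complex^3) \<Rightarrow> bool" where
  "parallel_along A nab \<gamma> V \<longleftrightarrow> (\<forall>t\<in>{0..1}. has_cov_deriv A nab \<gamma> V 0 t)"

text \<open>\<^term>\<open>transports A nab p q P\<close>: the map \<^term>\<open>P\<close> from the tangent space at \<^term>\<open>p\<close> to the one at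
  \<^term>\<open>q\<close> is parallel transport along some piecewise smooth path from \<^term>\<open>p\<close> to \<^term>\<open>q\<close>, given as
  a finite concatenation of smooth curves.\<close>

inductive transports ::
    "'g::topological_space chart set \<Rightarrow> 'g connection \<Rightarrow> 'g \<Rightarrow> 'g \<Rightarrow> (complex^3 \<Rightarrow> complex^3) \<Rightarrow> bool"
  for A nab where
  const: "transports A nab p p id"
| append: "\<lbrakk>transports A nab p (\<gamma> 0) P; smooth_curve A \<gamma>;
     \<forall>u. \<exists>V. parallel_along A nab \<gamma> V \<and> V 0 = u \<and> V 1 = Q u\<rbrakk>
     \<Longrightarrow> transports A nab p (\<gamma> 1) (Q \<circ> P)"

definition holonomy ::
    "'g::topological_space chart set \<Rightarrow> 'g connection \<Rightarrow> 'g \<Rightarrow> (complex^3 \<Rightarrow> complex^3) set" where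
  "holonomy A nab p = {P. transports A nab p p P}"

definition SU3 :: "(complex^3^3) set" where
  "SU3 = {M. M ** (\<chi> i j. cnj (M $ j $ i)) = mat 1 \<and> det M = 1}"

text \<open>The columns of \<^term>\<open>B\<close> form a unitary basis of the tangent space at \<^term>\<open>p\<close>. The inner product
  of \<^typ>\<open>complex^3\<close> is the real part of the standard Hermitian product.\<close>

definition unitary_frame :: "'g metric \<Rightarrow> 'g \<Rightarrow> complex^3^3 \<Rightarrow> bool" where
  "unitary_frame g p B \<longleftrightarrow> (\<forall>u v. g p (B *v u) (B *v v) = u \<bullet> v)"

text \<open>Matrices in a unitary frame identify the holonomy group at each point with SU(3); since SU(3) is
  normal in U(3), the choice of the frame is immaterial.\<close>

definition holonomy_is_SU3 :: "'g::topological_space chart set \<Rightarrow> 'g metric \<Rightarrow> 'g connection \<Rightarrow> bool" where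
  "holonomy_is_SU3 A g nab \<longleftrightarrow>
     (\<forall>p. \<exists>B. unitary_frame g p B \<and>
        holonomy A nab p = (\<lambda>M v. B *v (M *v (matrix_inv B *v v))) ` SU3)"

end

theory Submission
  imports Defs "HOL-Complex_Analysis.Complex_Analysis"
begin

text \<open>Take the metric for which \<open>\<phi>\<^sup>1, \<phi>\<^sup>2, \<phi>\<^sup>3\<close> is a unitary coframe. In the dual frame the Bismut connection
  has the constant coefficients \<open>\<omega>(x) = ad x - (ad x)\<^sup>*\<close>, where \<open>ad\<close> is read off the structure equations. The
  group is unimodular, hence \<open>\<omega>\<close> has values in \<open>\<ss>\<uu>(3)\<close> and all parallel transports lie in SU(3).

  Conversely, in both cases there are two frame vectors \<open>e\<close> such that \<open>z \<mapsto> \<omega>(z e)\<close> is the off-diagonal part of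
  a standard \<open>\<ss>\<uu>(2)\<close> in two coordinates, and the two coordinate pairs overlap. A holomorphic integral curve of
  \<open>e\<close> through a point \<open>p\<close> is an immersed complex disc on which \<open>\<omega>\<close> is constant, so that the parallel transport
  along a segment of the disc is an explicit rotation. Already the small squares at \<open>p\<close> generate SU(2), and the two
  copies of SU(2) generate SU(3).\<close>

no_notation fps_nth (infixl "$" 75)

section \<open>Calculus of iterated Frechet derivatives\<close>

text \<open>Holonomy is the bare set of transports around loops, so instead of arguing through
  curvature and Lie subgroups every element of SU(3) is written as a finite product of explicit
  transports. Complex discs are needed for the following reason. On a real integral curve every loop
  retraces itself and gives nothing. The fields \<open>e\<close> and \<open>\<i> e\<close> commute,
  so squares in the disc close up; but \<open>omega\<close> mixes a complex linear and a conjugate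
  linear term, and with \<open>N = ad e\<close> the commutator of \<open>omega(e)\<close> and
  \<open>omega(\<i> e)\<close> is \<open>2 \<i>\<close> times that of \<open>N\<close> and its
  adjoint, which does not vanish for the chosen vectors. The inclusion in SU(3) has an obstacle of
  its own: a transport is a map that matches initial and final values of some parallel fields, with
  no linearity built in. Linearity is recovered from preservation of the Hermitian product. Finally,
  the forms are holomorphic in the sense of one complex linear derivative, whereas metrics and
  vector fields are smooth to all orders in every chart. This is why Cauchy's formula in several
  variables comes before the geometry.\<close>

lemma frechet_derivative_eqI:
  "(f has_derivative f') (at x) \<Longrightarrow> frechet_derivative f (at x) = f'"
  using frechet_derivative_at by metis

lemma frechet_derivative_cong_open:
  assumes "open S" "x \<in> S" "\<And>y. y \<in> S \<Longrightarrow> f y = g y"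
  shows "frechet_derivative f (at x) = frechet_derivative g (at x)"
proof -
  have "(f has_derivative D) (at x) \<longleftrightarrow> (g has_derivative D) (at x)" for D
    using assms by (metis has_derivative_transform_within_open)
  then show ?thesis
    unfolding frechet_derivative_def by simp
qed

lemma differentiable_cong_open:
  assumes "open S" "x \<in> S" "\<And>y. y \<in> S \<Longrightarrow> f y = g y"
  shows "f differentiable (at x) \<longleftrightarrow> g differentiable (at x)"
  unfolding differentiable_def using assms by (metis has_derivative_transform_within_open)

lemma Ck_on_cong:
  assumes "open S" "\<And>x. x \<in> S \<Longrightarrow> f x = g x"
  shows "Ck_on k f S \<longleftrightarrow> Ck_on k g S"
  using assms(2)
proof (induction k arbitrary: f g)
  case 0
  then show ?case by (simp cong: continuous_on_cong)
next
  case (Suc k)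
  have "f differentiable (at x) \<longleftrightarrow> g differentiable (at x)" if "x \<in> S" for x
    using differentiable_cong_open[OF assms(1) that Suc.prems] .
  moreover have "Ck_on k (\<lambda>x. frechet_derivative f (at x) v) S
      \<longleftrightarrow> Ck_on k (\<lambda>x. frechet_derivative g (at x) v) S" for v
    by (rule Suc.IH) (use frechet_derivative_cong_open[OF assms(1) _ Suc.prems] in simp)
  ultimately show ?case by simp
qed

lemma Ck_on_subset: "Ck_on k f S \<Longrightarrow> T \<subseteq> S \<Longrightarrow> Ck_on k f T"
  by (induction k arbitrary: f) (auto intro: continuous_on_subset)

lemma Ck_on_Suc_imp: "Ck_on (Suc k) f S \<Longrightarrow> Ck_on k f S"
proof (induction k arbitrary: f)
  case 0
  then show ?case
    by (auto intro!: continuous_at_imp_continuous_on differentiable_imp_continuous_within)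
next
  case (Suc k)
  then show ?case by (metis Ck_on.simps(2))
qed

lemma Ck_on_SucI:
  assumes "open S" "\<And>x. x \<in> S \<Longrightarrow> (f has_derivative f' x) (at x)"
    and "\<And>v. Ck_on k (\<lambda>x. f' x v) S"
  shows "Ck_on (Suc k) f S"
proof -
  have "Ck_on k (\<lambda>x. frechet_derivative f (at x) v) S" for v
    using assms(3)[of v] frechet_derivative_eqI[OF assms(2)]
    by (subst Ck_on_cong[OF assms(1)]) auto
  then show ?thesis
    using assms(2) by (auto simp: differentiable_def)
qed

lemma Ck_on_Suc_has_derivative:
  "Ck_on (Suc k) f S \<Longrightarrow> x \<in> S \<Longrightarrow> (f has_derivative frechet_derivative f (at x)) (at x)"
  using frechet_derivative_works by auto

lemma Ck_on_const: "open S \<Longrightarrow> Ck_on k (\<lambda>x. c) S"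
proof (induction k arbitrary: c)
  case (Suc k)
  then show ?case by (intro Ck_on_SucI[where f' = "\<lambda>x v. 0"]) auto
qed simp

lemma Ck_on_bounded_linear:
  assumes "open S" "bounded_linear f"
  shows "Ck_on k f S"
proof (cases k)
  case 0
  then show ?thesis using assms by (simp add: linear_continuous_on)
next
  case (Suc k)
  then show ?thesis
    using Ck_on_SucI[OF assms(1) bounded_linear_imp_has_derivative[OF assms(2)] Ck_on_const[OF assms(1)]] by simp
qed

lemma Ck_on_add:
  assumes "open S" "Ck_on k f S" "Ck_on k g S"
  shows "Ck_on k (\<lambda>x. f x + g x) S"
  using assms(2,3)
proof (induction k arbitrary: f g)
  case 0
  then show ?case by (auto intro: continuous_intros)
next
  case (Suc k)
  show ?case
    by (rule Ck_on_SucI[OF assms(1), where f' = "\<lambda>x v. frechet_derivative f (at x) v + frechet_derivative g (at x) v"])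
       (use Suc in \<open>auto intro!: has_derivative_add Ck_on_Suc_has_derivative\<close>)
qed

text \<open>Leibniz' rule gives two products of the same kind, one order lower. Stated for any
  bounded bilinear map, it serves scalar multiplication, inner products and connection forms
  alike.\<close>

lemma Ck_on_bilinear:
  assumes "open S" "bounded_bilinear p" "Ck_on k f S" "Ck_on k g S"
  shows "Ck_on k (\<lambda>x. p (f x) (g x)) S"
  using assms(3,4)
proof (induction k arbitrary: f g)
  case 0
  then show ?case by (auto intro: bounded_bilinear.continuous_on[OF assms(2)])
next
  case (Suc k)
  show ?case
  proof (rule Ck_on_SucI[OF assms(1)])
    show "((\<lambda>x. p (f x) (g x)) has_derivative
        (\<lambda>v. p (f x) (frechet_derivative g (at x) v) + p (frechet_derivative f (at x) v) (g x))) (at x)" if "x \<in> S" for x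
      using bounded_bilinear.FDERIV[OF assms(2) Ck_on_Suc_has_derivative[OF Suc.prems(1) that]
          Ck_on_Suc_has_derivative[OF Suc.prems(2) that]] .
    show "Ck_on k (\<lambda>x. p (f x) (frechet_derivative g (at x) v) + p (frechet_derivative f (at x) v) (g x)) S" for v
      using Suc.prems Ck_on_Suc_imp[OF Suc.prems(1)] Ck_on_Suc_imp[OF Suc.prems(2)]
      by (intro Ck_on_add assms(1) Suc.IH) auto
  qed
qed

lemma Ck_on_sum:
  assumes "open S" "\<And>i. i \<in> I \<Longrightarrow> Ck_on k (f i) S"
  shows "Ck_on k (\<lambda>x. \<Sum>i\<in>I. f i x) S"
  using assms(2)
proof (induction I rule: infinite_finite_induct)
  case (insert i I)
  then show ?case by (simp add: Ck_on_add[OF assms(1)])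
qed (auto intro: Ck_on_const[OF assms(1)])

lemma linear_euclidean_expand:
  fixes L :: "'b::euclidean_space \<Rightarrow> 'c::real_normed_vector"
  assumes "linear L"
  shows "L v = (\<Sum>b\<in>Basis. (v \<bullet> b) *\<^sub>R L b)"
proof -
  have "L v = L (\<Sum>b\<in>Basis. (v \<bullet> b) *\<^sub>R b)" by (simp add: euclidean_representation)
  then show ?thesis using assms by (simp add: linear_sum linear_scale)
qed

text \<open>The chain rule evaluates the derivative of \<open>g\<close> in a direction that varies
  with \<open>x\<close>, while the induction hypothesis concerns fixed directions. Expanding the
  direction in a basis turns the derivative into a sum of products of functions covered by the
  hypothesis.\<close>

lemma Ck_on_compose:
  fixes f :: "'a::real_normed_vector \<Rightarrow> 'b::euclidean_space"
  assumes "open S" "open T" "Ck_on k f S" "Ck_on k g T" "\<And>x. x \<in> S \<Longrightarrow> f x \<in> T"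
  shows "Ck_on k (\<lambda>x. g (f x)) S"
  using assms(3,4,5)
proof (induction k arbitrary: f g)
  case 0
  have "continuous_on S f" "continuous_on T g" "f ` S \<subseteq> T"
    using 0 by auto
  then show ?case
    using continuous_on_compose2 by (metis Ck_on.simps(1))
next
  case (Suc k)
  note df = Ck_on_Suc_has_derivative[OF Suc.prems(1)]
  note dg = Ck_on_Suc_has_derivative[OF Suc.prems(2) Suc.prems(3)]
  show ?case
  proof (rule Ck_on_SucI[OF assms(1)])
    fix x assume x: "x \<in> S"
    have lin: "linear (frechet_derivative g (at (f x)))"
      using has_derivative_linear[OF dg[OF x]] .
    have "((\<lambda>x. g (f x)) has_derivative (\<lambda>v. frechet_derivative g (at (f x)) (frechet_derivative f (at x) v))) (at x)"
      using has_derivative_compose[OF df[OF x] dg[OF x]] .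
    also have "(\<lambda>v. frechet_derivative g (at (f x)) (frechet_derivative f (at x) v)) =
        (\<lambda>v. \<Sum>b\<in>Basis. (frechet_derivative f (at x) v \<bullet> b) *\<^sub>R frechet_derivative g (at (f x)) b)"
      using linear_euclidean_expand[OF lin] by (rule ext)
    finally show "((\<lambda>x. g (f x)) has_derivative
        (\<lambda>v. \<Sum>b\<in>Basis. (frechet_derivative f (at x) v \<bullet> b) *\<^sub>R frechet_derivative g (at (f x)) b)) (at x)" .
  next
    fix v
    show "Ck_on k (\<lambda>x. \<Sum>b\<in>Basis. (frechet_derivative f (at x) v \<bullet> b) *\<^sub>R frechet_derivative g (at (f x)) b) S"
    proof (intro Ck_on_sum assms(1) Ck_on_bilinear[OF assms(1) bounded_bilinear_scaleR])
      fix b :: 'b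
      have "Ck_on k (\<lambda>x. frechet_derivative f (at x) v) S" "\<And>v. Ck_on k (\<lambda>x. frechet_derivative g (at x) v) T"
        using Suc.prems(1,2) by simp_all
      then show "Ck_on k (\<lambda>x. frechet_derivative f (at x) v \<bullet> b) S"
        and "Ck_on k (\<lambda>x. frechet_derivative g (at (f x)) b) S"
        using Ck_on_bilinear[OF assms(1) bounded_bilinear_inner _ Ck_on_const[OF assms(1)]]
          Suc.IH[OF Ck_on_Suc_imp[OF Suc.prems(1)] _ Suc.prems(3)] by blast+
    qed
  qed
qed

section \<open>Closure properties of smooth maps\<close>

lemma smooth_on_cong:
  "open S \<Longrightarrow> (\<And>x. x \<in> S \<Longrightarrow> f x = g x) \<Longrightarrow> smooth_on f S \<longleftrightarrow> smooth_on g S"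
  unfolding smooth_on_def using Ck_on_cong by blast

lemma smooth_on_subset: "smooth_on f S \<Longrightarrow> T \<subseteq> S \<Longrightarrow> smooth_on f T"
  unfolding smooth_on_def using Ck_on_subset by blast

lemma smooth_on_const: "open S \<Longrightarrow> smooth_on (\<lambda>x. c) S"
  by (simp add: smooth_on_def Ck_on_const)

lemma smooth_on_bounded_linear: "open S \<Longrightarrow> bounded_linear f \<Longrightarrow> smooth_on f S"
  by (simp add: smooth_on_def Ck_on_bounded_linear)

lemma smooth_on_add: "open S \<Longrightarrow> smooth_on f S \<Longrightarrow> smooth_on g S \<Longrightarrow> smooth_on (\<lambda>x. f x + g x) S"
  by (simp add: smooth_on_def Ck_on_add)

lemma smooth_on_sum:
  "open S \<Longrightarrow> (\<And>i. i \<in> I \<Longrightarrow> smooth_on (f i) S) \<Longrightarrow> smooth_on (\<lambda>x. \<Sum>i\<in>I. f i x) S"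
  by (simp add: smooth_on_def Ck_on_sum)

lemma smooth_on_bilinear:
  "open S \<Longrightarrow> bounded_bilinear p \<Longrightarrow> smooth_on f S \<Longrightarrow> smooth_on g S \<Longrightarrow> smooth_on (\<lambda>x. p (f x) (g x)) S"
  by (simp add: smooth_on_def Ck_on_bilinear)

lemma smooth_on_compose:
  fixes f :: "'a::real_normed_vector \<Rightarrow> 'b::euclidean_space"
  shows "open S \<Longrightarrow> open T \<Longrightarrow> smooth_on f S \<Longrightarrow> smooth_on g T \<Longrightarrow> (\<And>x. x \<in> S \<Longrightarrow> f x \<in> T)
    \<Longrightarrow> smooth_on (\<lambda>x. g (f x)) S"
  by (simp add: smooth_on_def Ck_on_compose)

lemma smooth_on_linear:
  fixes f :: "'a::real_normed_vector \<Rightarrow> 'b::euclidean_space"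
  assumes "open S" "linear L" "smooth_on f S"
  shows "smooth_on (\<lambda>x. L (f x)) S"
  using smooth_on_compose[OF assms(1) open_UNIV assms(3) smooth_on_bounded_linear[OF open_UNIV]]
    assms(2) linear_conv_bounded_linear by blast

lemma smooth_on_has_derivative:
  "smooth_on f S \<Longrightarrow> x \<in> S \<Longrightarrow> (f has_derivative frechet_derivative f (at x)) (at x)"
  unfolding smooth_on_def using Ck_on_Suc_has_derivative by blast

lemma smooth_on_frechet_derivative: "smooth_on f S \<Longrightarrow> smooth_on (\<lambda>x. frechet_derivative f (at x) v) S"
  unfolding smooth_on_def using Ck_on.simps(2) by blast

lemma smooth_on_imp_continuous_on: "smooth_on f S \<Longrightarrow> continuous_on S f"
  unfolding smooth_on_def using Ck_on.simps(1) by blast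

text \<open>Jacobians and coframes are known to be smooth on fixed vectors; a basis expansion allows
  the argument to vary as well.\<close>

lemma smooth_on_apply_linear:
  fixes X :: "'a::real_normed_vector \<Rightarrow> 'b::euclidean_space"
  assumes "open S" "\<And>x. x \<in> S \<Longrightarrow> linear (D x)" "\<And>v. smooth_on (\<lambda>x. D x v) S" "smooth_on X S"
  shows "smooth_on (\<lambda>x. D x (X x)) S"
proof -
  have "smooth_on (\<lambda>x. \<Sum>b\<in>Basis. (X x \<bullet> b) *\<^sub>R D x b) S"
    by (intro smooth_on_sum smooth_on_bilinear[OF _ bounded_bilinear_scaleR] assms
        smooth_on_bilinear[OF _ bounded_bilinear_inner] smooth_on_const)
  then show ?thesis
    using linear_euclidean_expand[OF assms(2)] by (subst smooth_on_cong[OF assms(1)]) auto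
qed

lemma smooth_on_vecI:
  fixes f :: "'a::real_normed_vector \<Rightarrow> complex^3"
  assumes "open S" "\<And>i. smooth_on (\<lambda>x. f x $ i) S"
  shows "smooth_on f S"
proof -
  have eq: "f x = (\<Sum>i\<in>UNIV. axis i (f x $ i))" for x
    by (simp add: vec_eq_iff axis_def)
  have lin: "linear (axis i :: complex \<Rightarrow> complex^3)" for i
    by (rule linearI) (auto simp: vec_eq_iff axis_def)
  have "smooth_on (\<lambda>x. \<Sum>i\<in>UNIV. axis i (f x $ i)) S"
    by (rule smooth_on_sum[OF assms(1)]) (rule smooth_on_linear[OF assms(1) lin assms(2)])
  then show ?thesis using eq by simp
qed

section \<open>Holomorphic maps of several variables are smooth\<close>

lemma norm_vector_smult: "norm (k *s v) = cmod k * norm (v :: complex^'n)"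
  by (simp add: norm_vec_def vector_scalar_mult_def norm_mult L2_set_right_distrib)

lemma bounded_bilinear_vector_smult:
  "bounded_bilinear (\<lambda>(k::complex) (v::complex^'n). k *s v)"
  by (standard, simp_all add: vec_eq_iff distrib_left distrib_right norm_vector_smult)
    (intro exI[of _ 1], simp)

lemma scaleR_eq_vector_smult: "r *\<^sub>R (v :: complex^'n) = complex_of_real r *s v"
  unfolding vec_eq_iff vector_scaleR_component vector_smult_component by (simp add: scaleR_conv_of_real)

lemma holo_on_has_derivative:
  "holo_on s t f S \<Longrightarrow> x \<in> S \<Longrightarrow> (f has_derivative frechet_derivative f (at x)) (at x)"
  unfolding holo_on_def by (metis frechet_derivative_eqI)

lemma holo_on_derivative_scale:
  "holo_on s t f S \<Longrightarrow> x \<in> S \<Longrightarrow>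
    frechet_derivative f (at x) (s k v) = t k (frechet_derivative f (at x) v)"
  unfolding holo_on_def by (metis frechet_derivative_eqI)

lemma holo_on_continuous_on: "holo_on s t f S \<Longrightarrow> continuous_on S f"
  by (meson continuous_at_imp_continuous_on has_derivative_continuous holo_on_has_derivative)

text \<open>On the complex line through \<open>x\<close> in direction \<open>v\<close> this is
  Cauchy's formula for the first derivative. The point is uniformity: near \<open>x0\<close> one
  circle \<open>c\<close> and one kernel \<open>K\<close> serve all \<open>x\<close>, so the
  right-hand side depends on \<open>x\<close> through \<open>f\<close> alone and can be
  differentiated under the integral. Convexity of \<open>U\<close> is for the Leibniz rule.\<close>

lemma holo_on_Cauchy_formula:
  fixes f :: "complex^3 \<Rightarrow> complex"
  assumes S: "open S" and f: "holo_on (*s) (*) f S" and x0: "x0 \<in> S"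
  obtains U K c where "open U" "convex U" "x0 \<in> U"
    "continuous_on {0..1::real} K" "continuous_on {0..1} c"
    "\<And>x t. x \<in> U \<Longrightarrow> t \<in> {0..1} \<Longrightarrow> x + c t *s v \<in> S"
    "\<And>x. x \<in> U \<Longrightarrow> frechet_derivative f (at x) v = integral {0..1} (\<lambda>t. K t * f (x + c t *s v))"
proof -
  obtain r where r: "r > 0" "ball x0 r \<subseteq> S"
    using S x0 open_contains_ball by blast
  \<comment> \<open>Half of the radius \<open>r\<close> is left for moving the base point and half
    for the circle; the \<open>+ 1\<close> covers \<open>v = 0\<close>.\<close>
  define d where "d = r / (2 * (norm v + 1))"
  have nv: "norm v + 1 > 0" by (simp add: add_nonneg_pos)
  have d: "d > 0" using r nv by (simp add: d_def)
  have dv: "d * norm v < r / 2"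
    using r nv by (simp add: d_def field_simps)
  define U where "U = ball x0 (r / 2)"
  have inS: "x + w *s v \<in> S" if "x \<in> U" "cmod w \<le> d" for x w
  proof -
    have "norm (w *s v) \<le> d * norm v"
      using that(2) by (simp add: norm_vector_smult mult_right_mono)
    then have "norm (w *s v) < r / 2" using dv by linarith
    moreover have "dist x0 x < r / 2" using that(1) by (simp add: U_def)
    ultimately have "dist x0 (x + w *s v) < r"
      using norm_triangle_ineq4[of "x0 - x" "w *s v"] by (simp add: dist_norm algebra_simps)
    then show ?thesis using r(2) by auto
  qed
  define c where "c = circlepath 0 d"
  define K where "K t = (1 / (2 * of_real pi * \<i>)) * (vector_derivative c (at t) / (c t)^2)" for t
  have c_eq: "c t = d * exp (2 * of_real pi * \<i> * t)" for t
    by (simp add: c_def circlepath)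
  have cnorm: "cmod (c t) = d" for t
    using d by (simp add: c_eq norm_mult)
  have cc: "continuous_on T c" for T
    unfolding c_eq by (intro continuous_intros)
  have cK: "continuous_on T K" for T
  proof -
    have "c t \<noteq> 0" for t using cnorm[of t] d by auto
    then show ?thesis
      unfolding K_def c_def vector_derivative_circlepath
      by (intro continuous_intros cc[unfolded c_def]) auto
  qed
  have repr: "frechet_derivative f (at x) v = integral {0..1} (\<lambda>t. K t * f (x + c t *s v))" if x: "x \<in> U" for x
  proof -
    \<comment> \<open>Restriction to the complex line. Complex linearity of the derivative of
      \<open>f\<close> makes \<open>g\<close> holomorphic in one variable.\<close>
    define g where "g w = f (x + w *s v)" for w
    have dg: "(g has_field_derivative frechet_derivative f (at (x + w *s v)) v) (at w)" if "cmod w \<le> d" for w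
    proof -
      note y = inS[OF x that]
      have "((\<lambda>w. x + w *s v) has_derivative (\<lambda>h. 0 + h *s v)) (at w)"
        by (intro derivative_intros bounded_linear_imp_has_derivative
            bounded_bilinear.bounded_linear_left[OF bounded_bilinear_vector_smult])
      from has_derivative_compose[OF this holo_on_has_derivative[OF f y]]
      show ?thesis
        unfolding has_field_derivative_def g_def
        by (simp add: holo_on_derivative_scale[OF f y] mult.commute[of _ "frechet_derivative f _ v"])
    qed
    have "g holomorphic_on ball 0 d"
      unfolding holomorphic_on_def field_differentiable_def
      using dg by (meson DERIV_subset less_imp_le mem_ball_0 subset_UNIV)
    moreover have "continuous_on (cball 0 d) g"
      using dg by (meson DERIV_isCont continuous_at_imp_continuous_on mem_cball_0)
    ultimately have "(g has_field_derivative (1 / (2 * of_real pi * \<i>) *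
        contour_integral c (\<lambda>u. g u / (u - 0)^2))) (at 0)"
      unfolding c_def using d by (intro Cauchy_derivative_integral_circlepath(2)) auto
    from DERIV_unique[OF this dg[of 0]] d
    have "frechet_derivative f (at x) v = 1 / (2 * of_real pi * \<i>) * contour_integral c (\<lambda>u. g u / u^2)"
      by simp
    also have "\<dots> = integral {0..1} (\<lambda>t. 1 / (2 * of_real pi * \<i>) * (g (c t) / (c t)^2 * vector_derivative c (at t)))"
      by (simp only: contour_integral_integral integral_mult_right)
    also have "\<dots> = integral {0..1} (\<lambda>t. K t * f (x + c t *s v))"
      by (rule integral_cong) (simp add: K_def g_def)
    finally show ?thesis .
  qed
  show ?thesis
    using that[of U K c] r(1) inS cnorm cc cK repr by (auto simp: U_def)
qed

lemma continuous_on_shifted: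
  fixes F :: "complex^3 \<Rightarrow> complex"
  assumes "continuous_on S F" "continuous_on {0..1::real} K" "continuous_on {0..1} c"
    "\<And>x t. x \<in> U \<Longrightarrow> t \<in> {0..1} \<Longrightarrow> x + c t *s v \<in> S"
  shows "continuous_on (U \<times> cbox 0 1) (\<lambda>(x, t). K t * F (x + c t *s v))"
proof -
  have "continuous_on (U \<times> cbox 0 1) (\<lambda>z. fst z + c (snd z) *s v)"
    by (intro continuous_on_add continuous_on_fst continuous_on_id
        bounded_bilinear.continuous_on[OF bounded_bilinear_vector_smult] continuous_on_const
        continuous_on_compose2[OF assms(3) continuous_on_snd[OF continuous_on_id]]) auto
  then have "continuous_on (U \<times> cbox 0 1) (\<lambda>z. F (fst z + c (snd z) *s v))"
    by (rule continuous_on_compose2[OF assms(1)]) (use assms(4) in auto)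
  then show ?thesis
    unfolding split_beta
    by (intro continuous_on_mult
        continuous_on_compose2[OF assms(2) continuous_on_snd[OF continuous_on_id]]) auto
qed

text \<open>Continuity comes before differentiability: differentiation under the integral requires
  the derivative of the integrand to be continuous.\<close>

lemma holo_on_derivative_continuous:
  fixes f :: "complex^3 \<Rightarrow> complex"
  assumes S: "open S" and f: "holo_on (*s) (*) f S"
  shows "continuous_on S (\<lambda>x. frechet_derivative f (at x) v)"
proof (rule continuous_at_imp_continuous_on, rule ballI)
  fix x0 assume x0: "x0 \<in> S"
  obtain U K c where U: "open U" "convex U" "x0 \<in> U" "continuous_on {0..1::real} K" "continuous_on {0..1} c"
    "\<And>x t. x \<in> U \<Longrightarrow> t \<in> {0..1} \<Longrightarrow> x + c t *s v \<in> S"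
    "\<And>x. x \<in> U \<Longrightarrow> frechet_derivative f (at x) v = integral {0..1} (\<lambda>t. K t * f (x + c t *s v))"
    by (rule holo_on_Cauchy_formula[OF S f x0]) (rule that)
  have "continuous_on U (\<lambda>x. integral (cbox 0 1) (\<lambda>t. K t * f (x + c t *s v)))"
    by (rule integral_continuous_on_param[OF continuous_on_shifted[OF holo_on_continuous_on[OF f] U(4,5,6)]])
  then have "continuous_on U (\<lambda>x. frechet_derivative f (at x) v)"
    by (rule continuous_on_eq) (simp add: U(7))
  then show "isCont (\<lambda>x. frechet_derivative f (at x) v) x0"
    using U(1,3) continuous_on_eq_continuous_at by blast
qed

text \<open>Differentiate Cauchy's formula under the integral; complex linearity passes through the
  integral. Iterating this gives smoothness.\<close>

lemma holo_on_derivative: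
  fixes f :: "complex^3 \<Rightarrow> complex"
  assumes S: "open S" and f: "holo_on (*s) (*) f S"
  shows "holo_on (*s) (*) (\<lambda>x. frechet_derivative f (at x) v) S"
  unfolding holo_on_def
proof
  fix x0 assume x0: "x0 \<in> S"
  obtain U K c where U: "open U" "convex U" "x0 \<in> U"
    "continuous_on {0..1::real} K" "continuous_on {0..1} c"
    and inS: "\<And>x t. x \<in> U \<Longrightarrow> t \<in> {0..1} \<Longrightarrow> x + c t *s v \<in> S"
    and repr: "\<And>x. x \<in> U \<Longrightarrow> frechet_derivative f (at x) v = integral {0..1} (\<lambda>t. K t * f (x + c t *s v))"
    by (rule holo_on_Cauchy_formula[OF S f x0]) (rule that)
  define D where "D y = frechet_derivative f (at y)" for y
  \<comment> \<open>The Leibniz rule wants the derivative of the integrand as an element of the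
    Banach space of bounded linear maps. In finite dimension its continuity may be tested on single
    vectors.\<close>
  define fx where "fx x t = Blinfun (\<lambda>h. K t * D (x + c t *s v) h)" for x t
  have blD: "bounded_linear (\<lambda>h. K t * D (x + c t *s v) h)" if "x \<in> U" "t \<in> {0..1}" for x t
    unfolding D_def
    using has_derivative_bounded_linear[OF holo_on_has_derivative[OF f inS[OF that]]]
    by (rule bounded_linear_const_mult)
  have fx_apply: "blinfun_apply (fx x t) h = K t * D (x + c t *s v) h" if "x \<in> U" "t \<in> {0..1}" for x t h
    unfolding fx_def using bounded_linear_Blinfun_apply[OF blD[OF that]] by simp
  have cont_fx: "continuous_on (U \<times> cbox 0 1) (\<lambda>(x, t). fx x t)"
  proof (rule continuous_on_blinfun_componentwise)
    fix i :: "complex^3"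
    have "continuous_on (U \<times> cbox 0 1) (\<lambda>(x, t). K t * D (x + c t *s v) i)"
      unfolding D_def
      by (rule continuous_on_shifted[OF holo_on_derivative_continuous[OF S f] U(4,5) inS])
    then show "continuous_on (U \<times> cbox 0 1) (\<lambda>z. blinfun_apply (case z of (x, t) \<Rightarrow> fx x t) i)"
      by (rule continuous_on_eq) (auto simp: fx_apply)
  qed
  have der: "((\<lambda>x. integral (cbox 0 1) (\<lambda>t. K t * f (x + c t *s v))) has_derivative
      integral (cbox 0 1) (fx x0)) (at x0 within U)"
  proof (rule leibniz_rule[OF _ _ cont_fx U(3,2)])
    fix x and t :: real assume xt: "x \<in> U" "t \<in> cbox 0 1"
    then have t: "t \<in> {0..1}" by simp
    have "((\<lambda>x. x + c t *s v) has_derivative (\<lambda>h. h + 0)) (at x within U)"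
      by (intro derivative_intros)
    from has_derivative_compose[OF this holo_on_has_derivative[OF f inS[OF xt(1) t]]]
    have "((\<lambda>x. f (x + c t *s v)) has_derivative (\<lambda>h. D (x + c t *s v) h)) (at x within U)"
      by (simp add: D_def)
    then have "((\<lambda>x. K t * f (x + c t *s v)) has_derivative (\<lambda>h. K t * D (x + c t *s v) h)) (at x within U)"
      by (rule has_derivative_mult_right)
    then show "((\<lambda>x. K t * f (x + c t *s v)) has_derivative blinfun_apply (fx x t)) (at x within U)"
      using fx_apply[OF xt(1) t] by (metis (no_types, lifting) ext)
  next
    fix x assume x: "x \<in> U"
    have "continuous_on (cbox 0 1) (\<lambda>t. (case (x, t) of (x, t) \<Rightarrow> K t * f (x + c t *s v)))"
      by (rule continuous_on_compose2[OF continuous_on_shifted[OF holo_on_continuous_on[OF f] U(4,5) inS]])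
         (use x in \<open>auto intro!: continuous_intros\<close>)
    then show "(\<lambda>t. K t * f (x + c t *s v)) integrable_on cbox 0 1"
      by (intro integrable_continuous) simp
  qed
  have int_fx: "fx x0 integrable_on cbox 0 1"
  proof (rule integrable_continuous)
    have "continuous_on (cbox 0 1) (\<lambda>t. (case (x0, t) of (x, t) \<Rightarrow> fx x t))"
      by (rule continuous_on_compose2[OF cont_fx]) (use U(3) in \<open>auto intro!: continuous_intros\<close>)
    then show "continuous_on (cbox 0 1) (fx x0)" by simp
  qed
  have apply_int: "blinfun_apply (integral (cbox 0 1) (fx x0)) h = integral {0..1} (\<lambda>t. K t * D (x0 + c t *s v) h)" for h
  proof -
    have "blinfun_apply (integral (cbox 0 1) (fx x0)) h = integral (cbox 0 1) (\<lambda>t. blinfun_apply (fx x0 t) h)"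
      by (rule blinfun_apply_integral[OF int_fx])
    also have "\<dots> = integral {0..1} (\<lambda>t. K t * D (x0 + c t *s v) h)"
      unfolding cbox_interval by (rule integral_cong) (simp add: fx_apply U(3))
    finally show ?thesis .
  qed
  have "((\<lambda>x. frechet_derivative f (at x) v) has_derivative blinfun_apply (integral (cbox 0 1) (fx x0))) (at x0)"
    using has_derivative_transform_within_open[OF der[unfolded at_within_open[OF U(3,1)]] U(1,3)]
    by (simp add: repr)
  moreover have "blinfun_apply (integral (cbox 0 1) (fx x0)) (k *s h) = k * blinfun_apply (integral (cbox 0 1) (fx x0)) h" for k h
  proof -
    have "integral {0..1} (\<lambda>t. K t * D (x0 + c t *s v) (k *s h)) = integral {0..1} (\<lambda>t. k * (K t * D (x0 + c t *s v) h))"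
      unfolding D_def by (rule integral_cong) (simp add: holo_on_derivative_scale[OF f inS[OF U(3)]])
    then show ?thesis unfolding apply_int by simp
  qed
  ultimately show "\<exists>f'. ((\<lambda>x. frechet_derivative f (at x) v) has_derivative f') (at x0) \<and>
      (\<forall>k h. f' (k *s h) = k * f' h)"
    by blast
qed

lemma holo_on_imp_smooth_on:
  fixes f :: "complex^3 \<Rightarrow> complex"
  assumes S: "open S" and f: "holo_on (*s) (*) f S"
  shows "smooth_on f S"
proof -
  have "Ck_on k f S" for k
    using f
  proof (induction k arbitrary: f)
    case 0
    then show ?case by (simp add: holo_on_continuous_on)
  next
    case (Suc k)
    have "f differentiable (at x)" if "x \<in> S" for x
      using holo_on_has_derivative[OF Suc.prems that] by (rule differentiableI)
    then show ?case
      using Suc.IH[OF holo_on_derivative[OF S Suc.prems]] by simp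
  qed
  then show ?thesis by (simp add: smooth_on_def)
qed

lemma holo_on_component:
  fixes f :: "complex^3 \<Rightarrow> complex^3"
  assumes "holo_on (*s) (*s) f S"
  shows "holo_on (*s) (*) (\<lambda>x. f x $ i) S"
  unfolding holo_on_def
proof
  fix x assume "x \<in> S"
  then have "(f has_derivative frechet_derivative f (at x)) (at x)"
    and "frechet_derivative f (at x) (k *s v) = k *s frechet_derivative f (at x) v" for k v
    using holo_on_has_derivative[OF assms] holo_on_derivative_scale[OF assms] by auto
  then show "\<exists>f'. ((\<lambda>x. f x $ i) has_derivative f') (at x) \<and> (\<forall>k v. f' (k *s v) = k * f' v)"
    using bounded_linear.has_derivative[OF bounded_linear_vec_nth]
    by (intro exI[of _ "\<lambda>v. frechet_derivative f (at x) v $ i"]) auto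
qed

lemma holo_on_vec_imp_smooth_on:
  fixes f :: "complex^3 \<Rightarrow> complex^3"
  assumes "open S" "holo_on (*s) (*s) f S"
  shows "smooth_on f S"
  by (rule smooth_on_vecI[OF assms(1) holo_on_imp_smooth_on[OF assms(1) holo_on_component[OF assms(2)]]])

section \<open>Charts, vector fields and maps on a complex threefold\<close>

text \<open>Vector-valued, because the components of a vector field in a frame lie in
  \<open>complex^3\<close>. On real functions this and \<open>mderiv\<close> agree with
  \<open>smooth_fun\<close> and \<open>dir_deriv\<close>.\<close>

definition smooth_map :: "'g chart set \<Rightarrow> ('g \<Rightarrow> 'b::real_normed_vector) \<Rightarrow> bool" where
  "smooth_map A F \<longleftrightarrow> (\<forall>c\<in>A. smooth_on (\<lambda>y. F (chart_inv c y)) (chart_range c))"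

definition mderiv :: "'g chart set \<Rightarrow> ('g \<Rightarrow> 'b::real_normed_vector) \<Rightarrow> 'g \<Rightarrow> complex^3 \<Rightarrow> 'b" where
  "mderiv A F p = frechet_derivative (\<lambda>y. F (chart_inv (chart_at A p) y)) (at (snd (chart_at A p) p))"

lemma smooth_fun_iff_smooth_map: "smooth_fun A f \<longleftrightarrow> smooth_map A f"
  by (simp add: smooth_fun_def smooth_map_def o_def)

lemma dir_deriv_eq_mderiv: "dir_deriv A f p v = mderiv A f p v"
  by (simp add: dir_deriv_def mderiv_def o_def)

context complex_threefold
begin

lemma chart_at_mem: "chart_at A p \<in> A" "p \<in> fst (chart_at A p)"
proof -
  have "\<exists>c. c \<in> A \<and> p \<in> fst c" using charts_cover by blast
  then show "chart_at A p \<in> A" "p \<in> fst (chart_at A p)"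
    unfolding chart_at_def using someI_ex by (metis (mono_tags, lifting))+
qed

lemma chart_inv_snd: "c \<in> A \<Longrightarrow> p \<in> fst c \<Longrightarrow> chart_inv c (snd c p) = p"
  using chart_homeo homeomorphism_apply1 by metis

lemma snd_chart_inv: "y \<in> chart_range c \<Longrightarrow> snd c (chart_inv c y) = y"
  and chart_inv_mem: "y \<in> chart_range c \<Longrightarrow> chart_inv c y \<in> fst c"
  by (rule f_inv_into_f, assumption) (rule inv_into_into)

lemma continuous_chart_inv: "c \<in> A \<Longrightarrow> continuous_on (chart_range c) (chart_inv c)"
  using chart_homeo homeomorphism_cont2 by metis

lemma open_chart_image:
  assumes "c \<in> A" "open U"
  shows "open (snd c ` (fst c \<inter> U))"
proof -
  have "snd c ` (fst c \<inter> U) = chart_range c \<inter> chart_inv c -` U"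
    using chart_inv_snd[OF assms(1)] snd_chart_inv chart_inv_mem by force
  then show ?thesis
    using continuous_open_preimage[OF continuous_chart_inv[OF assms(1)] chart_range_open[OF assms(1)] assms(2)]
    by simp
qed

lemma transition_snd: "c \<in> A \<Longrightarrow> p \<in> fst c \<Longrightarrow> transition c d (snd c p) = snd d p"
  by (simp add: transition_def chart_inv_snd)

lemma smooth_on_transition:
  "c \<in> A \<Longrightarrow> d \<in> A \<Longrightarrow> smooth_on (transition c d) (snd c ` (fst c \<inter> fst d))"
  by (intro holo_on_vec_imp_smooth_on open_chart_image chart_open charts_compatible)

lemma transition_has_derivative:
  assumes "c \<in> A" "d \<in> A" "p \<in> fst c" "p \<in> fst d"
  shows "(transition c d has_derivative change c d p) (at (snd c p))"
  unfolding change_def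
  by (rule smooth_on_has_derivative[OF smooth_on_transition]) (use assms in auto)

lemma change_scale:
  assumes "c \<in> A" "d \<in> A" "p \<in> fst c" "p \<in> fst d"
  shows "change c d p (k *s v) = k *s change c d p v"
  unfolding change_def
  by (rule holo_on_derivative_scale[OF charts_compatible]) (use assms in auto)

lemma linear_change:
  assumes "c \<in> A" "d \<in> A" "p \<in> fst c" "p \<in> fst d"
  shows "linear (change c d p)"
  using transition_has_derivative[OF assms] by (rule has_derivative_linear)

lemma change_change:
  assumes "c \<in> A" "d \<in> A" "e \<in> A" "p \<in> fst c" "p \<in> fst d" "p \<in> fst e"
  shows "change d e p (change c d p v) = change c e p v"
proof -
  define O' where "O' = snd c ` (fst c \<inter> (fst d \<inter> fst e))"
  have O': "open O'" "snd c p \<in> O'"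
    unfolding O'_def using open_chart_image[OF assms(1) open_Int[OF chart_open[OF assms(2)] chart_open[OF assms(3)]]] assms
    by auto
  have eq: "transition d e (transition c d y) = transition c e y" if "y \<in> O'" for y
    using that assms by (auto simp: O'_def transition_snd)
  have "((\<lambda>y. transition d e (transition c d y)) has_derivative (\<lambda>v. change d e p (change c d p v))) (at (snd c p))"
    using has_derivative_compose[OF transition_has_derivative[OF assms(1,2,4,5)]]
      transition_has_derivative[OF assms(2,3,5,6)] transition_snd[OF assms(1,4)] by metis
  from has_derivative_transform_within_open[OF this O' eq]
  have "(transition c e has_derivative (\<lambda>v. change d e p (change c d p v))) (at (snd c p))" .
  from has_derivative_unique[OF this transition_has_derivative[OF assms(1,3,4,6)]]
  show ?thesis by metis
qed

lemma change_id:
  assumes "c \<in> A" "p \<in> fst c"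
  shows "change c c p v = v"
proof -
  have "transition c c y = y" if "y \<in> chart_range c" for y
    using that by (simp add: transition_def snd_chart_inv)
  then have "(transition c c has_derivative (\<lambda>v. v)) (at (snd c p))"
    using has_derivative_transform_within_open[OF has_derivative_ident chart_range_open[OF assms(1)]]
      assms(2) by (metis imageI)
  from has_derivative_unique[OF this transition_has_derivative[OF assms(1,1,2,2)]]
  show ?thesis by metis
qed

lemma vfield_in_snd:
  "c \<in> A \<Longrightarrow> p \<in> fst c \<Longrightarrow> vfield_in A c X (snd c p) = change (chart_at A p) c p (X p)"
  by (simp add: vfield_in_def chart_inv_snd)

lemma vfield_in_chart_at: "vfield_in A (chart_at A p) X (snd (chart_at A p) p) = X p"
  by (simp add: vfield_in_snd chart_at_mem change_id)

lemma form_in_snd: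
  "c \<in> A \<Longrightarrow> p \<in> fst c \<Longrightarrow> form_in A c \<alpha> (snd c p) w = \<alpha> p (change c (chart_at A p) p w)"
  by (simp add: form_in_def chart_inv_snd)

text \<open>Chart independence of \<open>mderiv\<close>: the preferred chart may jump from point to
  point, whereas regularity is tested in one fixed chart \<open>c\<close>.\<close>

lemma smooth_map_has_derivative:
  assumes "smooth_map A F" "c \<in> A" "p \<in> fst c"
  shows "((\<lambda>y. F (chart_inv c y)) has_derivative
      (\<lambda>w. mderiv A F p (change c (chart_at A p) p w))) (at (snd c p))"
proof -
  define d where "d = chart_at A p"
  have d: "d \<in> A" "p \<in> fst d" unfolding d_def by (rule chart_at_mem)+
  have "((\<lambda>y. F (chart_inv d y)) has_derivative mderiv A F p) (at (snd d p))"
    using assms(1) d unfolding smooth_map_def mderiv_def d_def[symmetric]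
    by (intro smooth_on_has_derivative[where S = "chart_range d"]) auto
  then have "((\<lambda>y. F (chart_inv d y)) has_derivative mderiv A F p) (at (transition c d (snd c p)))"
    by (simp add: transition_snd assms)
  from has_derivative_compose[OF transition_has_derivative[OF assms(2) d(1) assms(3) d(2)] this]
  have 1: "((\<lambda>y. F (chart_inv d (transition c d y))) has_derivative
      (\<lambda>w. mderiv A F p (change c d p w))) (at (snd c p))" .
  have 2: "open (snd c ` (fst c \<inter> fst d))" "snd c p \<in> snd c ` (fst c \<inter> fst d)"
    using open_chart_image[OF assms(2) chart_open[OF d(1)]] assms d by auto
  have 3: "F (chart_inv d (transition c d y)) = F (chart_inv c y)" if "y \<in> snd c ` (fst c \<inter> fst d)" for y
    using that d assms(2) by (auto simp: transition_snd chart_inv_snd)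
  show ?thesis
    using has_derivative_transform_within_open[OF 1 2 3] unfolding d_def .
qed

lemma smooth_map_has_derivative_at:
  assumes "smooth_map A F"
  shows "((\<lambda>y. F (chart_inv (chart_at A p) y)) has_derivative mderiv A F p) (at (snd (chart_at A p) p))"
  using smooth_map_has_derivative[OF assms chart_at_mem] by (simp add: change_id chart_at_mem)

lemma mderiv_eqI:
  "((\<lambda>y. F (chart_inv (chart_at A p) y)) has_derivative D) (at (snd (chart_at A p) p)) \<Longrightarrow> mderiv A F p = D"
  unfolding mderiv_def by (rule frechet_derivative_eqI)

lemma linear_mderiv: "smooth_map A F \<Longrightarrow> linear (mderiv A F p)"
  using smooth_map_has_derivative_at by (rule has_derivative_linear)

lemma mderiv_add:
  assumes "smooth_map A F" "smooth_map A H"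
  shows "mderiv A (\<lambda>q. F q + H q) p v = mderiv A F p v + mderiv A H p v"
  using mderiv_eqI[OF has_derivative_add[OF smooth_map_has_derivative_at[OF assms(1)] smooth_map_has_derivative_at[OF assms(2)]]]
  by metis

lemma mderiv_bilinear:
  assumes "bounded_bilinear b" "smooth_map A F" "smooth_map A H"
  shows "mderiv A (\<lambda>q. b (F q) (H q)) p v = b (F p) (mderiv A H p v) + b (mderiv A F p v) (H p)"
  using mderiv_eqI[OF bounded_bilinear.FDERIV[OF assms(1) smooth_map_has_derivative_at[OF assms(2)]
      smooth_map_has_derivative_at[OF assms(3)]]] chart_inv_snd[OF chart_at_mem]
  by simp

lemma mderiv_bounded_linear:
  assumes "bounded_linear b" "smooth_map A F"
  shows "mderiv A (\<lambda>q. b (F q)) p v = b (mderiv A F p v)"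
  using mderiv_eqI[OF bounded_linear.has_derivative[OF assms(1) smooth_map_has_derivative_at[OF assms(2)]]]
  by simp

lemma smooth_map_const: "smooth_map A (\<lambda>q. x)"
  unfolding smooth_map_def using smooth_on_const[OF chart_range_open] by blast

lemma mderiv_const: "mderiv A (\<lambda>q. x) p v = 0"
  using mderiv_eqI[OF has_derivative_const] by metis

lemma smooth_map_add: "smooth_map A F \<Longrightarrow> smooth_map A H \<Longrightarrow> smooth_map A (\<lambda>q. F q + H q)"
  unfolding smooth_map_def using smooth_on_add[OF chart_range_open] by blast

lemma smooth_map_bilinear:
  "bounded_bilinear b \<Longrightarrow> smooth_map A F \<Longrightarrow> smooth_map A H \<Longrightarrow> smooth_map A (\<lambda>q. b (F q) (H q))"
  unfolding smooth_map_def using smooth_on_bilinear[OF chart_range_open] by blast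

lemma smooth_map_mderiv:
  assumes "smooth_map A F" "smooth_vfield A X"
  shows "smooth_map A (\<lambda>p. mderiv A F p (X p))"
  unfolding smooth_map_def
proof
  fix c assume c: "c \<in> A"
  define f where "f y = F (chart_inv c y)" for y
  have f: "smooth_on f (chart_range c)"
    using assms(1) c unfolding smooth_map_def f_def by blast
  have "smooth_on (\<lambda>y. frechet_derivative f (at y) (vfield_in A c X y)) (chart_range c)"
    by (rule smooth_on_apply_linear[OF chart_range_open[OF c] has_derivative_linear[OF smooth_on_has_derivative[OF f]]
          smooth_on_frechet_derivative[OF f]])
       (use assms(2) c in \<open>auto simp: smooth_vfield_def\<close>)
  moreover have "frechet_derivative f (at y) (vfield_in A c X y) = mderiv A F (chart_inv c y) (X (chart_inv c y))"
    if "y \<in> chart_range c" for y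
  proof -
    define p where "p = chart_inv c y"
    have p: "p \<in> fst c" "y = snd c p"
      using that by (simp_all add: p_def snd_chart_inv chart_inv_mem)
    show ?thesis
      unfolding p_def[symmetric] p(2)
      using frechet_derivative_eqI[OF smooth_map_has_derivative[OF assms(1) c p(1)]]
      by (simp add: f_def[abs_def] vfield_in_snd c p(1) change_change chart_at_mem change_id chart_inv_snd)
  qed
  ultimately show "smooth_on (\<lambda>y. mderiv A F (chart_inv c y) (X (chart_inv c y))) (chart_range c)"
    using smooth_on_cong[OF chart_range_open[OF c]] by (metis (no_types, lifting))
qed

text \<open>A smooth curve lives on an open set around the unit interval, so its velocity is a
  two-sided derivative even at the endpoints, and by continuity it stays for a while in the
  preferred chart of \<open>\<gamma> t\<close>.\<close>

lemma smooth_curve_chart_derivative: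
  assumes "smooth_curve A \<gamma>" "t \<in> {0..1}"
  shows "(snd (chart_at A (\<gamma> t)) \<circ> \<gamma> has_vector_derivative velocity A \<gamma> t) (at t)"
    and "\<exists>U. open U \<and> t \<in> U \<and> \<gamma> ` U \<subseteq> fst (chart_at A (\<gamma> t))"
proof -
  define c where "c = chart_at A (\<gamma> t)"
  have c: "c \<in> A" "\<gamma> t \<in> fst c" unfolding c_def by (rule chart_at_mem)+
  obtain S where S: "open S" "{0..1} \<subseteq> S" "continuous_on S \<gamma>"
    "\<forall>c\<in>A. smooth_on (snd c \<circ> \<gamma>) (S \<inter> \<gamma> -` fst c)"
    using assms(1) unfolding smooth_curve_def by blast
  have "t \<in> S \<inter> \<gamma> -` fst c" using S assms(2) c by auto
  from smooth_on_has_derivative[OF _ this] S(4) c(1)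
  have "(snd c \<circ> \<gamma>) differentiable (at t)"
    by (blast intro: differentiableI)
  then show "(snd (chart_at A (\<gamma> t)) \<circ> \<gamma> has_vector_derivative velocity A \<gamma> t) (at t)"
    unfolding velocity_def c_def by (simp add: vector_derivative_works)
  have "open (S \<inter> \<gamma> -` fst c)"
    using continuous_open_preimage[OF S(3,1) chart_open[OF c(1)]] .
  then show "\<exists>U. open U \<and> t \<in> U \<and> \<gamma> ` U \<subseteq> fst (chart_at A (\<gamma> t))"
    using \<open>t \<in> S \<inter> \<gamma> -` fst c\<close> unfolding c_def[symmetric] by blast
qed

lemma smooth_map_curve_derivative:
  assumes "smooth_map A F" "smooth_curve A \<gamma>" "t \<in> {0..1}"
  shows "((\<lambda>s. F (\<gamma> s)) has_vector_derivative mderiv A F (\<gamma> t) (velocity A \<gamma> t)) (at t)"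
proof -
  define c where "c = chart_at A (\<gamma> t)"
  have c: "c \<in> A" "\<gamma> t \<in> fst c" unfolding c_def by (rule chart_at_mem)+
  obtain U where U: "open U" "t \<in> U" "\<gamma> ` U \<subseteq> fst c"
    using smooth_curve_chart_derivative(2)[OF assms(2,3)] unfolding c_def by blast
  have 1: "((\<lambda>s. snd c (\<gamma> s)) has_derivative (\<lambda>h. h *\<^sub>R velocity A \<gamma> t)) (at t)"
    using smooth_curve_chart_derivative(1)[OF assms(2,3)]
    unfolding has_vector_derivative_def c_def o_def .
  have 2: "((\<lambda>y. F (chart_inv c y)) has_derivative mderiv A F (\<gamma> t)) (at (snd c (\<gamma> t)))"
    unfolding c_def by (rule smooth_map_has_derivative_at[OF assms(1)])
  have "((\<lambda>s. F (chart_inv c (snd c (\<gamma> s)))) has_derivative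
      (\<lambda>h. mderiv A F (\<gamma> t) (h *\<^sub>R velocity A \<gamma> t))) (at t)"
    by (rule has_derivative_compose[OF 1 2])
  moreover have "F (chart_inv c (snd c (\<gamma> s))) = F (\<gamma> s)" if "s \<in> U" for s
    using that U(3) c(1) by (simp add: chart_inv_snd image_subset_iff)
  ultimately have "((\<lambda>s. F (\<gamma> s)) has_derivative (\<lambda>h. mderiv A F (\<gamma> t) (h *\<^sub>R velocity A \<gamma> t))) (at t)"
    using has_derivative_transform_within_open[OF _ U(1,2), where g = "\<lambda>s. F (\<gamma> s)"] by simp
  then show ?thesis
    unfolding has_vector_derivative_def linear_scale[OF linear_mderiv[OF assms(1)]] .
qed

end

section \<open>Holomorphic coframes\<close>

lemma holo_on_const: "holo_on (*s) (*) (\<lambda>y :: complex^3. k) S"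
  unfolding holo_on_def by (auto intro!: exI[of _ "\<lambda>v. 0"])

lemma holo_on_diff:
  fixes f g :: "complex^3 \<Rightarrow> complex"
  assumes "holo_on (*s) (*) f S" "holo_on (*s) (*) g S"
  shows "holo_on (*s) (*) (\<lambda>y. f y - g y) S"
  unfolding holo_on_def
proof
  fix x assume x: "x \<in> S"
  show "\<exists>f'. ((\<lambda>y. f y - g y) has_derivative f') (at x) \<and> (\<forall>k v. f' (k *s v) = k * f' v)"
    by (rule exI, rule conjI, rule has_derivative_diff[OF holo_on_has_derivative[OF assms(1) x] holo_on_has_derivative[OF assms(2) x]])
       (simp add: holo_on_derivative_scale[OF assms(1) x] holo_on_derivative_scale[OF assms(2) x] right_diff_distrib)
qed

lemma holo_on_add:
  fixes f g :: "complex^3 \<Rightarrow> complex"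
  assumes "holo_on (*s) (*) f S" "holo_on (*s) (*) g S"
  shows "holo_on (*s) (*) (\<lambda>y. f y + g y) S"
  using holo_on_diff[OF assms(1) holo_on_diff[OF holo_on_const[of 0] assms(2)]] by simp

lemma holo_on_mult:
  fixes f g :: "complex^3 \<Rightarrow> complex"
  assumes "holo_on (*s) (*) f S" "holo_on (*s) (*) g S"
  shows "holo_on (*s) (*) (\<lambda>y. f y * g y) S"
  unfolding holo_on_def
proof
  fix x assume x: "x \<in> S"
  show "\<exists>f'. ((\<lambda>y. f y * g y) has_derivative f') (at x) \<and> (\<forall>k v. f' (k *s v) = k * f' v)"
    by (rule exI, rule conjI, rule has_derivative_mult[OF holo_on_has_derivative[OF assms(1) x] holo_on_has_derivative[OF assms(2) x]])
       (simp add: holo_on_derivative_scale[OF assms(1) x] holo_on_derivative_scale[OF assms(2) x] algebra_simps)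
qed

lemma holo_on_divide:
  fixes f g :: "complex^3 \<Rightarrow> complex"
  assumes "holo_on (*s) (*) f S" "holo_on (*s) (*) g S" "\<And>x. x \<in> S \<Longrightarrow> g x \<noteq> 0"
  shows "holo_on (*s) (*) (\<lambda>y. f y / g y) S"
  unfolding holo_on_def
proof
  fix x assume x: "x \<in> S"
  show "\<exists>f'. ((\<lambda>y. f y / g y) has_derivative f') (at x) \<and> (\<forall>k v. f' (k *s v) = k * f' v)"
    by (rule exI, rule conjI, rule has_derivative_divide[OF holo_on_has_derivative[OF assms(1) x] holo_on_has_derivative[OF assms(2) x] assms(3)[OF x]])
       (simp add: holo_on_derivative_scale[OF assms(1) x] holo_on_derivative_scale[OF assms(2) x] algebra_simps)
qed

lemma holo_on_cong:
  "(\<And>x. x \<in> S \<Longrightarrow> f x = g x) \<Longrightarrow> open S \<Longrightarrow> holo_on s t f S \<Longrightarrow> holo_on s t g S"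
  unfolding holo_on_def by (metis has_derivative_transform_within_open)

lemma has_derivative_vecI:
  fixes f :: "'a::real_normed_vector \<Rightarrow> complex^3"
  assumes "\<And>i. ((\<lambda>y. f y $ i) has_derivative (\<lambda>v. D v $ i)) (at x)"
  shows "(f has_derivative D) (at x)"
proof (rule has_derivative_componentwise_within[THEN iffD2], rule ballI)
  fix b :: "complex^3" assume "b \<in> Basis"
  then obtain i u where b: "b = axis i u" by (auto simp: Basis_vec_def)
  have "((\<lambda>y. f y $ i \<bullet> u) has_derivative (\<lambda>v. D v $ i \<bullet> u)) (at x)"
    by (rule has_derivative_inner_left[OF assms])
  then show "((\<lambda>y. f y \<bullet> b) has_derivative (\<lambda>v. D v \<bullet> b)) (at x)"
    by (simp add: b inner_axis)
qed

lemma holo_on_vecI: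
  fixes f :: "complex^3 \<Rightarrow> complex^3"
  assumes "\<And>i. holo_on (*s) (*) (\<lambda>y. f y $ i) S"
  shows "holo_on (*s) (*s) f S"
  unfolding holo_on_def
proof
  fix x assume x: "x \<in> S"
  define D where "D v = (\<chi> i. frechet_derivative (\<lambda>y. f y $ i) (at x) v)" for v
  have "((\<lambda>y. f y $ i) has_derivative (\<lambda>v. D v $ i)) (at x)" for i
    using holo_on_has_derivative[OF assms x] by (simp add: D_def)
  then have "(f has_derivative D) (at x)"
    by (rule has_derivative_vecI)
  moreover have "D (k *s v) = k *s D v" for k v
    by (simp add: D_def vec_eq_iff holo_on_derivative_scale[OF assms x])
  ultimately show "\<exists>f'. (f has_derivative f') (at x) \<and> (\<forall>k v. f' (k *s v) = k *s f' v)" by blast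
qed

lemma holo_on_det3:
  fixes M :: "complex^3 \<Rightarrow> complex^3^3"
  assumes "\<And>i j. holo_on (*s) (*) (\<lambda>y. M y $ i $ j) S"
  shows "holo_on (*s) (*) (\<lambda>y. det (M y)) S"
  unfolding det_3 by (rule holo_on_diff holo_on_add holo_on_mult assms)+

text \<open>A product rule for a varying linear map whose derivative is known one vector at a time.
  Linearity of \<open>D'\<close> in that vector follows from uniqueness of derivatives; then
  everything is expanded in a basis.\<close>

lemma has_derivative_apply_linear:
  fixes D :: "'a::real_normed_vector \<Rightarrow> 'b::euclidean_space \<Rightarrow> 'c::real_normed_vector"
  assumes lin: "\<And>y. y \<in> S \<Longrightarrow> linear (D y)" and S: "open S" "x \<in> S"
    and D: "\<And>w. ((\<lambda>y. D y w) has_derivative D' w) (at x)" and X: "(X has_derivative X') (at x)"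
  shows "((\<lambda>y. D y (X y)) has_derivative (\<lambda>u. D x (X' u) + D' (X x) u)) (at x)"
proof -
  have D'_lin: "linear (\<lambda>w. D' w u)" for u
  proof (rule linearI)
    fix w w'
    have "((\<lambda>y. D y w + D y w') has_derivative (\<lambda>u. D' w u + D' w' u)) (at x)"
      by (rule has_derivative_add[OF D D])
    then have "((\<lambda>y. D y (w + w')) has_derivative (\<lambda>u. D' w u + D' w' u)) (at x)"
      by (rule has_derivative_transform_within_open[OF _ S]) (simp add: linear_add[OF lin])
    from has_derivative_unique[OF D this] show "D' (w + w') u = D' w u + D' w' u" by metis
  next
    fix r w
    have "((\<lambda>y. r *\<^sub>R D y w) has_derivative (\<lambda>u. r *\<^sub>R D' w u)) (at x)"
      by (rule has_derivative_scaleR_right[OF D])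
    then have "((\<lambda>y. D y (r *\<^sub>R w)) has_derivative (\<lambda>u. r *\<^sub>R D' w u)) (at x)"
      by (rule has_derivative_transform_within_open[OF _ S]) (simp add: linear_scale[OF lin])
    from has_derivative_unique[OF D this] show "D' (r *\<^sub>R w) u = r *\<^sub>R D' w u" by metis
  qed
  have "((\<lambda>y. \<Sum>b\<in>Basis. (X y \<bullet> b) *\<^sub>R D y b) has_derivative
      (\<lambda>u. \<Sum>b\<in>Basis. (X x \<bullet> b) *\<^sub>R D' b u + (X' u \<bullet> b) *\<^sub>R D x b)) (at x)"
    by (rule has_derivative_sum, rule has_derivative_scaleR[OF has_derivative_inner_left[OF X] D])
  also have "(\<lambda>u. \<Sum>b\<in>Basis. (X x \<bullet> b) *\<^sub>R D' b u + (X' u \<bullet> b) *\<^sub>R D x b) = (\<lambda>u. D x (X' u) + D' (X x) u)"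
  proof
    fix u
    have a: "D x (X' u) = (\<Sum>b\<in>Basis. (X' u \<bullet> b) *\<^sub>R D x b)"
      by (rule linear_euclidean_expand[OF lin[OF S(2)]])
    have b: "D' (X x) u = (\<Sum>b\<in>Basis. (X x \<bullet> b) *\<^sub>R D' b u)"
      by (rule linear_euclidean_expand[OF D'_lin])
    show "(\<Sum>b\<in>Basis. (X x \<bullet> b) *\<^sub>R D' b u + (X' u \<bullet> b) *\<^sub>R D x b) = D x (X' u) + D' (X x) u"
      unfolding a b sum.distrib by (rule add.commute)
  qed
  finally have "((\<lambda>y. \<Sum>b\<in>Basis. (X y \<bullet> b) *\<^sub>R D y b) has_derivative (\<lambda>u. D x (X' u) + D' (X x) u)) (at x)" .
  then show ?thesis
    by (rule has_derivative_transform_within_open[OF _ S]) (simp add: linear_euclidean_expand[OF lin, symmetric])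
qed

section \<open>A holomorphic coframe and its dual frame\<close>

locale holomorphic_coframe = complex_threefold A
  for A :: "'g::{t2_space,second_countable_topology} chart set" +
  fixes \<phi> :: "3 \<Rightarrow> 'g form1"
  assumes holomorphic_form: "holomorphic_10_form A (\<phi> i)"
    and independent: "(\<And>i. \<phi> i p v = 0) \<Longrightarrow> v = 0"
begin

definition coframe :: "'g \<Rightarrow> complex^3 \<Rightarrow> complex^3" where
  "coframe p v = (\<chi> i. \<phi> i p v)"

definition frame :: "'g \<Rightarrow> complex^3 \<Rightarrow> complex^3" where
  "frame p = inv_into UNIV (coframe p)"

definition coframe_in :: "'g chart \<Rightarrow> complex^3 \<Rightarrow> complex^3 \<Rightarrow> complex^3" where
  "coframe_in c y w = (\<chi> i. form_in A c (\<phi> i) y w)"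

definition frame_in :: "'g chart \<Rightarrow> complex^3 \<Rightarrow> complex^3 \<Rightarrow> complex^3" where
  "frame_in c y w = vfield_in A c (\<lambda>p. frame p w) y"

lemma coframe_scale: "coframe p (k *s v) = k *s coframe p v"
  and coframe_add: "coframe p (u + v) = coframe p u + coframe p v"
proof -
  have "Vector_Spaces.linear (*s) (*) (\<phi> i p)" for i
    using holomorphic_form[of i] unfolding holomorphic_10_form_def by blast
  then have "\<phi> i p (k *s v) = k * \<phi> i p v" "\<phi> i p (u + v) = \<phi> i p u + \<phi> i p v" for i
    unfolding Vector_Spaces.linear_iff by simp_all
  then show "coframe p (k *s v) = k *s coframe p v" "coframe p (u + v) = coframe p u + coframe p v"
    by (simp_all add: coframe_def vec_eq_iff)
qed

lemma linear_coframe: "linear (coframe p)"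
  by (rule linearI) (simp_all only: coframe_add scaleR_eq_vector_smult coframe_scale)

lemma bij_coframe: "bij (coframe p)"
proof -
  have "inj (coframe p)"
    unfolding linear_injective_0[OF linear_coframe]
    using independent[of p] by (auto simp: coframe_def vec_eq_iff)
  then show ?thesis
    using linear_injective_imp_surjective[OF linear_coframe] by (simp add: bij_def)
qed

lemma frame_coframe: "frame p (coframe p v) = v"
  and coframe_frame: "coframe p (frame p v) = v"
  unfolding frame_def using bij_coframe bij_is_inj bij_is_surj
  by (simp_all add: inv_f_f surj_f_inv_f bij_is_inj bij_is_surj)

lemma coframe_eq_iff: "coframe p u = coframe p v \<longleftrightarrow> u = v"
  by (metis frame_coframe)

lemma frame_scale: "frame p (k *s v) = k *s frame p v"
  and frame_add: "frame p (u + v) = frame p u + frame p v"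
  by (metis frame_coframe coframe_frame coframe_scale) (metis frame_coframe coframe_frame coframe_add)

lemma linear_frame: "linear (frame p)"
  by (rule linearI) (simp_all only: frame_add scaleR_eq_vector_smult frame_scale)

lemma coframe_in_snd:
  "c \<in> A \<Longrightarrow> p \<in> fst c \<Longrightarrow> coframe_in c (snd c p) w = coframe p (change c (chart_at A p) p w)"
  by (simp add: coframe_in_def coframe_def form_in_snd)

lemma frame_in_snd:
  "c \<in> A \<Longrightarrow> p \<in> fst c \<Longrightarrow> frame_in c (snd c p) w = change (chart_at A p) c p (frame p w)"
  by (simp add: frame_in_def vfield_in_snd)

lemma coframe_in_vfield_in:
  assumes "c \<in> A" "y \<in> chart_range c"
  shows "coframe_in c y (vfield_in A c X y) = coframe (chart_inv c y) (X (chart_inv c y))"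
proof -
  define p where "p = chart_inv c y"
  have p: "p \<in> fst c" "y = snd c p"
    using assms by (simp_all add: p_def snd_chart_inv chart_inv_mem)
  show ?thesis
    unfolding p_def[symmetric] unfolding p(2)
    by (simp add: coframe_in_snd vfield_in_snd assms(1) p(1) change_change chart_at_mem change_id)
qed

lemma coframe_in_frame_in:
  "c \<in> A \<Longrightarrow> y \<in> chart_range c \<Longrightarrow> coframe_in c y (frame_in c y w) = w"
  by (simp add: frame_in_def coframe_in_vfield_in coframe_frame)

lemma coframe_in_linear:
  assumes "c \<in> A" "y \<in> chart_range c"
  shows "coframe_in c y (k *s w) = k *s coframe_in c y w" "linear (coframe_in c y)"
proof -
  define p where "p = chart_inv c y"
  have p: "p \<in> fst c" "y = snd c p"
    using assms by (simp_all add: p_def snd_chart_inv chart_inv_mem)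
  note ch = assms(1) chart_at_mem(1)[of p] p(1) chart_at_mem(2)[of p]
  show "coframe_in c y (k *s w) = k *s coframe_in c y w"
    unfolding p(2) by (simp add: coframe_in_snd ch change_scale coframe_scale)
  have "coframe_in c y = coframe p \<circ> change c (chart_at A p) p"
    unfolding p(2) by (rule ext) (simp add: coframe_in_snd ch)
  then show "linear (coframe_in c y)"
    using linear_compose[OF linear_change[OF ch] linear_coframe] by simp
qed

lemma frame_in_linear:
  assumes "c \<in> A" "y \<in> chart_range c"
  shows "linear (frame_in c y)"
proof -
  define p where "p = chart_inv c y"
  have p: "p \<in> fst c" "y = snd c p"
    using assms by (simp_all add: p_def snd_chart_inv chart_inv_mem)
  note ch = chart_at_mem(1)[of p] assms(1) chart_at_mem(2)[of p] p(1)
  have "frame_in c y = change (chart_at A p) c p \<circ> frame p"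
    unfolding p(2) by (rule ext) (simp add: frame_in_snd ch)
  then show ?thesis
    using linear_compose[OF linear_frame linear_change[OF ch]] by simp
qed

lemma holo_on_form_in: "c \<in> A \<Longrightarrow> holo_on (*s) (*) (\<lambda>y. form_in A c (\<phi> i) y w) (chart_range c)"
  using holomorphic_form[of i] unfolding holomorphic_10_form_def by blast

lemma smooth_on_coframe_in: "c \<in> A \<Longrightarrow> smooth_on (\<lambda>y. coframe_in c y w) (chart_range c)"
  by (rule smooth_on_vecI[OF chart_range_open])
     (simp_all add: coframe_in_def holo_on_imp_smooth_on[OF chart_range_open holo_on_form_in])

text \<open>The frame is the inverse matrix of the coframe, so that Cramer's rule applies.\<close>

lemma holo_on_frame_in:
  assumes c: "c \<in> A"
  shows "holo_on (*s) (*s) (\<lambda>y. frame_in c y w) (chart_range c)"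
proof -
  define N where "N y = (\<chi> i j. form_in A c (\<phi> i) y (axis j 1))" for y
  have N: "coframe_in c y v = N y *v v" if "y \<in> chart_range c" for y v
  proof -
    note lin = coframe_in_linear[OF c that]
    have "v = (\<Sum>j\<in>UNIV. (v $ j) *s axis j 1)"
      by (simp add: basis_expansion)
    then have "coframe_in c y v = (\<Sum>j\<in>UNIV. coframe_in c y ((v $ j) *s axis j 1))"
      using linear_sum[OF lin(2)] by metis
    also have "\<dots> = (\<Sum>j\<in>UNIV. (v $ j) *s coframe_in c y (axis j 1))" by (simp add: lin(1))
    also have "\<dots> = N y *v v"
      by (simp add: vec_eq_iff matrix_vector_mult_def N_def coframe_in_def mult.commute)
    finally show ?thesis .
  qed
  have det: "det (N y) \<noteq> 0" if "y \<in> chart_range c" for y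
  proof -
    have "surj ((*v) (N y))"
      using N[OF that] coframe_in_frame_in[OF c that] by (metis surjI)
    then show ?thesis
      using invertible_right_inverse matrix_right_invertible_surjective invertible_det_nz by blast
  qed
  have frame: "frame_in c y w $ k = det (\<chi> i j. if j = k then w $ i else N y $ i $ j) / det (N y)"
    if "y \<in> chart_range c" for y k
    using cramer[OF det[OF that], of "frame_in c y w" w] N[OF that] coframe_in_frame_in[OF c that] by simp
  have N_holo: "holo_on (*s) (*) (\<lambda>y. N y $ i $ j) (chart_range c)" for i j
    unfolding N_def using holo_on_form_in[OF c] by simp
  have "holo_on (*s) (*) (\<lambda>y. frame_in c y w $ k) (chart_range c)" for k
  proof (rule holo_on_cong[OF frame[symmetric] chart_range_open[OF c]])
    have "holo_on (*s) (*) (\<lambda>y. (\<chi> i j. if j = k then w $ i else N y $ i $ j) $ i $ j) (chart_range c)" for i j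
      using holo_on_const[of "w $ i"] N_holo[of i j] by (cases "j = k") simp_all
    then show "holo_on (*s) (*) (\<lambda>y. det (\<chi> i j. if j = k then w $ i else N y $ i $ j) / det (N y)) (chart_range c)"
      by (intro holo_on_divide holo_on_det3 N_holo det)
  qed
  then show ?thesis by (rule holo_on_vecI)
qed

lemma smooth_on_frame_in: "c \<in> A \<Longrightarrow> smooth_on (\<lambda>y. frame_in c y w) (chart_range c)"
  by (rule holo_on_vec_imp_smooth_on[OF chart_range_open holo_on_frame_in])

text \<open>Together with \<open>smooth_vfield_frame\<close> this identifies smooth vector fields
  with smooth component functions, so that later regularity questions never return to
  charts.\<close>

lemma smooth_map_coframe:
  assumes "smooth_vfield A Y"
  shows "smooth_map A (\<lambda>p. coframe p (Y p))"
  unfolding smooth_map_def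
proof
  fix c assume c: "c \<in> A"
  have "smooth_on (\<lambda>y. coframe_in c y (vfield_in A c Y y)) (chart_range c)"
    by (rule smooth_on_apply_linear[OF chart_range_open[OF c] coframe_in_linear(2)[OF c] smooth_on_coframe_in[OF c]])
       (use assms c in \<open>auto simp: smooth_vfield_def\<close>)
  then show "smooth_on (\<lambda>y. coframe (chart_inv c y) (Y (chart_inv c y))) (chart_range c)"
    using smooth_on_cong[OF chart_range_open[OF c], of "\<lambda>y. coframe_in c y (vfield_in A c Y y)"
        "\<lambda>y. coframe (chart_inv c y) (Y (chart_inv c y))"] coframe_in_vfield_in[OF c, of _ Y] by simp
qed

lemma smooth_vfield_frame:
  assumes "smooth_map A F"
  shows "smooth_vfield A (\<lambda>p. frame p (F p))"
  unfolding smooth_vfield_def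
proof
  fix c assume c: "c \<in> A"
  have "smooth_on (\<lambda>y. frame_in c y (F (chart_inv c y))) (chart_range c)"
    by (rule smooth_on_apply_linear[OF chart_range_open[OF c] frame_in_linear[OF c] smooth_on_frame_in[OF c]])
       (use assms c in \<open>auto simp: smooth_map_def\<close>)
  moreover have "vfield_in A c (\<lambda>p. frame p (F p)) = (\<lambda>y. frame_in c y (F (chart_inv c y)))"
    by (rule ext) (simp add: frame_in_def vfield_in_def)
  ultimately show "smooth_on (vfield_in A c (\<lambda>p. frame p (F p))) (chart_range c)"
    by simp
qed

lemma frame_vfield_smooth: "smooth_vfield A (\<lambda>p. frame p w)"
  by (rule smooth_vfield_frame[OF smooth_map_const])

text \<open>By the product rule each derivative of components has two parts. The parts that
  differentiate the vector fields combine to the Lie bracket, and those that differentiate the forms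
  are the exterior derivative.\<close>

lemma Cartan_formula:
  assumes "smooth_vfield A X" "smooth_vfield A Y"
  shows "mderiv A (\<lambda>q. coframe q (Y q)) p (X p) - mderiv A (\<lambda>q. coframe q (X q)) p (Y p)
    - coframe p (lie_bracket A X Y p) = (\<chi> i. ext_deriv A (\<phi> i) p (X p) (Y p))"
proof -
  define c where "c = chart_at A p"
  define x where "x = snd c p"
  have c: "c \<in> A" "p \<in> fst c" unfolding c_def by (rule chart_at_mem)+
  have x: "x \<in> chart_range c" using c by (simp add: x_def)
  define D where "D w = frechet_derivative (\<lambda>y. coframe_in c y w) (at x)" for w
  have D: "((\<lambda>y. coframe_in c y w) has_derivative D w) (at x)" for w
    unfolding D_def by (rule smooth_on_has_derivative[OF smooth_on_coframe_in[OF c(1)] x])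
  have co: "coframe_in c x w = coframe p w" for w
    unfolding x_def using coframe_in_snd[OF c] by (simp add: c_def change_id chart_at_mem)
  have main: "mderiv A (\<lambda>q. coframe q (Y q)) p u =
      coframe p (frechet_derivative (vfield_in A c Y) (at x) u) + D (Y p) u" if Y: "smooth_vfield A Y" for Y u
  proof -
    have "(vfield_in A c Y has_derivative frechet_derivative (vfield_in A c Y) (at x)) (at x)"
      using Y c x unfolding smooth_vfield_def by (blast intro: smooth_on_has_derivative)
    from has_derivative_apply_linear[OF coframe_in_linear(2)[OF c(1)] chart_range_open[OF c(1)] x D this]
    have "((\<lambda>y. coframe_in c y (vfield_in A c Y y)) has_derivative
        (\<lambda>u. coframe p (frechet_derivative (vfield_in A c Y) (at x) u) + D (Y p) u)) (at x)"
      unfolding co using vfield_in_chart_at[of p Y] by (simp add: x_def c_def)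
    then have "((\<lambda>y. coframe (chart_inv c y) (Y (chart_inv c y))) has_derivative
        (\<lambda>u. coframe p (frechet_derivative (vfield_in A c Y) (at x) u) + D (Y p) u)) (at x)"
      by (rule has_derivative_transform_within_open[OF _ chart_range_open[OF c(1)] x])
         (rule coframe_in_vfield_in[OF c(1)])
    from mderiv_eqI[OF this[unfolded x_def c_def]] show ?thesis
      by (simp add: x_def c_def)
  qed
  have ext: "(\<chi> i. ext_deriv A (\<phi> i) p u v) = D v u - D u v" for u v
  proof -
    have "D w h $ i = frechet_derivative (\<lambda>y. form_in A c (\<phi> i) y w) (at x) h" for w h i
    proof -
      have "((\<lambda>y. coframe_in c y w $ i) has_derivative (\<lambda>h. D w h $ i)) (at x)"
        by (rule bounded_linear.has_derivative[OF bounded_linear_vec_nth D])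
      then have "((\<lambda>y. form_in A c (\<phi> i) y w) has_derivative (\<lambda>h. D w h $ i)) (at x)"
        by (simp add: coframe_in_def)
      then show ?thesis by (simp add: frechet_derivative_eqI)
    qed
    then show ?thesis
      by (simp add: vec_eq_iff ext_deriv_def Let_def c_def x_def)
  qed
  show ?thesis
    unfolding main[OF assms(1)] main[OF assms(2)] ext lie_bracket_def Let_def c_def[symmetric] x_def[symmetric]
    by (simp add: linear_diff[OF linear_coframe])
qed

end

section \<open>Generating SU(3) by loops in two complex directions\<close>

text \<open>SU(2) acting on the coordinates \<open>m\<close> and \<open>n\<close>. The parameters
  are not normalized, so that products are given by quaternion multiplication without side
  conditions.\<close>

definition rot :: "3 \<Rightarrow> 3 \<Rightarrow> complex \<Rightarrow> complex \<Rightarrow> complex^3^3" where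
  "rot m n \<alpha> \<beta> = (\<chi> i j. if i = m \<and> j = m then \<alpha> else if i = m \<and> j = n then \<beta>
     else if i = n \<and> j = m then - cnj \<beta> else if i = n \<and> j = n then cnj \<alpha>
     else if i = j then 1 else 0)"

definition adjoint3 :: "complex^3^3 \<Rightarrow> complex^3^3" where
  "adjoint3 M = (\<chi> i j. cnj (M $ j $ i))"

lemma adjoint3_mult: "adjoint3 (M ** N) = adjoint3 N ** adjoint3 M"
  by (simp add: adjoint3_def matrix_matrix_mult_def vec_eq_iff mult.commute)

lemma SU3_iff: "M \<in> SU3 \<longleftrightarrow> M ** adjoint3 M = mat 1 \<and> det M = 1"
  by (simp add: SU3_def adjoint3_def)

lemma SU3_mult: "M \<in> SU3 \<Longrightarrow> N \<in> SU3 \<Longrightarrow> M ** N \<in> SU3"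
proof -
  assume M: "M \<in> SU3" and N: "N \<in> SU3"
  have "(M ** N) ** adjoint3 (M ** N) = M ** (N ** adjoint3 N) ** adjoint3 M"
    by (simp add: adjoint3_mult matrix_mul_assoc)
  then show ?thesis
    using M N by (simp add: SU3_iff det_mul)
qed

lemma exhaust_pair3: "m \<noteq> n \<Longrightarrow>
  (m = 1 \<and> n = 2) \<or> (m = 1 \<and> n = 3) \<or> (m = 2 \<and> n = 1) \<or> (m = 2 \<and> n = 3) \<or> (m = 3 \<and> n = 1) \<or> (m = 3 \<and> n = (2::3))"
  using exhaust_3[of m] exhaust_3[of n] by auto

lemma rot_mult_nth:
  assumes "m \<noteq> n"
  shows "(rot m n \<alpha> \<beta> ** M) $ i $ j = (if i = m then \<alpha> * M $ m $ j + \<beta> * M $ n $ j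
     else if i = n then cnj \<alpha> * M $ n $ j - cnj \<beta> * M $ m $ j else M $ i $ j)"
  using exhaust_pair3[OF assms] exhaust_3[of i]
  by (elim disjE; simp add: rot_def matrix_matrix_mult_def sum_3)

lemma rot_vec_nth:
  assumes "m \<noteq> n"
  shows "(rot m n \<alpha> \<beta> *v x) $ i = (if i = m then \<alpha> * x $ m + \<beta> * x $ n
     else if i = n then cnj \<alpha> * x $ n - cnj \<beta> * x $ m else x $ i)"
  using exhaust_pair3[OF assms] exhaust_3[of i]
  by (elim disjE; simp add: rot_def matrix_vector_mult_def sum_3)

lemma rot_mult:
  assumes "m \<noteq> n"
  shows "rot m n \<alpha> \<beta> ** rot m n \<alpha>' \<beta>' = rot m n (\<alpha> * \<alpha>' - \<beta> * cnj \<beta>') (\<alpha> * \<beta>' + \<beta> * cnj \<alpha>')"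
  using assms unfolding vec_eq_iff rot_mult_nth[OF assms] by (simp add: rot_def algebra_simps)

lemma rot_one:
  assumes "m \<noteq> n"
  shows "rot m n 1 0 = mat 1"
proof -
  have "rot m n 1 0 ** M = M" for M :: "complex^3^3"
    unfolding vec_eq_iff rot_mult_nth[OF assms] by simp
  from this[of "mat 1"] show ?thesis by simp
qed

lemma rot_SU3:
  assumes "m \<noteq> n" "\<alpha> * cnj \<alpha> + \<beta> * cnj \<beta> = 1"
  shows "rot m n \<alpha> \<beta> \<in> SU3"
proof -
  have "adjoint3 (rot m n \<alpha> \<beta>) = rot m n (cnj \<alpha>) (- \<beta>)"
    using exhaust_pair3[OF assms(1)]
    by (elim disjE; simp add: rot_def adjoint3_def vec_eq_iff forall_3)
  then have "rot m n \<alpha> \<beta> ** adjoint3 (rot m n \<alpha> \<beta>) = mat 1"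
    using assms by (simp add: rot_mult rot_one)
  moreover have "det (rot m n \<alpha> \<beta>) = 1"
    using exhaust_pair3[OF assms(1)] assms(2)
    by (elim disjE; simp add: rot_def det_3 algebra_simps)
  ultimately show ?thesis by (simp add: SU3_iff)
qed

text \<open>Elimination: two rotations carry the column \<open>a\<close> of \<open>M\<close> to a
  unit vector. Unitarity then clears the row \<open>a\<close>, and what remains is an SU(2) block in
  \<open>b\<close> and \<open>c\<close>.\<close>

lemma SU3_generated:
  assumes H: "\<And>M N. M \<in> H \<Longrightarrow> N \<in> H \<Longrightarrow> M ** N \<in> H"
    and abc: "a \<noteq> b" "a \<noteq> c" "b \<noteq> c"
    and ac: "\<And>\<alpha> \<beta>. \<alpha> * cnj \<alpha> + \<beta> * cnj \<beta> = 1 \<Longrightarrow> rot a c \<alpha> \<beta> \<in> H"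
    and bc: "\<And>\<alpha> \<beta>. \<alpha> * cnj \<alpha> + \<beta> * cnj \<beta> = 1 \<Longrightarrow> rot b c \<alpha> \<beta> \<in> H"
    and M: "M \<in> SU3"
  shows "M \<in> H"
proof -
  have U3: "UNIV = {a, b, c}"
    using exhaust_pair3[OF abc(1)] abc(2,3) exhaust_3[of c] by (auto simp: UNIV_3)
  have sum_abc: "(\<Sum>i\<in>UNIV. f i) = f a + f b + f c" for f :: "3 \<Rightarrow> complex"
    unfolding U3 using abc by (simp add: add.assoc)
  have all_abc: "(\<forall>i. P i) \<longleftrightarrow> P a \<and> P b \<and> P c" for P
    using U3 by (metis UNIV_I empty_iff insert_iff)
  have unit: "N ** adjoint3 N = mat 1 \<Longrightarrow> adjoint3 N ** N = mat 1" for N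
    by (simp add: matrix_left_right_inverse)
  have col: "N $ a $ a * cnj (N $ a $ a) + N $ b $ a * cnj (N $ b $ a) + N $ c $ a * cnj (N $ c $ a) = 1"
    if "N \<in> SU3" for N
  proof -
    have "(adjoint3 N ** N) $ a $ a = mat 1 $ a $ a"
      using unit that by (simp add: SU3_iff)
    then show ?thesis
      by (simp add: matrix_matrix_mult_def adjoint3_def sum_abc mat_def mult.commute)
  qed
  have row: "N $ i $ a * cnj (N $ j $ a) + N $ i $ b * cnj (N $ j $ b) + N $ i $ c * cnj (N $ j $ c) = (if i = j then 1 else 0)"
    if "N \<in> SU3" for N i j
  proof -
    have "(N ** adjoint3 N) $ i $ j = mat 1 $ i $ j"
      using that by (simp add: SU3_iff)
    then show ?thesis
      by (simp add: matrix_matrix_mult_def adjoint3_def sum_abc mat_def)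
  qed
  define x where "x i = M $ i $ a" for i
  define r where "r = sqrt ((cmod (x b))\<^sup>2 + (cmod (x c))\<^sup>2)"
  have r2: "complex_of_real r * complex_of_real r = x b * cnj (x b) + x c * cnj (x c)"
  proof -
    have "r * r = (cmod (x b))\<^sup>2 + (cmod (x c))\<^sup>2"
      unfolding r_def by simp
    then show ?thesis
      by (simp only: of_real_mult[symmetric] complex_norm_square[symmetric]) simp
  qed
  \<comment> \<open>A rotation that clears the entry \<open>b\<close> and collects the length
    \<open>r\<close> of the pair in the entry \<open>c\<close>. For \<open>r = 0\<close> the
    identity does.\<close>
  obtain \<alpha> \<beta> where ab: "\<alpha> * cnj \<alpha> + \<beta> * cnj \<beta> = 1" "\<alpha> * x b + \<beta> * x c = 0" "cnj \<alpha> * x c - cnj \<beta> * x b = r"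
  proof (cases "r = 0")
    case True
    then have "x b = 0" "x c = 0" by (simp_all add: r_def)
    with True show ?thesis using that[of 1 0] by simp
  next
    case False
    have "x c / r * cnj (x c / r) + (- x b / r) * cnj (- x b / r) = (x b * cnj (x b) + x c * cnj (x c)) / (complex_of_real r * complex_of_real r)"
      by (simp add: add_divide_distrib)
    also have "\<dots> = 1" using False unfolding r2[symmetric] by simp
    finally have 1: "x c / r * cnj (x c / r) + (- x b / r) * cnj (- x b / r) = 1" .
    have "cnj (x c / r) * x c - cnj (- x b / r) * x b = (x b * cnj (x b) + x c * cnj (x c)) / complex_of_real r"
      by (simp add: add_divide_distrib mult.commute)
    also have "\<dots> = r" using False unfolding r2[symmetric] by simp
    finally show ?thesis
      using that[of "x c / r" "- x b / r"] 1 by simp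
  qed
  define R1 where "R1 = rot b c \<alpha> \<beta>"
  \<comment> \<open>This one moves the vector \<open>(x a, r)\<close>, of length one, onto the axis
    \<open>a\<close>.\<close>
  define R2 where "R2 = rot a c (cnj (x a)) r"
  have xr: "x a * cnj (x a) + complex_of_real r * complex_of_real r = 1"
    using col[OF M] unfolding r2 x_def by (simp add: add.assoc)
  have R: "R1 \<in> SU3" "R2 \<in> SU3"
    unfolding R1_def R2_def using ab(1) abc xr by (auto intro!: rot_SU3 simp: mult.commute)
  define N where "N = R2 ** (R1 ** M)"
  have N: "N \<in> SU3" unfolding N_def by (intro SU3_mult R M)
  have Ma: "(R1 ** M) $ a $ a = x a" "(R1 ** M) $ b $ a = 0" "(R1 ** M) $ c $ a = r"
    using ab abc by (simp_all add: R1_def rot_mult_nth x_def)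
  have Na: "N $ a $ a = 1" "N $ b $ a = 0" "N $ c $ a = 0"
    unfolding N_def R2_def using abc xr by (simp_all add: rot_mult_nth Ma mult.commute)
  have "N $ a $ b * cnj (N $ a $ b) + N $ a $ c * cnj (N $ a $ c) = 0"
    using row[OF N, of a a] Na by simp
  then have "complex_of_real ((cmod (N $ a $ b))\<^sup>2 + (cmod (N $ a $ c))\<^sup>2) = 0"
    by (simp add: complex_norm_square del: of_real_power)
  then have Na': "N $ a $ b = 0" "N $ a $ c = 0"
    unfolding of_real_eq_0_iff by (simp_all add: add_nonneg_eq_0_iff)
  have "det N = N $ b $ b * N $ c $ c - N $ b $ c * N $ c $ b"
    using exhaust_pair3[OF abc(1)] abc(2,3) exhaust_3[of c] Na Na'
    by (elim disjE conjE) (simp_all add: det_3)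
  then have det: "N $ b $ b * N $ c $ c - N $ b $ c * N $ c $ b = 1"
    using N by (simp add: SU3_iff)
  have bb: "N $ b $ b * cnj (N $ b $ b) + N $ b $ c * cnj (N $ b $ c) = 1"
    using row[OF N, of b b] Na by simp
  have cb: "N $ c $ b * cnj (N $ b $ b) + N $ c $ c * cnj (N $ b $ c) = 0"
    using row[OF N, of c b] Na abc by simp
  \<comment> \<open>The equations \<open>bb\<close>, \<open>cb\<close> and \<open>det\<close> are
    linear in the second row of the block and determine it.\<close>
  have cc': "N $ c $ c = cnj (N $ b $ b)"
    using det bb cb by algebra
  have cb': "N $ c $ b = - cnj (N $ b $ c)"
    using det bb cb by algebra
  have "N = rot b c (N $ b $ b) (N $ b $ c)"
    using abc Na Na' cc' cb' by (simp add: vec_eq_iff all_abc rot_def)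
  then have NH: "N \<in> H" using bc[OF bb] by simp
  \<comment> \<open>\<open>H\<close> is closed under products only, so the inverse rotations have to
    be produced from the hypotheses \<open>ac\<close> and \<open>bc\<close> as well.\<close>
  define R1' where "R1' = rot b c (cnj \<alpha>) (- \<beta>)"
  define R2' where "R2' = rot a c (x a) (- r)"
  have R1H: "R1' \<in> H" unfolding R1'_def using ab(1) by (intro bc) (simp add: mult.commute)
  have R2H: "R2' \<in> H" unfolding R2'_def using xr by (intro ac) simp
  have "R1' ** R1 = mat 1" "R2' ** R2 = mat 1"
    unfolding R1_def R1'_def R2_def R2'_def
    using ab(1) xr abc by (simp_all add: rot_mult rot_one mult.commute)
  then have "R1' ** (R2' ** N) = M"
    unfolding N_def by (metis matrix_mul_assoc matrix_mul_lid)
  then show ?thesis using H[OF R1H H[OF R2H NH]] by simp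
qed

text \<open>A pair \<open>(\<alpha>, \<beta>)\<close> with \<open>|\<alpha>|\<^sup>2 + |\<beta>|\<^sup>2 = 1\<close> stands for an element of SU(2). The hypothesis \<open>comm\<close> provides the
  commutators of equally long segments in two orthogonal directions of a complex line; the common
  phase \<open>e\<close> comes from turning the square.
  Multiplying two of them with suitable phases gives diagonal elements of continuously varying
  phase, hence the whole diagonal circle. Afterwards only \<open>|\<beta>|\<close> matters.\<close>

lemma SU2_generated:
  fixes P :: "complex \<Rightarrow> complex \<Rightarrow> bool"
  assumes mult: "\<And>\<alpha> \<beta> \<alpha>' \<beta>'. P \<alpha> \<beta> \<Longrightarrow> P \<alpha>' \<beta>' \<Longrightarrow>
      P (\<alpha> * \<alpha>' - \<beta> * cnj \<beta>') (\<alpha> * \<beta>' + \<beta> * cnj \<alpha>')"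
    and \<rho>: "\<rho> > 0"
    and comm: "\<And>t e. 0 \<le> t \<Longrightarrow> t < \<rho> \<Longrightarrow> cmod e = 1 \<Longrightarrow>
      P (Complex (1 - 2 * sin t ^ 4) (2 * (sin t)\<^sup>2 * (cos t)\<^sup>2))
        (e * (of_real (2 * sin t ^ 3 * cos t) * (1 - \<i>)))"
    and \<alpha>\<beta>: "(cmod \<alpha>)\<^sup>2 + (cmod \<beta>)\<^sup>2 = 1"
  shows "P \<alpha> \<beta>"
proof -
  \<comment> \<open>The entries of the commutators in \<open>comm\<close>, without the
    phase.\<close>
  define p where "p t = Complex (1 - 2 * sin t ^ 4) (2 * (sin t)\<^sup>2 * (cos t)\<^sup>2)" for t
  define q where "q t = of_real (2 * sin t ^ 3 * cos t) * (1 - \<i>)" for t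
  have pq: "(cmod (p t))\<^sup>2 + (cmod (q t))\<^sup>2 = 1" for t
  proof -
    have c: "(cos t)\<^sup>2 = 1 - (sin t)\<^sup>2" by (simp add: cos_squared_eq)
    have "(cmod (q t))\<^sup>2 = 2 * (2 * sin t ^ 3 * cos t)\<^sup>2"
      by (simp add: q_def norm_mult power_mult_distrib cmod_power2)
    also have "\<dots> = 8 * sin t ^ 6 * (cos t)\<^sup>2"
      by (simp add: power_mult_distrib flip: power_mult)
    finally have q: "(cmod (q t))\<^sup>2 = 8 * sin t ^ 6 * (1 - (sin t)\<^sup>2)"
      unfolding c .
    have p: "(cmod (p t))\<^sup>2 = (1 - 2 * sin t ^ 4)\<^sup>2 + (2 * (sin t)\<^sup>2 * (1 - (sin t)\<^sup>2))\<^sup>2"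
      unfolding p_def cmod_power2 c by simp
    have "(1 - 2 * s ^ 4)\<^sup>2 + (2 * s\<^sup>2 * (1 - s\<^sup>2))\<^sup>2 + 8 * s ^ 6 * (1 - s\<^sup>2) = 1" for s :: real
      by algebra
    then show ?thesis unfolding p q .
  qed
  \<comment> \<open>The bound \<open>1/2\<close> keeps \<open>sin t\<close> at most
    \<open>1/2\<close>, so that \<open>p t\<close> stays in the right half-plane and its argument is
    an arctangent.\<close>
  define t0 where "t0 = min (\<rho> / 2) (1/2)"
  have t0: "0 < t0" "t0 < \<rho>" "t0 \<le> 1/2" using \<rho> by (auto simp: t0_def)
  have sin_bd: "0 \<le> sin t" "sin t \<le> 1/2" "0 < cos t" if "0 \<le> t" "t \<le> t0" for t
  proof -
    have "t \<le> 1/2" using that t0 by simp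
    then show "0 \<le> sin t" "sin t \<le> 1/2" "0 < cos t"
      using that sin_x_le_x[of t] pi_gt3 by (auto intro!: sin_ge_zero cos_gt_zero_pi)
  qed
  have Re_p: "Re (p t) > 0" if "0 \<le> t" "t \<le> t0" for t
  proof -
    have "sin t ^ 4 \<le> (1/2) ^ 4" using sin_bd[OF that] by (intro power_mono) auto
    then show ?thesis by (simp add: p_def power_one_over)
  qed
  have Ppq: "P (p t) (e * q t)" if "0 \<le> t" "t \<le> t0" "cmod e = 1" for t e
    unfolding p_def q_def using comm[of t e] that t0 by simp
  have diag_t: "P (cis (2 * arctan (Im (p t) / Re (p t)))) 0" if t: "0 \<le> t" "t \<le> t0" for t
  proof -
    define A where "A = cmod (p t)"
    have A: "A > 0" using Re_p[OF t] complex_Re_le_cmod[of "p t"] unfolding A_def by linarith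
    \<comment> \<open>The phase for which the off-diagonal entry of \<open>(p, q)\<close> times
      \<open>(p, e q)\<close> cancels, namely \<open>- cnj p / p\<close>. The diagonal entry is then
      the square of the phase of \<open>p\<close>.\<close>
    define e where "e = - cnj ((p t)\<^sup>2) / A\<^sup>2"
    have e: "cmod e = 1" using A by (simp add: e_def norm_divide norm_power A_def)
    have pp: "p t * cnj (p t) = A\<^sup>2" using complex_norm_square[of "p t"] by (simp add: A_def)
    have qq: "q t * cnj (q t) = 1 - A\<^sup>2"
    proof -
      have "q t * cnj (q t) = complex_of_real ((cmod (q t))\<^sup>2)"
        by (rule complex_norm_square[symmetric])
      also have "(cmod (q t))\<^sup>2 = 1 - A\<^sup>2"
        using pq[of t] by (simp add: A_def)
      finally show ?thesis by simp
    qed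
    have ce: "cnj e = - (p t)\<^sup>2 / A\<^sup>2" by (simp add: e_def)
    have 1: "p t * p t - (1 * q t) * cnj (e * q t) = (p t)\<^sup>2 / A\<^sup>2"
    proof -
      have "p t * p t - (1 * q t) * cnj (e * q t) = (p t)\<^sup>2 - cnj e * (q t * cnj (q t))"
        by (simp add: power2_eq_square)
      also have "\<dots> = (p t)\<^sup>2 / A\<^sup>2" using A unfolding qq ce by (simp add: field_simps)
      finally show ?thesis .
    qed
    have 2: "p t * (e * q t) + (1 * q t) * cnj (p t) = 0"
    proof -
      have "p t * e = - (p t * cnj (p t)) * cnj (p t) / A\<^sup>2"
        by (simp add: e_def power2_eq_square)
      also have "\<dots> = - cnj (p t)" using A unfolding pp by simp
      finally show ?thesis by (simp add: mult.assoc[symmetric])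
    qed
    have "P ((p t)\<^sup>2 / A\<^sup>2) 0"
      using mult[OF Ppq[OF t, of 1] Ppq[OF t e]] unfolding 1 2 by simp
    moreover have "(p t)\<^sup>2 / A\<^sup>2 = cis (2 * arctan (Im (p t) / Re (p t)))"
    proof -
      have "Arg (p t) = arctan (Im (p t) / Re (p t))"
        using Re_p[OF t] by (simp add: arg_conv_arctan)
      moreover have "p t / A = cis (Arg (p t))"
        using A by (metis A_def cis_Arg norm_zero order_less_irrefl sgn_eq)
      moreover have "cis (2 * Arg (p t)) = (cis (Arg (p t)))\<^sup>2"
        by (simp add: power2_eq_square cis_mult)
      moreover have "(p t)\<^sup>2 / A\<^sup>2 = (p t / A)\<^sup>2"
        by (simp add: power_divide)
      ultimately show ?thesis by metis
    qed
    ultimately show ?thesis by simp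
  qed
  define \<theta> where "\<theta> t = 2 * arctan (Im (p t) / Re (p t))" for t
  have cont: "continuous_on {0..t0} \<theta>"
  proof -
    have "continuous_on {0..t0} (\<lambda>t. Re (p t))" "continuous_on {0..t0} (\<lambda>t. Im (p t))"
      unfolding p_def by (simp_all, (intro continuous_intros)+)
    then show ?thesis
      unfolding \<theta>_def using Re_p
      by (intro continuous_on_mult continuous_on_const continuous_on_arctan continuous_on_divide) force+
  qed
  have s0: "sin t0 > 0" using t0 pi_gt3 by (intro sin_gt_zero) auto
  have c0: "cos t0 > 0" using sin_bd t0 by auto
  have "\<theta> t0 > 0"
    using Re_p[of t0] t0 s0 c0 unfolding \<theta>_def by (simp add: p_def)
  have small: "P (cis \<psi>) 0" if "0 \<le> \<psi>" "\<psi> \<le> \<theta> t0" for \<psi>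
  proof -
    \<comment> \<open>At \<open>t = 0\<close> the commutator is trivial, so \<open>\<theta>\<close>
      takes all values between \<open>0\<close> and \<open>\<theta> t0\<close> by the intermediate
      value theorem. Powers of these phases fill the circle.\<close>
    have "\<theta> 0 = 0" by (simp add: \<theta>_def p_def)
    then have "\<exists>t\<ge>0. t \<le> t0 \<and> \<theta> t = \<psi>"
      using IVT'[of \<theta> 0 \<psi> t0] that cont t0 by simp
    then obtain t where "0 \<le> t" "t \<le> t0" "\<theta> t = \<psi>" by blast
    then show ?thesis using diag_t \<theta>_def by auto
  qed
  have diag_pow: "P (cis \<psi>) 0 \<Longrightarrow> P (cis (real (Suc n) * \<psi>)) 0" for \<psi> n
  proof (induction n)
    case (Suc n)
    from mult[OF Suc.IH[OF Suc.prems] Suc.prems] show ?case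
      by (simp add: cis_mult algebra_simps)
  qed simp
  have diag: "P z 0" if z: "cmod z = 1" for z
  proof -
    obtain \<psi> where \<psi>: "z = cis \<psi>" "0 \<le> \<psi>"
      using Arg2pi_eq[of z] Arg2pi_ge_0[of z] z that[of "Arg2pi z"] by (simp add: cis_conv_exp)
    obtain n where n: "\<psi> < real n * \<theta> t0"
      using reals_Archimedean3[OF \<open>\<theta> t0 > 0\<close>] by blast
    have "\<psi> / real (Suc n) \<le> \<theta> t0"
      using n \<open>\<theta> t0 > 0\<close> by (simp add: field_simps)
    from diag_pow[OF small[OF _ this], of n] \<psi> show ?thesis by simp
  qed
  have moduli: "P \<alpha>' \<beta>'"
    if P: "P \<alpha> \<beta>" and m: "cmod \<alpha>' = cmod \<alpha>" "cmod \<beta>' = cmod \<beta>" for \<alpha> \<beta> \<alpha>' \<beta>'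
  proof -
    have ph: "\<exists>u. cmod u = 1 \<and> z' = u * z" if "cmod z' = cmod z" for z z' :: complex
    proof (cases "z = 0")
      case True
      then show ?thesis using that by (intro exI[of _ 1]) simp
    next
      case False
      then show ?thesis using that by (intro exI[of _ "z' / z"]) (simp add: norm_divide)
    qed
    obtain u v where u: "cmod u = 1" "\<alpha>' = u * \<alpha>" and v: "cmod v = 1" "\<beta>' = v * \<beta>"
      using ph m by metis
    \<comment> \<open>Multiplying by the diagonal elements \<open>z\<close> on the left and
      \<open>w\<close> on the right multiplies the entries by \<open>z w\<close> and
      \<open>z cnj w\<close>. The values solve \<open>z w = u\<close> and
      \<open>z cnj w = v\<close>.\<close>
    define z w where "z = csqrt (u * v)" and "w = csqrt (u * v) * cnj v"
    have z: "cmod z = 1" using u v by (simp add: z_def norm_mult)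
    have w: "cmod w = 1" using z v by (simp add: w_def z_def norm_mult)
    have vv: "v * cnj v = 1" "z * cnj z = 1" using v z by (simp_all add: complex_norm_square[symmetric])
    have "z * z = u * v" by (simp add: z_def flip: power2_eq_square)
    then have zw: "z * w = u" "z * cnj w = v"
      using vv unfolding w_def z_def[symmetric] by (simp_all add: mult.assoc[symmetric])
    have "P (z * \<alpha> * w) (z * \<beta> * cnj w)"
      using mult[OF mult[OF diag[OF z] P] diag[OF w]] by simp
    then show ?thesis using zw u v by (simp add: mult.assoc mult.left_commute mult.commute)
  qed
  define A B where "A = cmod (p t0)" and "B = cmod (q t0)"
  have AB: "A\<^sup>2 + B\<^sup>2 = 1" using pq by (simp add: A_def B_def)
  have A: "A > 0" using Re_p[of t0] t0 complex_Re_le_cmod[of "p t0"] unfolding A_def by linarith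
  have B: "B > 0" using s0 c0 unfolding B_def by (simp add: q_def complex_eq_iff)
  have PAB: "P A (e * B)" if "cmod e = 1" for e
    by (rule moduli[OF Ppq[of t0 1]]) (use t0 A B that in \<open>auto simp: A_def B_def norm_mult\<close>)
  have near: "P \<alpha> \<beta>" if n: "(cmod \<alpha>)\<^sup>2 + (cmod \<beta>)\<^sup>2 = 1" "cmod \<beta> \<le> 2 * A * B" for \<alpha> \<beta>
  proof -
    define c where "c = cmod \<beta> / (2 * A * B)"
    have c: "0 \<le> c" "c \<le> 1" using n A B by (auto simp: c_def)
    \<comment> \<open>The product of \<open>(A, B)\<close> and \<open>(A, e B)\<close> has
      off-diagonal entry \<open>A B (1 + e)\<close>. As \<open>e\<close> runs over the circle, its
      modulus runs over the interval from \<open>0\<close> to \<open>2 A B\<close>; this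
      \<open>e\<close> attains \<open>2 A B c\<close>.\<close>
    define e where "e = cis (2 * arccos c)"
    have 1: "cmod (1 + e) = 2 * c"
    proof -
      have "1 + e = cis (arccos c) * (cis (- arccos c) + cis (arccos c))"
        by (simp add: e_def distrib_left cis_mult)
      also have "cis (- arccos c) + cis (arccos c) = of_real (2 * c)"
        using c by (simp add: complex_eq_iff cos_arccos)
      finally show ?thesis using c by (simp add: norm_mult)
    qed
    have P: "P (A * A - (1 * B) * cnj (e * B)) (A * (e * B) + (1 * B) * cnj A)"
      using mult[OF PAB[of 1] PAB[of e]] by (simp add: e_def)
    have "A * (e * B) + (1 * B) * cnj A = of_real (A * B) * (1 + e)" by (simp add: algebra_simps)
    then have b: "cmod (A * (e * B) + (1 * B) * cnj A) = cmod \<beta>"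
      using 1 A B by (simp add: norm_mult c_def)
    have norm1: "(cmod (x * x' - y * cnj y'))\<^sup>2 + (cmod (x * y' + y * cnj x'))\<^sup>2
        = ((cmod x)\<^sup>2 + (cmod y)\<^sup>2) * ((cmod x')\<^sup>2 + (cmod y')\<^sup>2)" for x y x' y'
      unfolding cmod_power2 by simp algebra
    have "(cmod (A * A - (1 * B) * cnj (e * B)))\<^sup>2 + (cmod \<beta>)\<^sup>2 = 1"
      using norm1[of A A "1 * B" "e * B"] AB unfolding b by (simp add: e_def norm_mult)
    then have "cmod (A * A - (1 * B) * cnj (e * B)) = cmod \<alpha>"
      using n(1) by (metis add_right_cancel norm_ge_zero power2_eq_iff_nonneg)
    then show ?thesis using moduli[OF P] b by simp
  qed
  \<comment> \<open>Real rotations add their angles. An angle divided by a large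
    \<open>Suc n\<close> has sine at most \<open>2 A B\<close> and is covered by
    \<open>near\<close>.\<close>
  define c d where "c x = complex_of_real (cos x)" and "d x = complex_of_real (sin x)" for x
  have pow: "P (c \<psi>) (d \<psi>) \<Longrightarrow> P (c (real (Suc n) * \<psi>)) (d (real (Suc n) * \<psi>))" for \<psi> n
  proof (induction n)
    case (Suc n)
    have eq: "real (Suc (Suc n)) * \<psi> = real (Suc n) * \<psi> + \<psi>" by (simp add: algebra_simps)
    have "c (x + y) = c x * c y - d x * cnj (d y)" "d (x + y) = c x * d y + d x * cnj (c y)" for x y
      by (simp_all add: c_def d_def cos_add sin_add del: cos_of_real sin_of_real)
    with mult[OF Suc.IH[OF Suc.prems] Suc.prems] show ?case
      unfolding eq by simp
  qed simp
  obtain \<psi> where \<psi>: "0 \<le> \<psi>" "cmod \<alpha> = cos \<psi>" "cmod \<beta> = sin \<psi>"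
    using sincos_total_pi_half[of "cmod \<alpha>" "cmod \<beta>"] \<alpha>\<beta> by auto
  have AB0: "2 * A * B > 0" using A B by simp
  obtain n where n: "\<psi> < real n * (2 * A * B)"
    using reals_Archimedean3[OF AB0] by blast
  define \<psi>' where "\<psi>' = \<psi> / real (Suc n)"
  have "\<psi>' \<le> 2 * A * B" "\<psi>' \<ge> 0"
    using n AB0 \<psi> by (auto simp: \<psi>'_def field_simps)
  then have "\<bar>sin \<psi>'\<bar> \<le> 2 * A * B"
    using abs_sin_x_le_abs_x[of \<psi>'] by linarith
  then have "P (c \<psi>') (d \<psi>')"
    unfolding c_def d_def by (intro near) (simp_all only: norm_of_real power2_abs sin_cos_squared_add2)
  from pow[OF this, of n] have "P (c \<psi>) (d \<psi>)" by (simp add: \<psi>'_def)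
  then show ?thesis
  proof (rule moduli)
    have "c \<psi> = of_real (cmod \<alpha>)" "d \<psi> = of_real (cmod \<beta>)"
      by (simp_all only: c_def d_def \<psi>)
    then show "cmod \<alpha> = cmod (c \<psi>)" "cmod \<beta> = cmod (d \<psi>)" by simp_all
  qed
qed

section \<open>The Bismut connection of a left-invariant metric\<close>

definition hdot :: "complex^3 \<Rightarrow> complex^3 \<Rightarrow> complex" where
  "hdot u v = (\<Sum>i\<in>UNIV. u $ i * cnj (v $ i))"

lemma Re_hdot: "Re (hdot u v) = u \<bullet> v"
  by (simp add: hdot_def inner_vec_def inner_complex_def)

lemma cnj_hdot: "cnj (hdot u v) = hdot v u"
  by (simp add: hdot_def mult.commute)

lemma hdot_add_left: "hdot (u + u') v = hdot u v + hdot u' v"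
  and hdot_diff_left: "hdot (u - u') v = hdot u v - hdot u' v"
  and hdot_add_right: "hdot u (v + v') = hdot u v + hdot u v'"
  and hdot_diff_right: "hdot u (v - v') = hdot u v - hdot u v'"
  and hdot_minus_left: "hdot (- u) v = - hdot u v"
  and hdot_minus_right: "hdot u (- v) = - hdot u v"
  and hdot_scale_left: "hdot (k *s u) v = k * hdot u v"
  and hdot_scale_right: "hdot u (k *s v) = cnj k * hdot u v"
  by (simp_all add: hdot_def sum.distrib sum_subtractf sum_negf sum_distrib_left algebra_simps)

lemma bounded_bilinear_hdot: "bounded_bilinear hdot"
proof -
  have "linear (hdot u)" "linear (\<lambda>u. hdot u v)" for u v
    by (rule linearI; simp add: hdot_add_left hdot_add_right scaleR_eq_vector_smult
        hdot_scale_left hdot_scale_right scaleR_conv_of_real)+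
  then show ?thesis by (simp add: bilinear_conv_bounded_bilinear[symmetric] bilinear_def)
qed

lemma hdot_self_eq_0: "hdot u u = 0 \<Longrightarrow> u = 0"
  using Re_hdot[of u u] by simp

lemma hdot_axis: "hdot u (axis i 1) = u $ i"
  by (simp add: hdot_def axis_def if_distrib cong: if_cong)

lemma inner_i_smult: "(\<i> *s x) \<bullet> (\<i> *s y) = x \<bullet> (y :: complex^3)"
  by (simp add: Re_hdot[symmetric] hdot_scale_left hdot_scale_right)

text \<open>A map that preserves the Hermitian product is automatically linear:
  \<open>R w - M *v w\<close> is orthogonal to every \<open>R z\<close>, hence to \<open>R w\<close>
  and to the combination \<open>M *v w\<close> of such vectors, hence to itself. This is how
  parallel transports are shown to be linear.\<close>

lemma hdot_isometry_matrix:
  assumes R: "\<And>w z. hdot (R w) (R z) = hdot w z"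
  defines "M \<equiv> \<chi> i j. R (axis j 1) $ i"
  shows "R w = M *v w" "M ** adjoint3 M = mat 1"
proof -
  have exp: "M *v w = (\<Sum>j\<in>UNIV. w $ j *s R (axis j 1))" for w
    by (simp add: vec_eq_iff M_def matrix_vector_mult_def mult.commute)
  have lin: "hdot (M *v w) z = (\<Sum>j\<in>UNIV. w $ j * hdot (R (axis j 1)) z)" for w z
    unfolding exp by (simp add: sum_3 hdot_add_left hdot_scale_left)
  have lin': "hdot z (M *v w) = (\<Sum>j\<in>UNIV. cnj (w $ j) * hdot z (R (axis j 1)))" for w z
    unfolding exp by (simp add: sum_3 hdot_add_right hdot_scale_right)
  have "hdot (M *v w) (R z) = hdot w z" for w z
  proof -
    have "hdot (axis j 1) z = cnj (z $ j)" for j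
      using hdot_axis[of z j] by (metis cnj_hdot)
    then show ?thesis unfolding lin R by (simp add: hdot_def)
  qed
  then have 0: "hdot (R w - M *v w) (R z) = 0" for w z
    by (simp add: hdot_diff_left R)
  have "hdot (R w - M *v w) (R w - M *v w) = 0"
    using 0 by (simp add: hdot_diff_right lin')
  then show "R w = M *v w"
    using hdot_self_eq_0 by fastforce
  have "adjoint3 M ** M = mat 1"
  proof -
    have "(adjoint3 M ** M) $ i $ j = hdot (R (axis j 1)) (R (axis i 1))" for i j
      by (simp add: adjoint3_def matrix_matrix_mult_def M_def hdot_def mult.commute)
    then show ?thesis
      unfolding R hdot_axis by (simp add: vec_eq_iff mat_def axis_def)
  qed
  then show "M ** adjoint3 M = mat 1"
    by (simp add: matrix_left_right_inverse)
qed

text \<open>In a left-invariant unitary frame with bracket \<open>b\<close>, the Bismut connection is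
  \<open>\<omega>(x) = ad x - (ad x)\<^sup>*\<close>. It takes values in \<open>\<ss>\<uu>(3)\<close> because the group is unimodular, which is
  hypothesis \<open>b_trace\<close>.\<close>

locale bismut_frame = holomorphic_coframe A \<phi>
  for A :: "'g::{t2_space,second_countable_topology} chart set" and \<phi> :: "3 \<Rightarrow> 'g form1" +
  fixes b :: "complex^3 \<Rightarrow> complex^3 \<Rightarrow> complex^3"
  assumes b_add_left: "b (x + x') y = b x y + b x' y"
    and b_scale_left: "b (k *s x) y = k *s b x y"
    and b_skew: "b y x = - b x y"
    and b_trace: "(\<Sum>j\<in>UNIV. b x (axis j 1) $ j) = 0"
    and structure_equation: "ext_deriv A (\<phi> i) p u v = - b (coframe p u) (coframe p v) $ i"
begin

lemma b_add_right: "b x (y + y') = b x y + b x y'"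
  and b_scale_right: "b x (k *s y) = k *s b x y"
  using b_skew[of x] by (simp_all add: b_add_left b_scale_left vec_eq_iff)

lemma b_expand: "b x y $ i = (\<Sum>j\<in>UNIV. b x (axis j 1) $ i * y $ j)"
proof -
  have "y = y $ 1 *s axis 1 1 + y $ 2 *s axis 2 1 + y $ 3 *s axis 3 1"
    using basis_expansion[of y] by (simp add: sum_3)
  then have "b x y = b x (y $ 1 *s axis 1 1 + y $ 2 *s axis 2 1 + y $ 3 *s axis 3 1)"
    by (rule arg_cong)
  then show ?thesis
    by (simp add: b_add_right b_scale_right sum_3 mult.commute)
qed

definition b_adj :: "complex^3 \<Rightarrow> complex^3 \<Rightarrow> complex^3" where
  "b_adj x y = (\<chi> j. \<Sum>i\<in>UNIV. cnj (b x (axis j 1) $ i) * y $ i)"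

definition omega :: "complex^3 \<Rightarrow> complex^3 \<Rightarrow> complex^3" where
  "omega x y = b x y - b_adj x y"

lemma hdot_b: "hdot (b x y) z = hdot y (b_adj x z)"
  unfolding hdot_def b_adj_def b_expand[of x y] by (simp add: sum_3 algebra_simps)

lemma inner_b: "b x y \<bullet> z = y \<bullet> b_adj x z"
  by (simp add: Re_hdot[symmetric] hdot_b)

lemma omega_skew_Hermitian: "hdot (omega x y) z + hdot y (omega x z) = 0"
proof -
  have "hdot (b_adj x y) z = hdot y (b x z)"
    using hdot_b[of x z y] by (metis cnj_hdot)
  then show ?thesis
    by (simp add: omega_def hdot_diff_left hdot_diff_right hdot_b)
qed

lemma omega_skew: "omega x y \<bullet> z + y \<bullet> omega x z = 0"
proof -
  have "omega x y \<bullet> z + y \<bullet> omega x z = Re (hdot (omega x y) z + hdot y (omega x z))"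
    by (simp add: Re_hdot)
  then show ?thesis by (simp add: omega_skew_Hermitian)
qed

lemma omega_add_left: "omega (x + x') y = omega x y + omega x' y"
  and omega_scaleR_left: "omega (r *\<^sub>R x) y = r *\<^sub>R omega x y"
  and omega_add_right: "omega x (y + y') = omega x y + omega x y'"
  and omega_scale_right: "omega x (k *s y) = k *s omega x y"
  unfolding omega_def b_adj_def scaleR_eq_vector_smult b_add_left b_add_right b_scale_left b_scale_right
  by (simp_all add: vec_eq_iff sum_3 algebra_simps)

lemma omega_scaleR_right: "omega x (r *\<^sub>R y) = r *\<^sub>R omega x y"
  by (simp only: scaleR_eq_vector_smult omega_scale_right)

lemma bounded_bilinear_omega: "bounded_bilinear omega"
proof -
  have "linear (omega x)" "linear (\<lambda>x. omega x y)" for x y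
    by (rule linearI; simp add: omega_add_left omega_add_right omega_scaleR_left omega_scaleR_right)+
  then show ?thesis by (simp add: bilinear_conv_bounded_bilinear[symmetric] bilinear_def)
qed

lemma omega_expand: "omega x y $ i = (\<Sum>j\<in>UNIV. omega x (axis j 1) $ i * y $ j)"
proof -
  have "y = y $ 1 *s axis 1 1 + y $ 2 *s axis 2 1 + y $ 3 *s axis 3 1"
    using basis_expansion[of y] by (simp add: sum_3)
  then have "omega x y = omega x (y $ 1 *s axis 1 1 + y $ 2 *s axis 2 1 + y $ 3 *s axis 3 1)"
    by (rule arg_cong)
  then show ?thesis
    by (simp add: omega_add_right omega_scale_right sum_3 mult.commute)
qed

text \<open>The trace of an adjoint is the conjugate trace, so the claim reduces to
  unimodularity.\<close>

lemma omega_trace: "(\<Sum>j\<in>UNIV. omega x (axis j 1) $ j) = 0"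
proof -
  have "b_adj x (axis j 1) $ j = cnj (b x (axis j 1) $ j)" for j
    by (simp add: b_adj_def axis_def if_distrib cong: if_cong)
  then have "(\<Sum>j\<in>UNIV. omega x (axis j 1) $ j) =
      (\<Sum>j\<in>UNIV. b x (axis j 1) $ j) - cnj (\<Sum>j\<in>UNIV. b x (axis j 1) $ j)"
    by (simp add: omega_def sum_subtractf)
  then show ?thesis by (simp add: b_trace)
qed

section \<open>The left-invariant metric and its Bismut connection\<close>

definition metric :: "'g metric" where
  "metric p u v = coframe p u \<bullet> coframe p v"

definition nabla :: "'g connection" where
  "nabla Y p v = frame p (mderiv A (\<lambda>q. coframe q (Y q)) p v + omega (coframe p v) (coframe p (Y p)))"

lemma coframe_nabla:
  "coframe p (nabla Y p v) = mderiv A (\<lambda>q. coframe q (Y q)) p v + omega (coframe p v) (coframe p (Y p))"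
  by (simp add: nabla_def coframe_frame)

lemma coframe_eqI: "coframe p u = coframe p v \<Longrightarrow> u = v"
  using coframe_eq_iff by blast

lemma hermitian_metric_metric: "hermitian_metric A metric"
  unfolding hermitian_metric_def
proof (intro conjI allI ballI impI)
  show "linear (metric p u)" for p u
    by (rule linearI) (simp_all add: metric_def linear_add[OF linear_coframe] linear_scale[OF linear_coframe] inner_add_right)
  show "metric p u v = metric p v u" for p u v
    by (simp add: metric_def inner_commute)
  show "metric p u u > 0" if "u \<noteq> 0" for p u
    using that coframe_eq_iff[of p u 0] linear_0[OF linear_coframe] by (simp add: metric_def)
  show "metric p (\<i> *s u) (\<i> *s v) = metric p u v" for p u v
    by (simp add: metric_def coframe_scale inner_i_smult)
next
  fix c u v assume c: "c \<in> A"
  have "smooth_on (\<lambda>y. coframe_in c y u \<bullet> coframe_in c y v) (chart_range c)"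
    by (rule smooth_on_bilinear[OF chart_range_open[OF c] bounded_bilinear_inner smooth_on_coframe_in[OF c] smooth_on_coframe_in[OF c]])
  moreover have "coframe_in c y u \<bullet> coframe_in c y v = metric_in A c metric y u v" if "y \<in> chart_range c" for y
  proof -
    define p where "p = chart_inv c y"
    have p: "p \<in> fst c" "y = snd c p"
      using that by (simp_all add: p_def snd_chart_inv chart_inv_mem)
    show ?thesis
      unfolding metric_in_def Let_def p_def[symmetric] metric_def unfolding p(2)
      by (simp add: coframe_in_snd[OF c p(1)])
  qed
  ultimately show "smooth_on (\<lambda>y. metric_in A c metric y u v) (chart_range c)"
    using smooth_on_cong[OF chart_range_open[OF c], of "\<lambda>y. coframe_in c y u \<bullet> coframe_in c y v"
        "\<lambda>y. metric_in A c metric y u v"] by simp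
qed

lemma affine_connection_nabla: "affine_connection A nabla"
  unfolding affine_connection_def
proof (intro conjI allI impI)
  fix Y p assume Y: "smooth_vfield A Y"
  have "linear (\<lambda>v. mderiv A (\<lambda>q. coframe q (Y q)) p v + omega (coframe p v) (coframe p (Y p)))"
    by (rule linearI)
       (simp_all add: linear_add[OF linear_mderiv[OF smooth_map_coframe[OF Y]]] linear_scale[OF linear_mderiv[OF smooth_map_coframe[OF Y]]]
         linear_add[OF linear_coframe] linear_scale[OF linear_coframe] omega_add_left omega_scaleR_left scaleR_add_right)
  from linear_compose[OF this linear_frame[of p]] show "linear (nabla Y p)"
    by (simp add: nabla_def[abs_def] o_def)
next
  fix X Y assume X: "smooth_vfield A X" and Y: "smooth_vfield A Y"
  show "smooth_vfield A (\<lambda>p. nabla Y p (X p))"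
    unfolding nabla_def
    by (rule smooth_vfield_frame[OF smooth_map_add[OF smooth_map_mderiv[OF smooth_map_coframe[OF Y] X]
          smooth_map_bilinear[OF bounded_bilinear_omega smooth_map_coframe[OF X] smooth_map_coframe[OF Y]]]])
next
  fix Y Z p v assume Y: "smooth_vfield A Y" and Z: "smooth_vfield A Z"
  show "nabla (\<lambda>q. Y q + Z q) p v = nabla Y p v + nabla Z p v"
  proof (rule coframe_eqI[of p])
    show "coframe p (nabla (\<lambda>q. Y q + Z q) p v) = coframe p (nabla Y p v + nabla Z p v)"
      unfolding coframe_add coframe_nabla
        mderiv_add[OF smooth_map_coframe[OF Y] smooth_map_coframe[OF Z]] omega_add_right
      by simp
  qed
next
  fix f Y p v assume f: "smooth_fun A f" and Y: "smooth_vfield A Y"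
  have F: "smooth_map A f" using f by (simp add: smooth_fun_iff_smooth_map)
  show "nabla (\<lambda>q. f q *\<^sub>R Y q) p v = dir_deriv A f p v *\<^sub>R Y p + f p *\<^sub>R nabla Y p v"
  proof (rule coframe_eqI[of p])
    show "coframe p (nabla (\<lambda>q. f q *\<^sub>R Y q) p v) = coframe p (dir_deriv A f p v *\<^sub>R Y p + f p *\<^sub>R nabla Y p v)"
      unfolding coframe_add linear_scale[OF linear_coframe] coframe_nabla
        mderiv_bilinear[OF bounded_bilinear_scaleR F smooth_map_coframe[OF Y]] omega_scaleR_right dir_deriv_eq_mderiv
      by (simp add: scaleR_add_right)
  qed
qed

text \<open>By Cartan's formula and the structure equations the derivative terms and the Lie bracket
  leave \<open>- b\<close>. This cancels one of the two copies of \<open>b\<close> coming from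
  \<open>omega\<close>.\<close>

lemma coframe_torsion:
  assumes "smooth_vfield A X" "smooth_vfield A Y"
  shows "coframe p (torsion A nabla X Y p) =
    b (coframe p (X p)) (coframe p (Y p)) - b_adj (coframe p (X p)) (coframe p (Y p))
      + b_adj (coframe p (Y p)) (coframe p (X p))"
proof -
  have "(\<chi> i. ext_deriv A (\<phi> i) p (X p) (Y p)) = - b (coframe p (X p)) (coframe p (Y p))"
    by (simp add: vec_eq_iff structure_equation)
  with Cartan_formula[OF assms, of p]
  have *: "mderiv A (\<lambda>q. coframe q (Y q)) p (X p) - mderiv A (\<lambda>q. coframe q (X q)) p (Y p) - coframe p (lie_bracket A X Y p)
      = - b (coframe p (X p)) (coframe p (Y p))" by simp
  have "coframe p (torsion A nabla X Y p) =
      (mderiv A (\<lambda>q. coframe q (Y q)) p (X p) - mderiv A (\<lambda>q. coframe q (X q)) p (Y p) - coframe p (lie_bracket A X Y p))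
      + omega (coframe p (X p)) (coframe p (Y p)) - omega (coframe p (Y p)) (coframe p (X p))"
    unfolding torsion_def linear_diff[OF linear_coframe] coframe_nabla by simp
  then show ?thesis
    unfolding * omega_def using b_skew[of "coframe p (X p)" "coframe p (Y p)"] by simp
qed

text \<open>Skew-symmetry of \<open>omega\<close> gives \<open>\<nabla> g = 0\<close> and its
  complex linearity in the second argument \<open>\<nabla> J = 0\<close>. Pairing the torsion with
  \<open>z\<close> gives the cyclic sum of the terms \<open>b x y \<bullet> z\<close>, which is
  alternating because \<open>b\<close> is skew. This requirement on the torsion is the origin of the
  adjoint in \<open>omega\<close>.\<close>

lemma bismut_connection_nabla: "bismut_connection A metric nabla"
  unfolding bismut_connection_def
proof (intro conjI allI impI)
  show "affine_connection A nabla" by (rule affine_connection_nabla)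
next
  fix Y Z p v assume Y: "smooth_vfield A Y" and Z: "smooth_vfield A Z"
  show "dir_deriv A (\<lambda>q. metric q (Y q) (Z q)) p v = metric p (nabla Y p v) (Z p) + metric p (Y p) (nabla Z p v)"
    unfolding metric_def dir_deriv_eq_mderiv coframe_nabla
      mderiv_bilinear[OF bounded_bilinear_inner smooth_map_coframe[OF Y] smooth_map_coframe[OF Z]]
    using omega_skew[of "coframe p v" "coframe p (Y p)" "coframe p (Z p)"]
    by (simp add: inner_add_left inner_add_right)
next
  fix Y p v assume Y: "smooth_vfield A Y"
  have "bounded_linear (\<lambda>v :: complex^3. \<i> *s v)"
    by (rule bounded_bilinear.bounded_linear_right[OF bounded_bilinear_vector_smult])
  note i_deriv = mderiv_bounded_linear[OF this smooth_map_coframe[OF Y]]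
  show "nabla (\<lambda>q. \<i> *s Y q) p v = \<i> *s nabla Y p v"
  proof (rule coframe_eqI[of p])
    show "coframe p (nabla (\<lambda>q. \<i> *s Y q) p v) = coframe p (\<i> *s nabla Y p v)"
      unfolding coframe_scale coframe_nabla omega_scale_right i_deriv
      by (simp add: vec_eq_iff distrib_left)
  qed
next
  fix X Y Z p assume X: "smooth_vfield A X" and Y: "smooth_vfield A Y" and Z: "smooth_vfield A Z"
  define x y z where "x = coframe p (X p)" and "y = coframe p (Y p)" and "z = coframe p (Z p)"
  note defs = metric_def coframe_torsion[OF X Y] coframe_torsion[OF Y X] coframe_torsion[OF X Z]
    x_def[symmetric] y_def[symmetric] z_def[symmetric] inner_diff_left inner_add_left
  show "metric p (torsion A nabla X Y p) (Z p) = - metric p (torsion A nabla Y X p) (Z p)"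
    unfolding defs by (simp add: b_skew[of x y])
  have "b_adj u v \<bullet> w = v \<bullet> b u w" for u v w
    using inner_b[of u w v] by (simp add: inner_commute)
  then show "metric p (torsion A nabla X Y p) (Z p) = - metric p (torsion A nabla X Z p) (Y p)"
    unfolding defs by (simp add: inner_commute[of _ "b _ _"] b_skew[of z y])
qed

end

section \<open>Parallel transport\<close>

text \<open>Liouville's formula: the derivative of \<open>det X\<close> is minus the trace of
  \<open>O'\<close> times \<open>det X\<close>. In dimension three it is checked by expanding the
  determinant.\<close>

lemma has_vector_derivative_matrix_ode_det:
  fixes X :: "real \<Rightarrow> complex^3^3" and O' :: "complex^3^3"
  assumes "\<And>i j. ((\<lambda>s. X s $ i $ j) has_vector_derivative - (O' ** X t) $ i $ j) (at t within T)"
    and tr: "O' $ 1 $ 1 + O' $ 2 $ 2 + O' $ 3 $ 3 = 0"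
  shows "((\<lambda>s. det (X s)) has_vector_derivative 0) (at t within T)"
proof -
  have e: "((\<lambda>s. X s $ i $ j) has_vector_derivative
      - (O' $ i $ 1 * X t $ 1 $ j + O' $ i $ 2 * X t $ 2 $ j + O' $ i $ 3 * X t $ 3 $ j)) (at t within T)" for i j
    using assms(1)[of i j] by (simp add: matrix_matrix_mult_def sum_3)
  show ?thesis
    unfolding det_3
    by (rule has_vector_derivative_eq_rhs,
        (rule has_vector_derivative_diff has_vector_derivative_add has_vector_derivative_mult e)+)
       (use tr in algebra)
qed

lemma zero_derivative_endpoints:
  fixes f :: "real \<Rightarrow> 'a::real_normed_vector"
  assumes "\<And>t. t \<in> {0..1} \<Longrightarrow> (f has_vector_derivative 0) (at t within {0..1})"
  shows "f 1 = f 0"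
proof -
  obtain c where "\<And>x. x \<in> {0..1} \<Longrightarrow> f x = c"
    using has_vector_derivative_zero_constant[OF convex_closed_interval assms] by blast
  then show ?thesis by simp
qed

context bismut_frame
begin

section \<open>Parallel transport as a linear differential equation in frame components\<close>

definition parallel_ode :: "(real \<Rightarrow> 'g) \<Rightarrow> (real \<Rightarrow> complex^3) \<Rightarrow> bool" where
  "parallel_ode \<gamma> x \<longleftrightarrow> (\<forall>t\<in>{0..1}. (x has_vector_derivative
      - omega (coframe (\<gamma> t) (velocity A \<gamma> t)) (x t)) (at t within {0..1}))"

text \<open>The covariant derivative is defined through some local expression of \<open>V\<close>.
  Passing to components shows that every such expression leads to the same equation, in which the
  fields \<open>E i\<close> no longer occur.\<close>

lemma has_cov_deriv_imp:
  assumes \<gamma>: "smooth_curve A \<gamma>" and t: "t \<in> {0..1}" and "has_cov_deriv A nabla \<gamma> V W t"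
  shows "((\<lambda>s. coframe (\<gamma> s) (V s)) has_vector_derivative
    coframe (\<gamma> t) W - omega (coframe (\<gamma> t) (velocity A \<gamma> t)) (coframe (\<gamma> t) (V t))) (at t within {0..1})"
  using assms(3) unfolding has_cov_deriv_def
proof (elim exE conjE)
  fix n E v v' \<epsilon>
  assume E': "\<forall>i<n. smooth_vfield A (E i)"
    and v: "\<forall>i<n. (v i has_real_derivative v' i) (at t within {0..1})" and \<epsilon>: "0 < \<epsilon>"
    and V: "\<forall>s\<in>{0..1}. \<bar>s - t\<bar> < \<epsilon> \<longrightarrow> V s = (\<Sum>i<n. v i s *\<^sub>R E i (\<gamma> s))"
    and W: "W = (\<Sum>i<n. v' i *\<^sub>R E i (\<gamma> t) + v i t *\<^sub>R nabla (E i) (\<gamma> t) (velocity A \<gamma> t))"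
  note E = E'[rule_format]
  define F where "F i q = coframe q (E i q)" for i q
  define u where "u = velocity A \<gamma> t"
  have F: "((\<lambda>s. F i (\<gamma> s)) has_vector_derivative mderiv A (F i) (\<gamma> t) u) (at t within {0..1})" if "i < n" for i
    using smooth_map_curve_derivative[OF smooth_map_coframe[OF E[OF that]] \<gamma> t]
    unfolding F_def[abs_def] u_def by (rule has_vector_derivative_at_within)
  have 1: "((\<lambda>s. \<Sum>i<n. v i s *\<^sub>R F i (\<gamma> s)) has_vector_derivative
      (\<Sum>i<n. v i t *\<^sub>R mderiv A (F i) (\<gamma> t) u + v' i *\<^sub>R F i (\<gamma> t))) (at t within {0..1})"
    by (rule has_vector_derivative_sum, rule has_vector_derivative_scaleR) (use v F in auto)
  have sum: "coframe p (\<Sum>i<n. a i *\<^sub>R E i p) = (\<Sum>i<n. a i *\<^sub>R F i p)" for a p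
    by (simp add: linear_sum[OF linear_coframe] linear_scale[OF linear_coframe] F_def)
  have 2: "((\<lambda>s. coframe (\<gamma> s) (V s)) has_vector_derivative
      (\<Sum>i<n. v i t *\<^sub>R mderiv A (F i) (\<gamma> t) u + v' i *\<^sub>R F i (\<gamma> t))) (at t within {0..1})"
    by (rule has_vector_derivative_transform_within[OF 1 \<epsilon> t])
       (simp add: sum[symmetric] V dist_real_def)
  have "coframe (\<gamma> t) W = (\<Sum>i<n. v' i *\<^sub>R F i (\<gamma> t) + v i t *\<^sub>R (mderiv A (F i) (\<gamma> t) u + omega (coframe (\<gamma> t) u) (F i (\<gamma> t))))"
    unfolding W by (simp add: linear_sum[OF linear_coframe] linear_scale[OF linear_coframe] coframe_add coframe_nabla F_def[abs_def] u_def)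
  moreover have "omega (coframe (\<gamma> t) u) (coframe (\<gamma> t) (V t)) = (\<Sum>i<n. v i t *\<^sub>R omega (coframe (\<gamma> t) u) (F i (\<gamma> t)))"
  proof -
    have "V t = (\<Sum>i<n. v i t *\<^sub>R E i (\<gamma> t))" using V t \<epsilon> by simp
    then show ?thesis
      by (simp add: sum bounded_bilinear.sum_right[OF bounded_bilinear_omega] omega_scaleR_right)
  qed
  ultimately have "coframe (\<gamma> t) W - omega (coframe (\<gamma> t) u) (coframe (\<gamma> t) (V t))
      = (\<Sum>i<n. v i t *\<^sub>R mderiv A (F i) (\<gamma> t) u + v' i *\<^sub>R F i (\<gamma> t))"
    by (simp add: sum.distrib scaleR_add_right)
  with 2 show ?thesis unfolding u_def by simp
qed

text \<open>The frame provides a global expression, so any \<open>\<epsilon>\<close> will do. Its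
  coefficients must be real, hence the expansion in a real basis of \<open>complex^3\<close>,
  enumerated by \<open>h\<close>; the frame fields have constant components, on which the connection
  acts by \<open>omega\<close> alone.\<close>

lemma has_cov_deriv_frame:
  assumes x: "(x has_vector_derivative x') (at t within {0..1})"
  shows "has_cov_deriv A nabla \<gamma> (\<lambda>s. frame (\<gamma> s) (x s))
    (frame (\<gamma> t) (x' + omega (coframe (\<gamma> t) (velocity A \<gamma> t)) (x t))) t"
proof -
  define n where "n = card (Basis :: (complex^3) set)"
  obtain h :: "nat \<Rightarrow> complex^3" where h: "bij_betw h {..<n} Basis"
    unfolding n_def using ex_bij_betw_nat_finite[OF finite_Basis] by (metis atLeast0LessThan)
  have expand: "(\<Sum>i<n. (w \<bullet> h i) *\<^sub>R h i) = w" for w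
    using sum.reindex_bij_betw[OF h, of "\<lambda>b. (w \<bullet> b) *\<^sub>R b"] by (simp add: euclidean_representation)
  have lin: "frame p w = (\<Sum>i<n. (w \<bullet> h i) *\<^sub>R frame p (h i))" for p w
    by (subst expand[of w, symmetric]) (simp only: linear_sum[OF linear_frame] linear_scale[OF linear_frame])
  have nab: "nabla (\<lambda>q. frame q w) p v = frame p (omega (coframe p v) w)" for w p v
    by (simp add: nabla_def coframe_frame mderiv_const)
  have om: "omega a w = (\<Sum>i<n. (w \<bullet> h i) *\<^sub>R omega a (h i))" for a w
    by (subst expand[of w, symmetric])
       (simp only: bounded_bilinear.sum_right[OF bounded_bilinear_omega] omega_scaleR_right)
  show ?thesis
    unfolding has_cov_deriv_def
  proof (intro exI conjI)
    show "\<forall>i<n. smooth_vfield A (\<lambda>p. frame p (h i))"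
      using frame_vfield_smooth by blast
    have "((\<lambda>s. x s \<bullet> h i) has_vector_derivative x' \<bullet> h i) (at t within {0..1})" for i
      by (rule bounded_linear.has_vector_derivative[OF bounded_linear_inner_left x])
    then show "\<forall>i<n. ((\<lambda>s. x s \<bullet> h i) has_real_derivative x' \<bullet> h i) (at t within {0..1})"
      by (simp add: has_real_derivative_iff_has_vector_derivative)
    show "(1::real) > 0" by simp
    show "\<forall>s\<in>{0..1}. \<bar>s - t\<bar> < 1 \<longrightarrow> frame (\<gamma> s) (x s) = (\<Sum>i<n. (x s \<bullet> h i) *\<^sub>R frame (\<gamma> s) (h i))"
      using lin by blast
    show "frame (\<gamma> t) (x' + omega (coframe (\<gamma> t) (velocity A \<gamma> t)) (x t)) =
      (\<Sum>i<n. (x' \<bullet> h i) *\<^sub>R frame (\<gamma> t) (h i) + (x t \<bullet> h i) *\<^sub>R nabla (\<lambda>p. frame p (h i)) (\<gamma> t) (velocity A \<gamma> t))"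
      unfolding nab frame_add sum.distrib lin[of "\<gamma> t" x', symmetric] om[of _ "x t"]
      by (simp add: linear_sum[OF linear_frame] linear_scale[OF linear_frame])
  qed
qed

lemma parallel_along_imp_ode:
  assumes "smooth_curve A \<gamma>" "parallel_along A nabla \<gamma> V"
  shows "parallel_ode \<gamma> (\<lambda>s. coframe (\<gamma> s) (V s))"
  unfolding parallel_ode_def
proof
  fix t :: real assume t: "t \<in> {0..1}"
  then have "has_cov_deriv A nabla \<gamma> V 0 t"
    using assms(2) unfolding parallel_along_def by blast
  from has_cov_deriv_imp[OF assms(1) t this]
  show "((\<lambda>s. coframe (\<gamma> s) (V s)) has_vector_derivative
      - omega (coframe (\<gamma> t) (velocity A \<gamma> t)) (coframe (\<gamma> t) (V t))) (at t within {0..1})"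
    by (simp add: linear_0[OF linear_coframe])
qed

lemma parallel_ode_imp_along:
  assumes "parallel_ode \<gamma> x"
  shows "parallel_along A nabla \<gamma> (\<lambda>s. frame (\<gamma> s) (x s))"
  unfolding parallel_along_def
proof
  fix t :: real assume t: "t \<in> {0..1}"
  from has_cov_deriv_frame[OF assms[unfolded parallel_ode_def, rule_format, OF t], of \<gamma>]
  show "has_cov_deriv A nabla \<gamma> (\<lambda>s. frame (\<gamma> s) (x s)) 0 t"
    by (simp add: linear_0[OF linear_frame])
qed

lemma parallel_ode_hdot:
  assumes "parallel_ode \<gamma> x" "parallel_ode \<gamma> y"
  shows "hdot (x 1) (y 1) = hdot (x 0) (y 0)"
proof (rule zero_derivative_endpoints[where f = "\<lambda>s. hdot (x s) (y s)"])
  fix t :: real assume t: "t \<in> {0..1}"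
  define a where "a = coframe (\<gamma> t) (velocity A \<gamma> t)"
  have "(x has_vector_derivative - omega a (x t)) (at t within {0..1})"
    "(y has_vector_derivative - omega a (y t)) (at t within {0..1})"
    using assms t unfolding parallel_ode_def a_def by blast+
  from bounded_bilinear.has_vector_derivative[OF bounded_bilinear_hdot this]
  have "((\<lambda>s. hdot (x s) (y s)) has_vector_derivative
      hdot (x t) (- omega a (y t)) + hdot (- omega a (x t)) (y t)) (at t within {0..1})" .
  moreover have "hdot (x t) (- omega a (y t)) + hdot (- omega a (x t)) (y t) = 0"
    using omega_skew_Hermitian[of a "x t" "y t"]
    by (simp add: hdot_minus_left hdot_minus_right add.commute) (metis add.inverse_unique add.commute)
  ultimately show "((\<lambda>s. hdot (x s) (y s)) has_vector_derivative 0) (at t within {0..1})" by simp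
qed

lemma parallel_ode_det:
  fixes x :: "3 \<Rightarrow> real \<Rightarrow> complex^3"
  assumes "\<And>j. parallel_ode \<gamma> (x j)"
  shows "det (\<chi> i j. x j 1 $ i) = det (\<chi> i j. x j 0 $ i)"
proof (rule zero_derivative_endpoints[where f = "\<lambda>s. det (\<chi> i j. x j s $ i)"])
  fix t :: real assume t: "t \<in> {0..1}"
  define a where "a = coframe (\<gamma> t) (velocity A \<gamma> t)"
  define M where "M = (\<chi> i j. omega a (axis j 1) $ i)"
  show "((\<lambda>s. det (\<chi> i j. x j s $ i)) has_vector_derivative 0) (at t within {0..1})"
  proof (rule has_vector_derivative_matrix_ode_det)
    show "M $ 1 $ 1 + M $ 2 $ 2 + M $ 3 $ 3 = 0"
      using omega_trace[of a] by (simp add: M_def sum_3)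
    fix i j
    have "(x j has_vector_derivative - omega a (x j t)) (at t within {0..1})"
      using assms t unfolding parallel_ode_def a_def by blast
    from bounded_linear.has_vector_derivative[OF bounded_linear_vec_nth this, of i]
    have "((\<lambda>s. x j s $ i) has_vector_derivative - (omega a (x j t) $ i)) (at t within {0..1})" by simp
    also have "omega a (x j t) $ i = (M ** (\<chi> i j. x j t $ i)) $ i $ j"
      unfolding omega_expand[of a "x j t"] by (simp add: M_def matrix_matrix_mult_def)
    finally show "((\<lambda>s. (\<chi> i j. x j s $ i) $ i $ j) has_vector_derivative
        - (M ** (\<chi> i j. x j t $ i)) $ i $ j) (at t within {0..1})" by simp
  qed
qed

text \<open>Along each curve the Hermitian product of two solutions and the determinant of three
  solutions are constant. The first makes the transport a unitary matrix, linearity included, and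
  the second gives determinant one.\<close>

lemma transports_SU3:
  assumes "transports A nabla p q P"
  shows "\<exists>M\<in>SU3. \<forall>v. coframe q (P v) = M *v coframe p v"
  using assms
proof (induction rule: transports.induct)
  case (const p)
  have "mat 1 \<in> SU3"
    using rot_SU3[of 1 2 1 0] by (simp add: rot_one)
  then show ?case by (intro bexI[of _ "mat 1"]) simp_all
next
  case (append p \<gamma> P Q)
  obtain M where M: "M \<in> SU3" "\<And>v. coframe (\<gamma> 0) (P v) = M *v coframe p v"
    using append.IH by blast
  \<comment> \<open>The map \<open>Q\<close> in frame components; at this point it is just a
    function.\<close>
  define R where "R w = coframe (\<gamma> 1) (Q (frame (\<gamma> 0) w))" for w
  have "\<exists>x. parallel_ode \<gamma> x \<and> x 0 = w \<and> x 1 = R w" for w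
  proof -
    obtain V where "parallel_along A nabla \<gamma> V" "V 0 = frame (\<gamma> 0) w" "V 1 = Q (frame (\<gamma> 0) w)"
      using append.hyps(3) by blast
    then show ?thesis
      using parallel_along_imp_ode[OF append.hyps(2)] by (metis R_def coframe_frame)
  qed
  then obtain x where x: "\<And>w. parallel_ode \<gamma> (x w)" "\<And>w. x w 0 = w" "\<And>w. x w 1 = R w"
    by metis
  define N where "N = (\<chi> i j. R (axis j 1) $ i)"
  have "hdot (R w) (R z) = hdot w z" for w z
    using parallel_ode_hdot[OF x(1) x(1), of w z] by (simp add: x)
  note N = hdot_isometry_matrix[of R, OF this, folded N_def]
  have "det N = 1"
  proof -
    \<comment> \<open>The solutions that start at the standard basis have initial determinant
      one.\<close>
    have "(\<chi> i j. axis j 1 $ i) = (mat 1 :: complex^3^3)"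
      by (simp add: vec_eq_iff axis_def mat_def)
    then show ?thesis
      using parallel_ode_det[of \<gamma> "\<lambda>j. x (axis j 1)"] x by (simp add: N_def)
  qed
  then have "N ** M \<in> SU3"
    using N(2) M(1) by (intro SU3_mult) (simp_all add: SU3_iff)
  moreover have "coframe (\<gamma> 1) ((Q \<circ> P) v) = (N ** M) *v coframe p v" for v
  proof -
    have "coframe (\<gamma> 1) (Q (P v)) = R (coframe (\<gamma> 0) (P v))"
      by (simp add: R_def frame_coframe)
    then show ?thesis by (simp add: M(2) N(1) matrix_vector_mul_assoc)
  qed
  ultimately show ?case by blast
qed

text \<open>A curve may be appended as soon as each initial value has one explicit solution with the
  right end value.\<close>

lemma transports_ode:
  assumes "transports A nabla p (\<gamma> 0) P" "smooth_curve A \<gamma>"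
    and "\<And>w. \<exists>x. parallel_ode \<gamma> x \<and> x 0 = w \<and> x 1 = M *v w"
  shows "transports A nabla p (\<gamma> 1) ((\<lambda>v. frame (\<gamma> 1) (M *v coframe (\<gamma> 0) v)) \<circ> P)"
proof (rule transports.append[OF assms(1,2)], rule allI)
  fix u
  obtain x where x: "parallel_ode \<gamma> x" "x 0 = coframe (\<gamma> 0) u" "x 1 = M *v coframe (\<gamma> 0) u"
    using assms(3) by blast
  show "\<exists>V. parallel_along A nabla \<gamma> V \<and> V 0 = u \<and> V 1 = frame (\<gamma> 1) (M *v coframe (\<gamma> 0) u)"
    using parallel_ode_imp_along[OF x(1)] x(2,3)
    by (intro exI[of _ "\<lambda>s. frame (\<gamma> s) (x s)"]) (simp add: frame_coframe)
qed

text \<open>Curves are appended at the end only, so the induction runs over the later path.\<close>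

lemma transports_trans:
  assumes "transports A nabla q r Q" "transports A nabla p q P"
  shows "transports A nabla p r (Q \<circ> P)"
  using assms
proof (induction rule: transports.induct)
  case (append q \<gamma> P' Q)
  from transports.append[OF append.IH[OF append.prems] append.hyps(2,3)]
  show ?case by (simp only: comp_assoc)
qed simp

definition frame_holonomy :: "'g \<Rightarrow> (complex^3^3) set" where
  "frame_holonomy p = {M. (\<lambda>v. frame p (M *v coframe p v)) \<in> holonomy A nabla p}"

lemma frame_holonomy_mult:
  assumes "M \<in> frame_holonomy p" "N \<in> frame_holonomy p"
  shows "M ** N \<in> frame_holonomy p"
  using transports_trans[of p p "\<lambda>v. frame p (M *v coframe p v)" p "\<lambda>v. frame p (N *v coframe p v)"] assms
  by (simp add: frame_holonomy_def holonomy_def o_def coframe_frame matrix_vector_mul_assoc)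

text \<open>One inclusion is \<open>transports_SU3\<close>. The unitary basis consists of the frame
  vectors, so \<open>B\<close> and its inverse are \<open>frame p\<close> and
  \<open>coframe p\<close>.\<close>

lemma holonomy_is_SU3_metric:
  assumes "\<And>p. SU3 \<subseteq> frame_holonomy p"
  shows "holonomy_is_SU3 A metric nabla"
  unfolding holonomy_is_SU3_def
proof
  fix p
  define B where "B = (\<chi> i j. frame p (axis j 1) $ i)"
  have B: "B *v v = frame p v" for v
  proof -
    have "frame p v = frame p (\<Sum>j\<in>UNIV. v $ j *s axis j 1)"
      by (simp add: basis_expansion)
    also have "\<dots> = (\<Sum>j\<in>UNIV. v $ j *s frame p (axis j 1))"
      by (simp add: linear_sum[OF linear_frame] frame_scale)
    finally show ?thesis
      by (simp add: vec_eq_iff B_def matrix_vector_mult_def mult.commute)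
  qed
  have "surj ((*v) B)"
    using B frame_coframe by (metis surjI)
  then have "invertible B"
    using invertible_right_inverse matrix_right_invertible_surjective by blast
  then have "B ** matrix_inv B = mat 1 \<and> matrix_inv B ** B = mat 1"
    unfolding matrix_inv_def invertible_def by (rule someI_ex)
  then have "matrix_inv B *v (B *v w) = w" for w
    by (simp add: matrix_vector_mul_assoc)
  then have Binv: "matrix_inv B *v v = coframe p v" for v
    by (metis B frame_coframe)
  have "holonomy A nabla p \<subseteq> (\<lambda>M v. frame p (M *v coframe p v)) ` SU3"
  proof
    fix P assume "P \<in> holonomy A nabla p"
    then obtain M where "M \<in> SU3" "\<And>v. coframe p (P v) = M *v coframe p v"
      using transports_SU3 unfolding holonomy_def by blast
    then show "P \<in> (\<lambda>M v. frame p (M *v coframe p v)) ` SU3"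
      by (intro image_eqI[of _ _ M] ext) (simp_all add: frame_coframe flip: \<open>\<And>v. coframe p (P v) = M *v coframe p v\<close>)
  qed
  then have "holonomy A nabla p = (\<lambda>M v. frame p (M *v coframe p v)) ` SU3"
    using assms[of p] by (auto simp: frame_holonomy_def)
  moreover have "unitary_frame metric p B"
    by (simp add: unitary_frame_def metric_def B coframe_frame)
  ultimately show "\<exists>B. unitary_frame metric p B \<and>
      holonomy A nabla p = (\<lambda>M v. B *v (M *v (matrix_inv B *v v))) ` SU3"
    by (intro exI[of _ B]) (simp add: B Binv)
qed

end

section \<open>Integral curves of holomorphic vector fields\<close>

lemma onorm_vector_smult_le: "onorm (\<lambda>h. h *s (w :: complex^3)) \<le> norm w"
  by (rule onorm_le) (simp add: norm_vector_smult mult.commute)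

text \<open>By compactness the derivative is bounded on each basis vector; the sum of these bounds
  controls its operator norm on the ball.\<close>

lemma smooth_on_Lipschitz_cball:
  fixes X :: "'a::euclidean_space \<Rightarrow> 'b::real_normed_vector"
  assumes S: "open S" "cball y0 R \<subseteq> S" and X: "smooth_on X S"
  obtains L where "L > 0" "\<And>y y'. y \<in> cball y0 R \<Longrightarrow> y' \<in> cball y0 R \<Longrightarrow> norm (X y - X y') \<le> L * norm (y - y')"
proof -
  define D where "D y = frechet_derivative X (at y)" for y
  have "\<exists>B>0. \<forall>y\<in>cball y0 R. norm (D y v) \<le> B" for v
  proof -
    have "continuous_on (cball y0 R) (\<lambda>y. D y v)"
      unfolding D_def using smooth_on_imp_continuous_on[OF smooth_on_frechet_derivative[OF X]] S(2)
      by (rule continuous_on_subset)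
    then have "bounded ((\<lambda>y. D y v) ` cball y0 R)"
      using compact_continuous_image compact_cball compact_imp_bounded by blast
    then show ?thesis by (auto simp: bounded_pos)
  qed
  then obtain B where B: "\<And>v. B v > 0" "\<And>v y. y \<in> cball y0 R \<Longrightarrow> norm (D y v) \<le> B v" by metis
  define L where "L = (\<Sum>b\<in>Basis. B b)"
  have "L > 0" unfolding L_def using B(1) by (intro sum_pos) auto
  moreover have "norm (X y - X y') \<le> L * norm (y - y')" if "y \<in> cball y0 R" "y' \<in> cball y0 R" for y y'
  proof (rule differentiable_bound[OF convex_cball _ _ that])
    fix x assume x: "x \<in> cball y0 R"
    then have d: "(X has_derivative D x) (at x)"
      unfolding D_def using S(2) X smooth_on_has_derivative by blast
    then show "(X has_derivative D x) (at x within cball y0 R)"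
      by (rule has_derivative_at_withinI)
    show "onorm (D x) \<le> L"
    proof (rule onorm_le)
      fix v
      have "norm (D x v) \<le> (\<Sum>b\<in>Basis. norm ((v \<bullet> b) *\<^sub>R D x b))"
        unfolding linear_euclidean_expand[OF has_derivative_linear[OF d], of v] by (rule norm_sum)
      also have "\<dots> \<le> (\<Sum>b\<in>Basis. norm v * B b)"
        using B(2)[OF x] by (intro sum_mono) (auto intro!: mult_mono Basis_le_norm)
      finally show "norm (D x v) \<le> L * norm v" by (simp add: L_def sum_distrib_left mult.commute)
    qed
  qed
  ultimately show ?thesis using that by blast
qed

text \<open>One Picard step in complex time: each component of \<open>X (f z)\<close> is holomorphic
  on a disc and therefore has a primitive there.\<close>

lemma holo_primitive_vec:
  fixes X :: "complex^3 \<Rightarrow> complex^3"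
  assumes X: "holo_on (*s) (*s) X S" and f: "\<And>z. z \<in> ball 0 \<rho> \<Longrightarrow> (f has_derivative (\<lambda>h. h *s f' z)) (at z)"
    and fS: "\<And>z. z \<in> ball 0 \<rho> \<Longrightarrow> f z \<in> S"
  obtains g where "g 0 = y0" "\<And>z. z \<in> ball 0 \<rho> \<Longrightarrow> (g has_derivative (\<lambda>h. h *s X (f z))) (at z)"
proof -
  have "(\<lambda>z. X (f z) $ k) holomorphic_on ball 0 \<rho>" for k
  proof (rule holomorphic_onI)
    fix z :: complex assume z: "z \<in> ball 0 \<rho>"
    from has_derivative_compose[OF f[OF z] holo_on_has_derivative[OF X fS[OF z]]]
    have "((\<lambda>z. X (f z)) has_derivative (\<lambda>h. h *s frechet_derivative X (at (f z)) (f' z))) (at z)"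
      by (simp add: holo_on_derivative_scale[OF X fS[OF z]])
    from bounded_linear.has_derivative[OF bounded_linear_vec_nth this, of k]
    have "((\<lambda>z. X (f z) $ k) has_field_derivative frechet_derivative X (at (f z)) (f' z) $ k) (at z)"
      unfolding has_field_derivative_def by (simp add: mult.commute[of _ "frechet_derivative X (at (f z)) (f' z) $ k"])
    then show "(\<lambda>z. X (f z) $ k) field_differentiable at z within ball 0 \<rho>"
      using field_differentiable_def field_differentiable_at_within by blast
  qed
  then have "\<exists>g. \<forall>z\<in>ball 0 \<rho>. (g has_field_derivative X (f z) $ k) (at z within ball 0 \<rho>)" for k
    using holomorphic_convex_primitive'[OF convex_ball open_ball] by metis
  then obtain g where g: "\<And>k z. z \<in> ball 0 \<rho> \<Longrightarrow> (g k has_field_derivative X (f z) $ k) (at z)"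
    by (metis at_within_open open_ball)
  show ?thesis
  proof (rule that[of "\<lambda>z. \<chi> k. g k z - g k 0 + y0 $ k"])
    show "(\<chi> k. g k 0 - g k 0 + y0 $ k) = y0" by (simp add: vec_eq_iff)
    fix z :: complex assume z: "z \<in> ball 0 \<rho>"
    show "((\<lambda>z. \<chi> k. g k z - g k 0 + y0 $ k) has_derivative (\<lambda>h. h *s X (f z))) (at z)"
    proof (rule has_derivative_vecI)
      fix k
      have "((\<lambda>z. g k z - g k 0 + y0 $ k) has_derivative (\<lambda>h. X (f z) $ k * h - 0 + 0)) (at z)"
        using g[OF z] unfolding has_field_derivative_def by (intro derivative_intros)
      then show "((\<lambda>z. (\<chi> k. g k z - g k 0 + y0 $ k) $ k) has_derivative (\<lambda>h. (h *s X (f z)) $ k)) (at z)"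
        by (simp add: mult.commute)
    qed
  qed
qed

text \<open>Picard iteration. The iterates are primitives on a disc, so that holomorphy in the complex time is built in.\<close>

lemma holomorphic_integral_curve:
  fixes X :: "complex^3 \<Rightarrow> complex^3"
  assumes S: "open S" "y0 \<in> S" and X: "holo_on (*s) (*s) X S"
  obtains \<rho> F where "\<rho> > 0" "F 0 = y0" "\<And>z. z \<in> ball 0 \<rho> \<Longrightarrow> F z \<in> S"
    "\<And>z. z \<in> ball 0 \<rho> \<Longrightarrow> (F has_derivative (\<lambda>h. h *s X (F z))) (at z)"
proof -
  obtain R where R: "R > 0" "cball y0 R \<subseteq> S"
    using S open_contains_cball by blast
  have sm: "smooth_on X S" by (rule holo_on_vec_imp_smooth_on[OF S(1) X])
  have "bounded (X ` cball y0 R)"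
    using continuous_on_subset[OF smooth_on_imp_continuous_on[OF sm] R(2)]
      compact_continuous_image compact_cball compact_imp_bounded by blast
  then obtain M where M: "M > 0" "\<And>y. y \<in> cball y0 R \<Longrightarrow> norm (X y) \<le> M"
    by (auto simp: bounded_pos)
  obtain L where L: "L > 0"
    "\<And>y y'. y \<in> cball y0 R \<Longrightarrow> y' \<in> cball y0 R \<Longrightarrow> norm (X y - X y') \<le> L * norm (y - y')"
    using smooth_on_Lipschitz_cball[OF S(1) R(2) sm] by blast
  \<comment> \<open>\<open>R / M\<close> keeps the iterates in the ball on which \<open>X\<close> is
    bounded, and \<open>1 / (2 * L)\<close> makes the iteration contract by one half.\<close>
  define \<rho> where "\<rho> = min (R / M) (1 / (2 * L))"
  have \<rho>: "\<rho> > 0" "M * \<rho> \<le> R" "L * \<rho> \<le> 1 / 2"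
    using R M L by (auto simp: \<rho>_def min_def field_simps)
  define U where "U = ball (0::complex) \<rho>"
  have U: "open U" "convex U" "0 \<in> U" using \<rho> by (simp_all add: U_def)
  have growth: "norm (u z - u 0) \<le> K * \<rho>"
    if "\<And>z. z \<in> U \<Longrightarrow> (u has_derivative (\<lambda>h. h *s u' z)) (at z)" "\<And>z. z \<in> U \<Longrightarrow> norm (u' z) \<le> K" "z \<in> U" "K \<ge> 0"
    for u :: "complex \<Rightarrow> complex^3" and u' K z
  proof -
    have "norm (u z - u 0) \<le> K * norm (z - 0)"
      by (rule differentiable_bound[OF U(2) _ _ that(3) U(3), where f' = "\<lambda>z h. h *s u' z"])
         (use that(1,2) onorm_vector_smult_le in \<open>auto intro: has_derivative_at_withinI order_trans\<close>)
    also have "\<dots> \<le> K * \<rho>" using that(3,4) by (intro mult_left_mono) (auto simp: U_def)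
    finally show ?thesis .
  qed
  \<comment> \<open>Complex differentiability is part of the invariant, because the next iterate is
    a primitive of a function of the present one.\<close>
  define good where "good f \<longleftrightarrow> (\<exists>f'. \<forall>z\<in>U. (f has_derivative (\<lambda>h. h *s f' z)) (at z)) \<and>
      f ` U \<subseteq> cball y0 R \<and> f 0 = y0" for f :: "complex \<Rightarrow> complex^3"
  have "\<exists>g. good g \<and> (\<forall>z\<in>U. (g has_derivative (\<lambda>h. h *s X (f z))) (at z))" if f: "good f" for f
  proof -
    obtain f' where f': "\<And>z. z \<in> U \<Longrightarrow> (f has_derivative (\<lambda>h. h *s f' z)) (at z)" and fR: "\<And>z. z \<in> U \<Longrightarrow> f z \<in> cball y0 R"
      using f unfolding good_def by blast
    have fS: "f z \<in> S" if "z \<in> ball 0 \<rho>" for z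
      using fR R(2) that by (auto simp: U_def)
    obtain g where g: "g 0 = y0" "\<And>z. z \<in> U \<Longrightarrow> (g has_derivative (\<lambda>h. h *s X (f z))) (at z)"
      using holo_primitive_vec[OF X f'[unfolded U_def] fS, where ?y0.0 = y0] unfolding U_def by blast
    have "g z \<in> cball y0 R" if "z \<in> U" for z
      using growth[OF g(2) M(2)[OF fR] that] M(1) \<rho>(2) g(1) by (simp add: dist_norm norm_minus_commute)
    then have "good g"
      unfolding good_def using g by (intro conjI exI[of _ "\<lambda>z. X (f z)"]) auto
    then show ?thesis using g(2) by blast
  qed
  then obtain N where N: "\<And>f. good f \<Longrightarrow> good (N f)"
    "\<And>f z. good f \<Longrightarrow> z \<in> U \<Longrightarrow> (N f has_derivative (\<lambda>h. h *s X (f z))) (at z)"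
    by metis
  define f where "f n = (N ^^ n) (\<lambda>_. y0)" for n
  have good0: "good (\<lambda>_. y0)"
    unfolding good_def using R(1) by (auto intro!: exI[of _ "\<lambda>_. 0"])
  have good: "good (f n)" for n
    by (induction n) (simp_all add: f_def good0 N(1))
  have df: "(f (Suc n) has_derivative (\<lambda>h. h *s X (f n z))) (at z)" if "z \<in> U" for n z
    using N(2)[OF good that] by (simp add: f_def)
  have fR: "f n z \<in> cball y0 R" if "z \<in> U" for n z
    using good[of n] that unfolding good_def by blast
  have f0: "f n 0 = y0" for n
    using good[of n] unfolding good_def by blast
  have diff: "norm (f (Suc n) z - f n z) \<le> 2 * R * (1/2) ^ n" if "z \<in> U" for n z
    using that
  proof (induction n arbitrary: z)
    case 0
    have "dist (f (Suc 0) z) (f 0 z) \<le> dist (f (Suc 0) z) y0 + dist y0 (f 0 z)"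
      by (rule dist_triangle)
    moreover have "dist y0 (f m z) \<le> R" for m
      using fR 0 by simp
    ultimately have "dist (f (Suc 0) z) (f 0 z) \<le> 2 * R"
      by (smt (verit) dist_commute)
    then show ?case by (simp add: dist_norm)
  next
    case (Suc n)
    have d: "((\<lambda>z. f (Suc (Suc n)) z - f (Suc n) z) has_derivative (\<lambda>h. h *s (X (f (Suc n) z) - X (f n z)))) (at z)"
      if "z \<in> U" for z
      using has_derivative_diff[OF df[OF that, of "Suc n"] df[OF that, of n]] by (simp add: vector_ssub_ldistrib)
    have "norm (X (f (Suc n) z) - X (f n z)) \<le> L * (2 * R * (1/2) ^ n)" if "z \<in> U" for z
      using L(2)[OF fR[OF that] fR[OF that]] Suc.IH[OF that] L(1)
      by (meson mult_left_mono less_imp_le order_trans)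
    from growth[where u' = "\<lambda>z. X (f (Suc n) z) - X (f n z)", OF d this Suc.prems]
    have "norm (f (Suc (Suc n)) z - f (Suc n) z - (f (Suc (Suc n)) 0 - f (Suc n) 0)) \<le> L * (2 * R * (1/2) ^ n) * \<rho>"
      using L(1) R(1) by simp
    also have "\<dots> = L * \<rho> * (2 * R * (1/2) ^ n)" by simp
    also have "\<dots> \<le> 1/2 * (2 * R * (1/2) ^ n)"
      using \<rho>(3) R(1) by (intro mult_right_mono) auto
    finally show ?case by (simp add: f0)
  qed
  have "uniformly_convergent_on U (\<lambda>n z. \<Sum>i<n. f (Suc i) z - f i z)"
    by (rule Weierstrass_m_test'[OF diff]) (simp_all add: summable_mult)
  then obtain l where l: "uniform_limit U (\<lambda>n z. \<Sum>i<n. f (Suc i) z - f i z) l sequentially"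
    unfolding uniformly_convergent_on_def by blast
  define F where "F z = l z + y0" for z
  have F: "uniform_limit U f F sequentially"
  proof -
    have "uniform_limit U (\<lambda>n z. (\<Sum>i<n. f (Suc i) z - f i z) + y0) (\<lambda>z. l z + y0) sequentially"
      by (rule uniform_limit_add[OF l uniform_limit_const])
    moreover have "(\<Sum>i<n. f (Suc i) z - f i z) + y0 = f n z" for n z
      using sum_lessThan_telescope[of "\<lambda>i. f i z" n] f_def[of 0] by simp
    ultimately show ?thesis unfolding F_def[abs_def] by simp
  qed
  have F_lim: "(\<lambda>n. f n z) \<longlonglongrightarrow> F z" if "z \<in> U" for z
    using tendsto_uniform_limitI[OF F that] .
  have FR: "F z \<in> cball y0 R" if "z \<in> U" for z
    by (rule closed_sequentially[OF closed_cball fR[OF that] F_lim[OF that]])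
  \<comment> \<open>The limit is differentiated through the uniform convergence of derivatives. The
    sequence is shifted, since the derivative of \<open>f (Suc n)\<close> is given by
    \<open>X (f n z)\<close>.\<close>
  have "\<exists>g. \<forall>z\<in>U. (\<lambda>n. f (Suc n) z) \<longlonglongrightarrow> g z \<and> (g has_derivative (\<lambda>h. h *s X (F z))) (at z within U)"
  proof (rule has_derivative_sequence[OF U(2)])
    show "(f (Suc n) has_derivative (\<lambda>h. h *s X (f n z))) (at z within U)" if "z \<in> U" for n z
      using df[OF that] by (rule has_derivative_at_withinI)
    show "0 \<in> U" by (rule U)
    show "(\<lambda>n. f (Suc n) 0) \<longlonglongrightarrow> y0" by (simp add: f0)
    fix e :: real assume "e > 0"
    then have "\<forall>\<^sub>F n in sequentially. \<forall>z\<in>U. dist (f n z) (F z) < e / L"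
      using F L(1) unfolding uniform_limit_iff by simp
    then show "\<forall>\<^sub>F n in sequentially. \<forall>z\<in>U. \<forall>h. norm (h *s X (f n z) - h *s X (F z)) \<le> e * norm h"
    proof (rule eventually_mono, intro ballI allI)
      fix n z and h :: complex assume n: "\<forall>z\<in>U. dist (f n z) (F z) < e / L" and z: "z \<in> U"
      have "norm (h *s X (f n z) - h *s X (F z)) = norm h * norm (X (f n z) - X (F z))"
        by (simp add: norm_vector_smult flip: vector_ssub_ldistrib)
      also have "\<dots> \<le> norm h * (L * norm (f n z - F z))"
        by (intro mult_left_mono L(2) fR FR z) auto
      also have "\<dots> \<le> norm h * (L * (e / L))"
        using n z L(1) by (intro mult_left_mono) (auto simp: dist_norm less_imp_le)
      finally show "norm (h *s X (f n z) - h *s X (F z)) \<le> e * norm h"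
        using L(1) by (simp add: mult.commute)
    qed
  qed
  then obtain g where g: "\<And>z. z \<in> U \<Longrightarrow> (\<lambda>n. f (Suc n) z) \<longlonglongrightarrow> g z"
    "\<And>z. z \<in> U \<Longrightarrow> (g has_derivative (\<lambda>h. h *s X (F z))) (at z within U)" by blast
  have gF: "g z = F z" if "z \<in> U" for z
    using LIMSEQ_unique[OF g(1)[OF that] LIMSEQ_Suc[OF F_lim[OF that]]] .
  show ?thesis
  proof (rule that[OF \<rho>(1)])
    show "F 0 = y0"
      using LIMSEQ_unique[OF F_lim[OF U(3)]] by (simp add: f0)
    show "F z \<in> S" if "z \<in> ball 0 \<rho>" for z
      using FR R(2) that by (auto simp: U_def)
    show "(F has_derivative (\<lambda>h. h *s X (F z))) (at z)" if "z \<in> ball 0 \<rho>" for z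
    proof -
      have z: "z \<in> U" using that by (simp add: U_def)
      show ?thesis
        using has_derivative_transform_within_open[OF g(2)[OF z, unfolded at_within_open[OF z U(1)]] U(1) z gF] .
    qed
  qed
qed

text \<open>Bootstrapping: if \<open>F\<close> is of class \<open>k\<close>, so is the right-hand
  side of its equation, hence \<open>F\<close> is of class \<open>k + 1\<close>.\<close>

lemma integral_curve_smooth:
  fixes X :: "complex^3 \<Rightarrow> complex^3"
  assumes S: "open S" "open U" and X: "smooth_on X S" and FS: "\<And>z. z \<in> U \<Longrightarrow> F z \<in> S"
    and F: "\<And>z. z \<in> U \<Longrightarrow> (F has_derivative (\<lambda>h. h *s X (F z))) (at z)"
  shows "smooth_on F U"
proof -
  have "Ck_on k F U" for k
  proof (induction k)
    case 0
    then show ?case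
      using F by (auto intro!: continuous_at_imp_continuous_on has_derivative_continuous)
  next
    case (Suc k)
    have "Ck_on k X S" using X by (simp add: smooth_on_def)
    from Ck_on_compose[OF S(2,1) Suc this FS]
    have *: "Ck_on k (\<lambda>z. h *s X (F z)) U" for h
      using Ck_on_bilinear[OF S(2) bounded_bilinear_vector_smult Ck_on_const[OF S(2)]] by blast
    show ?case
      by (rule Ck_on_SucI[OF S(2), where f' = "\<lambda>z h. h *s X (F z)"]) (simp_all only: F *)
  qed
  then show ?thesis by (simp add: smooth_on_def)
qed

section \<open>Holonomy along polygons in a complex direction\<close>

lemma has_vector_derivative_vecI:
  fixes x :: "real \<Rightarrow> complex^3"
  assumes "\<And>i. ((\<lambda>t. x t $ i) has_vector_derivative D $ i) (at t)"
  shows "(x has_vector_derivative D) (at t)"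
  using has_derivative_vecI[of x "\<lambda>h. h *\<^sub>R D"] assms by (simp add: has_vector_derivative_def)

section \<open>One-parameter groups of rotations and their commutators\<close>

definition rot_gen :: "3 \<Rightarrow> 3 \<Rightarrow> complex \<Rightarrow> complex^3 \<Rightarrow> complex^3" where
  "rot_gen m n w y = (\<chi> i. if i = m then w * y $ n else if i = n then - cnj w * y $ m else 0)"

text \<open>The exponential of \<open>t\<close> times \<open>rot_gen m n w\<close>. For
  \<open>w = 0\<close> the convention \<open>sgn 0 = 0\<close> gives the identity.\<close>

definition rot_exp :: "3 \<Rightarrow> 3 \<Rightarrow> complex \<Rightarrow> real \<Rightarrow> complex^3^3" where
  "rot_exp m n w t = rot m n (of_real (cos (cmod w * t))) (sgn w * of_real (sin (cmod w * t)))"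

lemma rot_exp_has_vector_derivative:
  assumes "m \<noteq> n"
  shows "((\<lambda>t. rot_exp m n w t *v v) has_vector_derivative rot_gen m n w (rot_exp m n w t *v v)) (at t)"
proof (rule has_vector_derivative_vecI)
  fix i
  define C S where "C t = complex_of_real (cos (cmod w * t))" and "S t = sgn w * complex_of_real (sin (cmod w * t))" for t
  have w: "cmod w * sgn w = w"
    by (cases "w = 0") (simp_all add: sgn_eq)
  have w': "cnj w * sgn w = cmod w"
  proof (cases "w = 0")
    case False
    have "cnj w * sgn w = (w * cnj w) / cmod w" by (simp add: sgn_eq)
    then show ?thesis using False by (simp add: complex_norm_square[symmetric] power2_eq_square)
  qed simp
  have "((\<lambda>t. cos (cmod w * t)) has_real_derivative - sin (cmod w * t) * cmod w) (at t)"
    "((\<lambda>t. sin (cmod w * t)) has_real_derivative cos (cmod w * t) * cmod w) (at t)" for t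
    by (auto intro!: derivative_eq_intros)
  note cs = this[THEN has_vector_derivative_of_real]
  have "complex_of_real (- sin (cmod w * t) * cmod w) = - (cnj w * S t)" for t
    by (simp add: S_def mult.assoc[symmetric] w')
  then have dC: "(C has_vector_derivative - (cnj w * S t)) (at t)" for t
    using cs(1)[of t, where 'a = complex] by (simp add: C_def[abs_def])
  have "sgn w * complex_of_real (cos (cmod w * t) * cmod w) = w * C t" for t
    using w by (simp add: C_def mult.commute mult.left_commute flip: mult.assoc)
  then have dS: "(S has_vector_derivative w * C t) (at t)" for t
    using has_vector_derivative_mult_right[OF cs(2)[of t], of "sgn w"] by (simp add: S_def[abs_def])
  note d = dC dS
  have "w * cnj (sgn w) = cmod w"
    using arg_cong[OF w', of cnj] by simp
  then have cS: "w * cnj (S t) = cnj w * S t" for t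
    by (simp add: S_def w' flip: mult.assoc)
  have cC: "cnj (C t) = C t" for t by (simp add: C_def)
  have cd: "((\<lambda>t. cnj (S t)) has_vector_derivative cnj w * C t) (at t)" for t
    using bounded_linear.has_vector_derivative[OF bounded_linear_cnj d(2)] by (simp add: cC)
  have nth: "(rot_exp m n w t *v v) $ j = (if j = m then C t * v $ m + S t * v $ n
     else if j = n then C t * v $ n - cnj (S t) * v $ m else v $ j)" for t j
    using cC by (simp add: rot_exp_def rot_vec_nth[OF assms] C_def[symmetric] S_def[symmetric])
  have 1: "((\<lambda>t. C t * v $ m + S t * v $ n) has_vector_derivative (- (cnj w * S t)) * v $ m + (w * C t) * v $ n) (at t)"
    by (intro has_vector_derivative_add has_vector_derivative_mult_left d)
  have 2: "((\<lambda>t. C t * v $ n - cnj (S t) * v $ m) has_vector_derivative (- (cnj w * S t)) * v $ n - (cnj w * C t) * v $ m) (at t)"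
    by (intro has_vector_derivative_diff has_vector_derivative_mult_left d cd)
  consider "i = m" | "i = n" "i \<noteq> m" | "i \<noteq> m" "i \<noteq> n" by blast
  then show "((\<lambda>t. (rot_exp m n w t *v v) $ i) has_vector_derivative rot_gen m n w (rot_exp m n w t *v v) $ i) (at t)"
  proof cases
    case 1
    then show ?thesis
      using \<open>((\<lambda>t. C t * v $ m + S t * v $ n) has_vector_derivative _) (at t)\<close> assms
      by (simp add: rot_gen_def nth right_diff_distrib cS flip: mult.assoc)
  next
    case 2
    then have "rot_gen m n w (rot_exp m n w t *v v) $ i = (- (cnj w * S t)) * v $ n - (cnj w * C t) * v $ m"
      using assms by (simp add: rot_gen_def nth algebra_simps)
    then show ?thesis
      using \<open>((\<lambda>t. C t * v $ n - cnj (S t) * v $ m) has_vector_derivative _) (at t)\<close> 2 assms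
      by (simp add: nth)
  next
    case 3
    then show ?thesis by (simp add: rot_gen_def nth)
  qed
qed

lemma rot_exp_0: "m \<noteq> n \<Longrightarrow> rot_exp m n w 0 = mat 1"
  by (simp add: rot_exp_def rot_one)

lemma rot_exp_unit:
  assumes "t \<ge> 0" "cmod e = 1"
  shows "rot_exp m n (of_real t * e) 1 = rot m n (of_real (cos t)) (e * of_real (sin t))"
  using assms by (cases "t = 0") (simp_all add: rot_exp_def norm_mult sgn_mult sgn_eq sgn_of_real del: cos_of_real sin_of_real)

text \<open>The sides of a square in the directions \<open>e\<close> and \<open>\<i> * e\<close>.
  The first two factors and the last two multiply to rotations with equal diagonal and opposite
  off-diagonal entries, which makes the final product short.\<close>

lemma rot_exp_commutator:
  assumes mn: "m \<noteq> n" and t: "t \<ge> 0" and e: "cmod e = 1"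
  shows "rot_exp m n (of_real t * e) 1 ** (rot_exp m n (of_real t * (\<i> * e)) 1 **
      (rot_exp m n (of_real t * - e) 1 ** rot_exp m n (of_real t * - (\<i> * e)) 1)) =
    rot m n (Complex (1 - 2 * sin t ^ 4) (2 * (sin t)\<^sup>2 * (cos t)\<^sup>2))
      (e * (of_real (2 * sin t ^ 3 * cos t) * (1 - \<i>)))"
proof -
  define C S where "C = complex_of_real (cos t)" and "S = complex_of_real (sin t)"
  have CS: "C * C + S * S = 1"
    unfolding C_def S_def of_real_mult[symmetric] of_real_add[symmetric]
    using sin_cos_squared_add[of t] by (simp add: power2_eq_square add.commute del: cos_of_real sin_of_real)
  have cnj: "cnj C = C" "cnj S = S" by (simp_all add: C_def S_def del: cos_of_real sin_of_real)
  have ee: "e * cnj e = 1" using e by (simp add: complex_norm_square[symmetric])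
  have ii: "\<i> * \<i> = -1" by simp
  have \<alpha>: "Complex (1 - 2 * sin t ^ 4) (2 * (sin t)\<^sup>2 * (cos t)\<^sup>2) = 1 - 2 * S ^ 4 + \<i> * (2 * S\<^sup>2 * C\<^sup>2)"
    by (simp add: Complex_eq C_def S_def del: cos_of_real sin_of_real)
  have \<beta>: "e * (of_real (2 * sin t ^ 3 * cos t) * (1 - \<i>)) = e * (2 * S ^ 3 * C * (1 - \<i>))"
    by (simp add: C_def S_def del: cos_of_real sin_of_real)
  have unit: "cmod (\<i> * e) = 1" "cmod (- e) = 1" "cmod (- (\<i> * e)) = 1"
    using e by (simp_all add: norm_mult)
  \<comment> \<open>The conjugate becomes an independent unknown, tied to \<open>e\<close> by
    \<open>e * e' = 1\<close>, so that the entries are polynomial identities.\<close>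
  define e' where "e' = cnj e"
  note cnj_simps = complex_cnj_mult complex_cnj_minus complex_cnj_add complex_cnj_diff complex_cnj_i
    complex_cnj_one cnj complex_cnj_cnj e'_def[symmetric]
  note ee' = ee[folded e'_def]
  have AB: "rot m n C (e * S) ** rot m n C ((\<i> * e) * S) = rot m n (C * C + \<i> * (S * S)) (e * (S * C * (1 + \<i>)))"
    unfolding rot_mult[OF mn]
  proof (rule arg_cong2[where f = "rot m n"])
    show "C * C - e * S * cnj (\<i> * e * S) = C * C + \<i> * (S * S)"
      unfolding cnj_simps using ee' by algebra
    show "C * (\<i> * e * S) + e * S * cnj C = e * (S * C * (1 + \<i>))"
      unfolding cnj_simps by algebra
  qed
  have CD: "rot m n C ((- e) * S) ** rot m n C ((- (\<i> * e)) * S) = rot m n (C * C + \<i> * (S * S)) (- (e * (S * C * (1 + \<i>))))"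
    unfolding rot_mult[OF mn]
  proof (rule arg_cong2[where f = "rot m n"])
    show "C * C - - e * S * cnj (- (\<i> * e) * S) = C * C + \<i> * (S * S)"
      unfolding cnj_simps using ee' by algebra
    show "C * (- (\<i> * e) * S) + - e * S * cnj C = - (e * (S * C * (1 + \<i>)))"
      unfolding cnj_simps by algebra
  qed
  have ABCD: "rot m n (C * C + \<i> * (S * S)) (e * (S * C * (1 + \<i>))) ** rot m n (C * C + \<i> * (S * S)) (- (e * (S * C * (1 + \<i>))))
      = rot m n (1 - 2 * S ^ 4 + \<i> * (2 * S\<^sup>2 * C\<^sup>2)) (e * (2 * S ^ 3 * C * (1 - \<i>)))"
    unfolding rot_mult[OF mn]
  proof (rule arg_cong2[where f = "rot m n"])
    show "(C * C + \<i> * (S * S)) * (C * C + \<i> * (S * S)) - e * (S * C * (1 + \<i>)) * cnj (- (e * (S * C * (1 + \<i>))))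
        = 1 - 2 * S ^ 4 + \<i> * (2 * S\<^sup>2 * C\<^sup>2)"
      unfolding cnj_simps using ee' CS ii by algebra
    show "(C * C + \<i> * (S * S)) * - (e * (S * C * (1 + \<i>))) + e * (S * C * (1 + \<i>)) * cnj (C * C + \<i> * (S * S))
        = e * (2 * S ^ 3 * C * (1 - \<i>))"
      unfolding cnj_simps using ii by algebra
  qed
  show ?thesis
    by (simp only: \<alpha> \<beta> rot_exp_unit[OF t e] rot_exp_unit[OF t unit(1)] rot_exp_unit[OF t unit(2)]
        rot_exp_unit[OF t unit(3)] C_def[symmetric] S_def[symmetric] CD)
       (simp only: matrix_mul_assoc AB ABCD[unfolded matrix_mul_assoc])
qed

context bismut_frame
begin

text \<open>The disc solves \<open>F' = X(F)\<close> in complex time, so the real velocity along a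
  segment is a constant complex multiple of the field. Hence the coefficients of the transport
  equation are constant along it.\<close>

lemma integral_curve_segment:
  fixes z0 z1 :: complex
  assumes c: "c \<in> A" and FS: "\<And>z. z \<in> ball 0 \<rho> \<Longrightarrow> F z \<in> chart_range c"
    and F: "\<And>z. z \<in> ball 0 \<rho> \<Longrightarrow> (F has_derivative (\<lambda>h. h *s frame_in c (F z) x)) (at z)"
    and z: "z0 \<in> ball 0 \<rho>" "z1 \<in> ball 0 \<rho>"
  defines "\<gamma> \<equiv> \<lambda>t. chart_inv c (F (z0 + of_real t * (z1 - z0)))"
  shows "smooth_curve A \<gamma>"
    and "t \<in> {0..1} \<Longrightarrow> coframe (\<gamma> t) (velocity A \<gamma> t) = (z1 - z0) *s x"
proof -
  define aff where "aff t = z0 + of_real t * (z1 - z0)" for t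
  \<comment> \<open>The open parameter set asked for by \<open>smooth_curve\<close>; it contains the
    unit interval because the disc is convex.\<close>
  define S where "S = aff -` ball 0 \<rho>"
  have cont_aff: "continuous_on T aff" for T
    unfolding aff_def by (intro continuous_intros)
  have S: "open S" unfolding S_def
    using open_vimage[OF open_ball] cont_aff by blast
  have S01: "{0..1} \<subseteq> S"
  proof
    fix t :: real assume t: "t \<in> {0..1}"
    have "aff t = (1 - t) *\<^sub>R z0 + t *\<^sub>R z1"
      by (simp add: aff_def scaleR_conv_of_real algebra_simps)
    then show "t \<in> S"
      using convexD_alt[OF convex_ball z, of t] t by (simp add: S_def)
  qed
  have "smooth_on aff S"
    unfolding aff_def
    by (rule smooth_on_add[OF S smooth_on_const[OF S] smooth_on_bounded_linear[OF S]])
       (rule bounded_linear_compose[OF bounded_linear_mult_left bounded_linear_of_real])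
  moreover have "smooth_on F (ball 0 \<rho>)"
    by (rule integral_curve_smooth[OF chart_range_open[OF c] open_ball smooth_on_frame_in[OF c] FS F])
  ultimately have sm: "smooth_on (\<lambda>t. F (aff t)) S"
    by (rule smooth_on_compose[OF S open_ball]) (simp add: S_def)
  have FaS: "F (aff t) \<in> chart_range c" if "t \<in> S" for t
    using FS that by (simp add: S_def)
  have \<gamma>_eq: "\<gamma> t = chart_inv c (F (aff t))" for t by (simp add: \<gamma>_def aff_def)
  have \<gamma>_mem: "\<gamma> t \<in> fst c" "snd c (\<gamma> t) = F (aff t)" if "t \<in> S" for t
    using FaS[OF that] by (simp_all add: \<gamma>_eq chart_inv_mem snd_chart_inv)
  have cont: "continuous_on S \<gamma>"
    unfolding \<gamma>_eq[abs_def]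
    by (rule continuous_on_compose2[OF continuous_chart_inv[OF c] smooth_on_imp_continuous_on[OF sm]]) (use FaS in auto)
  have open_d: "open (S \<inter> \<gamma> -` fst d)" if "d \<in> A" for d
    by (rule continuous_open_preimage[OF cont S chart_open[OF that]])
  have trans: "(snd d \<circ> \<gamma>) t = transition c d (F (aff t))" for t d
    by (simp add: \<gamma>_eq transition_def)
  have smd: "smooth_on (snd d \<circ> \<gamma>) (S \<inter> \<gamma> -` fst d)" if d: "d \<in> A" for d
  proof -
    have mem: "F (aff t) \<in> snd c ` (fst c \<inter> fst d)" if "t \<in> S \<inter> \<gamma> -` fst d" for t
      using \<gamma>_mem[of t] that by (intro image_eqI[of _ _ "\<gamma> t"]) auto
    have "smooth_on (\<lambda>t. transition c d (F (aff t))) (S \<inter> \<gamma> -` fst d)"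
      by (rule smooth_on_compose[OF open_d[OF d] open_chart_image[OF c chart_open[OF d]]
            smooth_on_subset[OF sm] smooth_on_transition[OF c d] mem]) auto
    then show ?thesis using trans[abs_def] by (simp add: o_def)
  qed
  show curve: "smooth_curve A \<gamma>"
    unfolding smooth_curve_def using S S01 cont smd by blast
  show "coframe (\<gamma> t) (velocity A \<gamma> t) = (z1 - z0) *s x" if t: "t \<in> {0..1}"
  proof -
    define e where "e = chart_at A (\<gamma> t)"
    have e: "e \<in> A" "\<gamma> t \<in> fst e" unfolding e_def by (rule chart_at_mem)+
    have tS: "t \<in> S" using t S01 by blast
    note mem = \<gamma>_mem[OF tS]
    have "(aff has_derivative (\<lambda>h. 0 + of_real h * (z1 - z0))) (at t)"
      unfolding aff_def by (intro derivative_intros bounded_linear_imp_has_derivative bounded_linear_of_real)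
    from has_derivative_compose[OF this F]
    have "((\<lambda>s. F (aff s)) has_derivative (\<lambda>h. (0 + of_real h * (z1 - z0)) *s frame_in c (F (aff t)) x)) (at t)"
      using tS by (simp add: S_def)
    from has_derivative_compose[OF this transition_has_derivative[OF c e(1) mem(1) e(2), unfolded mem(2)]]
    have "((\<lambda>s. transition c e (F (aff s))) has_derivative
        (\<lambda>h. change c e (\<gamma> t) ((of_real h * (z1 - z0)) *s frame_in c (F (aff t)) x))) (at t)"
      by simp
    also have "(\<lambda>h. change c e (\<gamma> t) ((of_real h * (z1 - z0)) *s frame_in c (F (aff t)) x)) =
        (\<lambda>h. h *\<^sub>R change c e (\<gamma> t) ((z1 - z0) *s frame_in c (F (aff t)) x))"
      by (simp only: change_scale[OF c e(1) mem(1) e(2)] scaleR_eq_vector_smult vector_smult_assoc)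
    finally have "(snd e \<circ> \<gamma> has_vector_derivative change c e (\<gamma> t) ((z1 - z0) *s frame_in c (F (aff t)) x)) (at t)"
      using trans[of e] by (simp add: has_vector_derivative_def o_def)
    from vector_derivative_unique_at[OF smooth_curve_chart_derivative(1)[OF curve t, folded e_def] this]
    have "velocity A \<gamma> t = change c e (\<gamma> t) ((z1 - z0) *s frame_in c (snd c (\<gamma> t)) x)"
      by (simp add: mem(2))
    then have "coframe (\<gamma> t) (velocity A \<gamma> t) = coframe_in c (snd c (\<gamma> t)) ((z1 - z0) *s frame_in c (snd c (\<gamma> t)) x)"
      by (simp add: coframe_in_snd[OF c mem(1)] e_def)
    also have "\<dots> = (z1 - z0) *s x"
      by (simp only: mem(2) coframe_in_linear(1)[OF c FaS[OF tS]] coframe_in_frame_in[OF c FaS[OF tS]])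
    finally show ?thesis .
  qed
qed

text \<open>\<open>K\<close> converts the parameter of the rotation into the displacement in the
  disc; it is plus or minus the identity or the conjugation in the applications. Oddness makes the
  loop close and norm preservation keeps it in the disc.\<close>

lemma SU2_subset_frame_holonomy:
  assumes mn: "m \<noteq> n"
    and om: "\<And>w y. omega (K w *s axis a 1) y = - rot_gen m n w y"
    and K: "\<And>w. K (- w) = - K w" "\<And>w. cmod (K w) = cmod w"
    and \<alpha>\<beta>: "\<alpha> * cnj \<alpha> + \<beta> * cnj \<beta> = 1"
  shows "rot m n \<alpha> \<beta> \<in> frame_holonomy p"
proof -
  define c where "c = chart_at A p"
  have c: "c \<in> A" "p \<in> fst c" unfolding c_def by (rule chart_at_mem)+
  have y0: "snd c p \<in> chart_range c" using c by simp
  obtain \<rho> F where \<rho>: "\<rho> > 0" and F0: "F 0 = snd c p" and FS: "\<And>z. z \<in> ball 0 \<rho> \<Longrightarrow> F z \<in> chart_range c"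
    and F: "\<And>z. z \<in> ball 0 \<rho> \<Longrightarrow> (F has_derivative (\<lambda>h. h *s frame_in c (F z) (axis a 1))) (at z)"
    by (rule holomorphic_integral_curve[OF chart_range_open[OF c(1)] y0 holo_on_frame_in[OF c(1)]]) (rule that)
  define f where "f z = chart_inv c (F z)" for z
  have f0: "f 0 = p" by (simp add: f_def F0 chart_inv_snd[OF c])
  \<comment> \<open>Transports from \<open>p\<close> to the point \<open>f z\<close> of the disc, as
    matrices in the frames at both ends.\<close>
  define T where "T z = {M. transports A nabla p (f z) (\<lambda>v. frame (f z) (M *v coframe p v))}" for z
  have T0: "T 0 = frame_holonomy p"
    by (simp add: T_def f0 frame_holonomy_def holonomy_def)
  have mat1: "mat 1 \<in> T 0"
    using transports.const[of A nabla p] by (simp add: T_def f0 frame_coframe id_def)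
  have step: "rot_exp m n w 1 ** M \<in> T z1"
    if M: "M \<in> T z0" and z: "z0 \<in> ball 0 \<rho>" "z1 \<in> ball 0 \<rho>" "z1 - z0 = K w" for M z0 z1 w
  proof -
    define \<gamma> where "\<gamma> = (\<lambda>t. chart_inv c (F (z0 + of_real t * (z1 - z0))))"
    have seg: "smooth_curve A \<gamma>"
      "\<And>t. t \<in> {0..1} \<Longrightarrow> coframe (\<gamma> t) (velocity A \<gamma> t) = (z1 - z0) *s axis a 1"
      unfolding \<gamma>_def using integral_curve_segment[OF c(1) FS F z(1,2)] by blast+
    have ends: "\<gamma> 0 = f z0" "\<gamma> 1 = f z1" by (simp_all add: \<gamma>_def f_def)
    have "parallel_ode \<gamma> (\<lambda>t. rot_exp m n w t *v v)" for v
      unfolding parallel_ode_def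
    proof
      fix t :: real assume t: "t \<in> {0..1}"
      have "- omega (coframe (\<gamma> t) (velocity A \<gamma> t)) (rot_exp m n w t *v v) = rot_gen m n w (rot_exp m n w t *v v)"
        unfolding seg(2)[OF t] z(3) om by simp
      then show "((\<lambda>t. rot_exp m n w t *v v) has_vector_derivative
          - omega (coframe (\<gamma> t) (velocity A \<gamma> t)) (rot_exp m n w t *v v)) (at t within {0..1})"
        using rot_exp_has_vector_derivative[OF mn, of w v t] by (simp add: has_vector_derivative_at_within)
    qed
    then have ode: "\<exists>x. parallel_ode \<gamma> x \<and> x 0 = v \<and> x 1 = rot_exp m n w 1 *v v" for v
      by (intro exI[of _ "\<lambda>t. rot_exp m n w t *v v"]) (simp add: rot_exp_0[OF mn])
    have "transports A nabla p (\<gamma> 0) (\<lambda>v. frame (\<gamma> 0) (M *v coframe p v))"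
      using M by (simp add: ends T_def)
    from transports_ode[OF this seg(1) ode]
    show ?thesis
      by (simp add: T_def ends o_def coframe_frame matrix_vector_mul_assoc)
  qed
  have comm: "rot m n (Complex (1 - 2 * sin t ^ 4) (2 * (sin t)\<^sup>2 * (cos t)\<^sup>2))
      (e * (of_real (2 * sin t ^ 3 * cos t) * (1 - \<i>))) \<in> frame_holonomy p"
    if t: "0 \<le> t" "t < \<rho> / 2" and e: "cmod e = 1" for t e
  proof -
    define w w' where "w = complex_of_real t * e" and "w' = complex_of_real t * (\<i> * e)"
    have nw: "cmod (K w) = t" "cmod (K w') = t"
      using t e by (simp_all add: K w_def w'_def norm_mult)
    have nn: "K (complex_of_real t * - e) = - K w" "K (complex_of_real t * - (\<i> * e)) = - K w'"
      using K(1)[of w] K(1)[of w'] by (simp_all add: w_def w'_def)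
    \<comment> \<open>Transports compose from the left, so the sides are traversed in the reverse
      order of the factors. The vertices are \<open>0\<close>, \<open>- K w'\<close>,
      \<open>- K w' - K w\<close>, \<open>- K w\<close> and \<open>0\<close>, of norm at most
      \<open>2 * t\<close>, hence the bound \<open>\<rho> / 2\<close> on \<open>t\<close>.\<close>
    have 1: "rot_exp m n (of_real t * - (\<i> * e)) 1 ** mat 1 \<in> T (- K w')"
      by (rule step[OF mat1]) (use nw t \<rho> nn in auto)
    have 2: "rot_exp m n (of_real t * - e) 1 ** (rot_exp m n (of_real t * - (\<i> * e)) 1 ** mat 1) \<in> T (- K w' - K w)"
      using norm_triangle_ineq4[of "- K w'" "K w"] by (intro step[OF 1]) (use nw t \<rho> nn in auto)
    have 3: "rot_exp m n w' 1 ** (rot_exp m n (of_real t * - e) 1 ** (rot_exp m n (of_real t * - (\<i> * e)) 1 ** mat 1)) \<in> T (- K w)"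
      using norm_triangle_ineq4[of "- K w'" "K w"] by (intro step[OF 2]) (use nw t \<rho> nn in auto)
    have "rot_exp m n w 1 ** (rot_exp m n w' 1 ** (rot_exp m n (of_real t * - e) 1 ** (rot_exp m n (of_real t * - (\<i> * e)) 1 ** mat 1))) \<in> T 0"
      by (rule step[OF 3]) (use nw t \<rho> nn in auto)
    then show ?thesis
      using rot_exp_commutator[OF mn t(1) e] by (simp add: T0 w_def w'_def)
  qed
  have "complex_of_real ((cmod \<alpha>)\<^sup>2 + (cmod \<beta>)\<^sup>2) = 1"
    using \<alpha>\<beta> by (simp add: complex_norm_square del: of_real_power)
  then have unit: "(cmod \<alpha>)\<^sup>2 + (cmod \<beta>)\<^sup>2 = 1"
    unfolding of_real_eq_1_iff .
  show ?thesis
  proof (rule SU2_generated[where P = "\<lambda>\<alpha> \<beta>. rot m n \<alpha> \<beta> \<in> frame_holonomy p", OF _ _ comm unit])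
    show "\<rho> / 2 > 0" using \<rho> by simp
    show "rot m n (\<alpha> * \<alpha>' - \<beta> * cnj \<beta>') (\<alpha> * \<beta>' + \<beta> * cnj \<alpha>') \<in> frame_holonomy p"
      if "rot m n \<alpha> \<beta> \<in> frame_holonomy p" "rot m n \<alpha>' \<beta>' \<in> frame_holonomy p" for \<alpha> \<beta> \<alpha>' \<beta>'
      using frame_holonomy_mult[OF that] by (simp add: rot_mult[OF mn])
  qed
qed

end

section \<open>Complex-parallelizable solvable groups of dimension three\<close>

text \<open>By left-invariance a linear relation between the forms at one point holds at all points.\<close>

lemma (in complex_lie_group3) holomorphic_coframe_basis:
  assumes "basis_of_forms A G \<phi>"
  shows "holomorphic_coframe A \<phi>"
proof unfold_locales
  have mem: "\<phi> i \<in> left_inv_holo_forms A G" for i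
    using assms unfolding basis_of_forms_def by blast
  then show hol: "holomorphic_10_form A (\<phi> i)" for i
    unfolding left_inv_holo_forms_def by blast
  have inv: "\<phi> i (a \<otimes> p) (differential A (\<lambda>x. a \<otimes> x) p v) = \<phi> i p v" for i a p v
    using mem unfolding left_inv_holo_forms_def left_invariant_def by blast
  have lin: "Vector_Spaces.linear (*s) (*) (\<phi> i p)" for i p
    using hol[of i] unfolding holomorphic_10_form_def by blast
  then have lin': "\<phi> i p (u + v) = \<phi> i p u + \<phi> i p v" "\<phi> i p (k *s v) = k * \<phi> i p v" for i p u v k
    unfolding Vector_Spaces.linear_iff by simp_all
  fix p v assume v: "\<And>i. \<phi> i p v = 0"
  define N where "N = (\<chi> i j. \<phi> i p (axis j 1))"
  have expand: "\<phi> i p w = (\<Sum>j\<in>UNIV. N $ i $ j * w $ j)" for i w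
  proof -
    have "w = w $ 1 *s axis 1 1 + w $ 2 *s axis 2 1 + w $ 3 *s axis 3 1"
      using basis_expansion[of w] by (simp add: sum_3)
    then have "\<phi> i p w = \<phi> i p (w $ 1 *s axis 1 1 + w $ 2 *s axis 2 1 + w $ 3 *s axis 3 1)"
      by (rule arg_cong)
    then show ?thesis by (simp add: lin' sum_3 N_def mult.commute)
  qed
  show "v = 0"
  proof (rule ccontr)
    assume "v \<noteq> 0"
    moreover have "N *v v = 0"
      using v expand by (simp add: vec_eq_iff matrix_vector_mult_def)
    ultimately have "\<not> invertible N"
      using matrix_left_invertible_ker[of N] invertible_left_inverse[of N] by blast
    then have "\<not> invertible (transpose N)"
      by (simp add: invertible_det_nz)
    \<comment> \<open>A common zero of the three forms at \<open>p\<close> makes their matrix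
      singular, so some nonzero combination \<open>k\<close> of the forms vanishes at
      \<open>p\<close>.\<close>
    then obtain k where k: "transpose N *v k = 0" "k \<noteq> 0"
      using matrix_left_invertible_ker[of "transpose N"] invertible_left_inverse[of "transpose N"] by blast
    have at_p: "(\<Sum>i\<in>UNIV. k $ i * \<phi> i p w) = 0" for w
    proof -
      have "(\<Sum>i\<in>UNIV. k $ i * N $ i $ j) = 0" for j
        using k(1) by (simp add: vec_eq_iff matrix_vector_mult_def transpose_def mult.commute)
      then have "(\<Sum>j\<in>UNIV. (\<Sum>i\<in>UNIV. k $ i * N $ i $ j) * w $ j) = 0" by simp
      then show ?thesis
        unfolding expand by (simp add: sum_3 algebra_simps)
    qed
    have "(\<Sum>i\<in>UNIV. k $ i * \<phi> i q w) = 0" for q w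
    proof -
      \<comment> \<open>Left translation by \<open>p \<otimes> inv q\<close> carries
        \<open>q\<close> to \<open>p\<close>, which spreads the relation from \<open>p\<close> to
        all points.\<close>
      define u where "u = differential A (\<lambda>x. (p \<otimes> inv q) \<otimes> x) q w"
      have "(p \<otimes> inv q) \<otimes> q = p"
        by (simp add: carrier_UNIV m_assoc)
      then have "\<phi> i q w = \<phi> i p u" for i
        using inv[of i "p \<otimes> inv q" q w] by (simp only: u_def)
      then show ?thesis by (simp only: at_p)
    qed
    then have 1: "(\<lambda>p v. 0) = (\<lambda>p v. \<Sum>i\<in>UNIV. k $ i * \<phi> i p v)" by simp
    have 2: "(\<lambda>p v. 0) = (\<lambda>p v. \<Sum>i\<in>UNIV. (0 :: complex^3) $ i * \<phi> i p v)" by simp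
    have "(\<lambda>p v. 0) \<in> left_inv_holo_forms A G"
    proof -
      have "Vector_Spaces.linear (*s) (*) (\<lambda>v :: complex^3. 0 :: complex)"
        using lin[of 1 p] unfolding Vector_Spaces.linear_iff by simp
      then show ?thesis
        unfolding left_inv_holo_forms_def holomorphic_10_form_def left_invariant_def form_in_def Let_def
        using holo_on_const by auto
    qed
    \<comment> \<open>The zero form now has the coefficients \<open>k\<close> and \<open>0\<close>,
      against uniqueness of coefficients in a basis.\<close>
    with assms have "\<exists>!k::complex^3. (\<lambda>p v. 0) = (\<lambda>p v. \<Sum>i\<in>UNIV. k $ i * \<phi> i p v)"
      unfolding basis_of_forms_def by blast
    with 1 2 have "k = 0" by blast
    with k(2) show False by simp
  qed
qed

text \<open>The two coordinate pairs share \<open>c\<close>, which is the configuration that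
  generates SU(3). What remains for a given group is to find two frame vectors on which
  \<open>omega\<close> is an off-diagonal rotation generator.\<close>

lemma (in bismut_frame) holonomy_is_SU3I:
  assumes abc: "a \<noteq> b'" "a \<noteq> c" "b' \<noteq> c"
    and K1: "\<And>w y. omega (K1 w *s axis i 1) y = - rot_gen a c w y" "\<And>w. K1 (- w) = - K1 w" "\<And>w. cmod (K1 w) = cmod w"
    and K2: "\<And>w y. omega (K2 w *s axis j 1) y = - rot_gen b' c w y" "\<And>w. K2 (- w) = - K2 w" "\<And>w. cmod (K2 w) = cmod w"
  shows "\<exists>g. hermitian_metric A g \<and> (\<exists>nab. bismut_connection A g nab \<and> holonomy_is_SU3 A g nab)"
proof -
  have "SU3 \<subseteq> frame_holonomy p" for p
    using SU3_generated[OF frame_holonomy_mult abc SU2_subset_frame_holonomy[OF abc(2) K1]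
        SU2_subset_frame_holonomy[OF abc(3) K2]] by blast
  then have "holonomy_is_SU3 A metric nabla"
    by (rule holonomy_is_SU3_metric)
  then show ?thesis
    using hermitian_metric_metric bismut_connection_nabla by blast
qed

theorem theorem4p1:
  fixes A :: "'g::{t2_space,second_countable_topology} chart set"
    and G :: "'g monoid"
    and \<phi> :: "3 \<Rightarrow> 'g form1"
  assumes "complex_lie_group3 A G"
    and "simply_connected (UNIV :: 'g set)"
    and "basis_of_forms A G \<phi>"
    and "(ext_deriv A (\<phi> 1) = (\<lambda>p u v. 0) \<and>
          ext_deriv A (\<phi> 2) = (\<lambda>p u v. 0) \<and>
          ext_deriv A (\<phi> 3) = wedge (\<phi> 1) (\<phi> 2))
       \<or> (ext_deriv A (\<phi> 1) = (\<lambda>p u v. 0) \<and>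
          ext_deriv A (\<phi> 2) = wedge (\<phi> 1) (\<phi> 2) \<and>
          ext_deriv A (\<phi> 3) = (\<lambda>p u v. - wedge (\<phi> 1) (\<phi> 3) p u v))"
  shows "\<exists>g. hermitian_metric A g \<and>
           (\<exists>nab. bismut_connection A g nab \<and> holonomy_is_SU3 A g nab)"
proof -
  have coframe: "holomorphic_coframe A \<phi>"
    by (rule complex_lie_group3.holomorphic_coframe_basis[OF assms(1,3)])
  interpret holomorphic_coframe A \<phi> by (rule coframe)
  note vec3 = vec_eq_iff forall_3 sum_3 axis_def
  from assms(4) show ?thesis
  proof
    assume d: "ext_deriv A (\<phi> 1) = (\<lambda>p u v. 0) \<and> ext_deriv A (\<phi> 2) = (\<lambda>p u v. 0) \<and>
        ext_deriv A (\<phi> 3) = wedge (\<phi> 1) (\<phi> 2)"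
    \<comment> \<open>The Lie bracket dual to the structure equations,
      \<open>\<phi>([u, v]) = - d\<phi>(u, v)\<close>; its only nonzero bracket of basis vectors, up
      to order, is that of the first two, minus the third.\<close>
    define b :: "complex^3 \<Rightarrow> complex^3 \<Rightarrow> complex^3" where
      "b x y = (\<chi> i. if i = 3 then x $ 2 * y $ 1 - x $ 1 * y $ 2 else 0)" for x y
    interpret bismut_frame A \<phi> b
    proof unfold_locales
      show "ext_deriv A (\<phi> i) p u v = - b (coframe p u) (coframe p v) $ i" for i p u v
        using exhaust_3[of i] d by (elim disjE) (simp_all add: b_def coframe_def wedge_def)
    qed (simp_all add: b_def vec3 algebra_simps)
    show ?thesis
      \<comment> \<open>The third vector is central and \<open>omega\<close> vanishes on it. The
        adjoint action of the first vector maps coordinate 2 to 3 and that of the second maps 1 to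
        3. Comparing with \<open>rot_gen\<close>, whose parameter sits in the opposite entry,
        introduces the conjugations in \<open>K1\<close> and \<open>K2\<close>.\<close>
      by (rule holonomy_is_SU3I[where a = 2 and b' = 1 and c = 3 and i = 1 and j = 2 and ?K1.0 = "\<lambda>w. - cnj w" and ?K2.0 = cnj])
         (simp_all add: omega_def b_adj_def rot_gen_def b_def vec3)
  next
    assume d: "ext_deriv A (\<phi> 1) = (\<lambda>p u v. 0) \<and> ext_deriv A (\<phi> 2) = wedge (\<phi> 1) (\<phi> 2) \<and>
        ext_deriv A (\<phi> 3) = (\<lambda>p u v. - wedge (\<phi> 1) (\<phi> 3) p u v)"
    define b :: "complex^3 \<Rightarrow> complex^3 \<Rightarrow> complex^3" where
      \<comment> \<open>The opposite signs in the two structure equations make the adjoint action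
        traceless.\<close>
      "b x y = (\<chi> i. if i = 2 then x $ 2 * y $ 1 - x $ 1 * y $ 2 else if i = 3 then x $ 1 * y $ 3 - x $ 3 * y $ 1 else 0)" for x y
    interpret bismut_frame A \<phi> b
    proof unfold_locales
      show "ext_deriv A (\<phi> i) p u v = - b (coframe p u) (coframe p v) $ i" for i p u v
        using exhaust_3[of i] d by (elim disjE) (simp_all add: b_def coframe_def wedge_def)
    qed (simp_all add: b_def vec3 algebra_simps)
    show ?thesis
      \<comment> \<open>The first vector acts diagonally, so the other two are used: they map
        coordinate 1 to 2 and to 3. The shared coordinate 1 is listed second, so the parameter sits
        in the complex linear entry and no conjugation appears.\<close>
      by (rule holonomy_is_SU3I[where a = 2 and b' = 3 and c = 1 and i = 2 and j = 3 and ?K1.0 = "\<lambda>w. - w" and ?K2.0 = "\<lambda>w. w"])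
         (simp_all add: omega_def b_adj_def rot_gen_def b_def vec3)
  qed
qed

end
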